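(* Let $z_h^{rt}\in\mathcal{R}T^0(\mathcal{T}_h)$ be a discrete dual solution (a maximizer of $D_h^{rt}$) and let $\overline\lambda_h\in\mathcal{L}^0(\mathcal{T}_h)$ be a Lagrange multiplier such that for every $(y_h,\overline\eta_h)\in\mathcal{R}T^0_N(\mathcal{T}_h)\times\mathcal{L}^0(\mathcal{T}_h)$, $$-(D_t\phi_h^*(\cdot,\Pi_hz_h^{rt}),\Pi_hy_h)_\Omega-(\overline\lambda_h,\operatorname{div}y_h)_\Omega=-(y_h\cdot n,u_D^h)_{\Gamma_D},$$ $$(\operatorname{div}z_h^{rt},\overline\eta_h)_\Omega=-(f_h,\overline\eta_h)_\Omega.$$ Then the discrete primal solution $u_h^{cr}\in\mathcal{S}^{1,cr}(\mathcal{T}_h)$ (the unique minimizer of $I_h^{cr}$) is given by the inverse generalized Marini formula $$u_h^{cr}=\overline\lambda_h+D_t\phi_h^*(\cdot,\Pi_hz_h^{rt})\cdot(\mathrm{id}_{\mathbb{R}^d}-\Pi_h\mathrm{id}_{\mathbb{R}^d})\quad\text{a.e. in }\Omega.$$ In particular, $\Pi_hu_h^{cr}=\overline\lambda_h$ a.e. in $\Omega$.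
   Context: Let $\Omega\subseteq\mathbb{R}^d$, $d\in\mathbb{N}$, be a bounded simplicial Lipschitz domain with $\partial\Omega=\overline\Gamma_D\cup\overline\Gamma_N$, $\Gamma_D,\Gamma_N$ disjoint and relatively open, $|\Gamma_D|>0$. $\mathcal{T}_h$ is a (shape-regular, conforming) simplicial triangulation of $\Omega$; $\mathcal{S}_h$ is the set of its sides (($d-1$)-dimensional faces), $\mathcal{S}_h^i$ the interior sides, $\mathcal{S}_h^{\Gamma_D},\mathcal{S}_h^{\Gamma_N}$ the boundary sides whose relative interior lies in $\Gamma_D$, resp. $\Gamma_N$; every boundary side belongs to exactly one of these two sets. $(v,w)_\omega=\int_\omega v\cdot w$; $\|\cdot\|_{p,\omega}$ is the $L^p(\omega)$-norm. $\mathcal{L}^k(\mathcal{T}_h)$ are the element-wise polynomials of degree $\le k$; $\mathcal{L}^0(\mathcal{S}_h^{\gamma})$ the side-wise constant functions on $\mathcal{S}_h^\gamma$. $\Pi_h$ is the $L^2$-projection onto element-wise constants (element averages, component-wise for vector fields; $\mathrm{id}_{\mathbb{R}^d}$ is the field $x\mapsto x$), $\pi_h$ the projection onto side-wise constants (side averages). $\nabla_h$ is the element-wise gradient. $\mathcal{S}^{1,cr}(\mathcal{T}_h)=\{v_h\in\mathcal{L}^1(\mathcal{T}_h):$ the side average of the jump of $v_h$ vanishes on every interior side$\}$ (Crouzeix–Raviart). $\mathcal{R}T^0(\mathcal{T}_h)=\{y_h\in(\mathcal{L}^1(\mathcal{T}_h))^d: y_h|_T\cdot n_T$ is constant on each side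 of each $T\in\mathcal{T}_h$ and the normal jump of $y_h$ vanishes on every interior side$\}$ (lowest-order Raviart–Thomas; on each $T$, $y_h(x)=a_T+b_Tx$ with $a_T\in\mathbb{R}^d,b_T\in\mathbb{R}$). $\mathcal{R}T^0_N(\mathcal{T}_h)=\{y_h\in\mathcal{R}T^0(\mathcal{T}_h):y_h\cdot n=0\text{ a.e. on }\Gamma_N\}$. $n$ is the outward unit normal on $\partial\Omega$. Data: $f_h\in\mathcal{L}^0(\mathcal{T}_h)$, $g_h\in\mathcal{L}^0(\mathcal{S}_h^{\Gamma_N})$, $\zeta_h\in\mathcal{L}^0(\mathcal{T}_h)$ with $\operatorname{ess\,inf}_\Omega\zeta_h>0$, $u_D^h\in\mathcal{L}^0(\mathcal{S}_h^{\Gamma_D})$ such that there exists $\widehat u_D^h\in\mathcal{S}^{1,cr}(\mathcal{T}_h)$ with $\pi_h\widehat u_D^h=u_D^h$ on $\Gamma_D$ and $\|\nabla_h\widehat u_D^h/\zeta_h\|_{\infty,\Omega}<1$. For a.e. $x$ and $s\in\mathbb{R}^d$: $\phi_h^*(x,s)=\frac12|s|^2$ if $|s|\le\zeta_h(x)$, $\phi_h^*(x,s)=\zeta_h(x)|s|-\frac12\zeta_h(x)^2$ if $|s|>\zeta_h(x)$; its gradient in the second argument is $D_t\phi_h^*(x,s)=s$ if $|s|\le\zeta_h(x)$ and $\zeta_h(x)s/|s|$ if $|s|>\zeta_h(x)$. Discrete primal problem: $K_h^{cr}=\{v_h\in\mathcal{S}^{1,cr}(\mathcal{T}_h):|\nabla_hv_h|\le\zeta_h\text{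 a.e. in }\Omega,\ \pi_hv_h=u_D^h\text{ a.e. on }\Gamma_D\}$; $I_h^{cr}(v_h)=\frac12\|\nabla_hv_h\|_{2,\Omega}^2-(f_h,\Pi_hv_h)_\Omega-(g_h,\pi_hv_h)_{\Gamma_N}$ if $v_h\in K_h^{cr}$ and $+\infty$ for other $v_h\in\mathcal{S}^{1,cr}(\mathcal{T}_h)$. It has a unique minimizer $u_h^{cr}$. Discrete dual functional: $K_h^{rt,*}=\{y_h\in\mathcal{R}T^0(\mathcal{T}_h):\operatorname{div}y_h=-f_h\text{ a.e. in }\Omega,\ y_h\cdot n=g_h\text{ a.e. on }\Gamma_N\}$; $D_h^{rt}(y_h)=-\int_\Omega\phi_h^*(\cdot,\Pi_hy_h)\,\mathrm{d}x+(y_h\cdot n,u_D^h)_{\Gamma_D}$ if $y_h\in K_h^{rt,*}$ and $-\infty$ for other $y_h\in\mathcal{R}T^0(\mathcal{T}_h)$. *)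

theory Defs
  imports "HOL-Analysis.Analysis" "HOL-Probability.Essential_Supremum"
begin

text \<open>
  Functions on the domain are functions on the whole space, read up to equality almost everywhere
  in the domain.  Element-wise polynomials are prescribed on the (open) interiors of the elements
  only; their values on the union of the sides, a null set, are arbitrary.
\<close>

section \<open>Domain, triangulation and sides\<close>

text \<open>Locally, up to a rigid motion, the domain is the strict subgraph of a Lipschitz function
  defined on the hyperplane orthogonal to \<open>\<nu>\<close>.\<close>

definition lipschitz_domain :: "'a::euclidean_space set \<Rightarrow> bool" where
  "lipschitz_domain \<Omega> \<longleftrightarrow> \<Omega> \<noteq> {} \<and> open \<Omega> \<and> connected \<Omega> \<and>
     (\<forall>x\<in>frontier \<Omega>. \<exists>\<nu> r L \<gamma>. norm \<nu> = 1 \<and> r > 0 \<and> L-lipschitz_on {y. y \<bullet> \<nu> = 0} \<gamma> \<and>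
        \<Omega> \<inter> ball x r =
          {y \<in> ball x r. (y - x) \<bullet> \<nu> < \<gamma> ((y - x) - ((y - x) \<bullet> \<nu>) *\<^sub>R \<nu>)})"

text \<open>The library predicate \<^const>\<open>triangulation\<close> contains finiteness and conformity (two elements
  meet in a common face).  Shape regularity is a uniformity condition on a family of triangulations;
  a single finite set of nondegenerate simplices satisfies it with some constant, so that it is no
  condition on one \<open>\<T>\<close>.\<close>

definition triangulation_of :: "'a::euclidean_space set \<Rightarrow> 'a set set \<Rightarrow> bool" where
  "triangulation_of \<Omega> \<T> \<longleftrightarrow>
     triangulation \<T> \<and> (\<forall>T\<in>\<T>. int DIM('a) simplex T) \<and> \<Union>\<T> = closure \<Omega>"

definition sides :: "'a::euclidean_space set set \<Rightarrow> 'a set set" where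
  "sides \<T> = {S. \<exists>T\<in>\<T>. S facet_of T}"

definition interior_sides :: "'a::euclidean_space set \<Rightarrow> 'a set set \<Rightarrow> 'a set set" where
  "interior_sides \<Omega> \<T> = {S \<in> sides \<T>. \<not> S \<subseteq> frontier \<Omega>}"

definition boundary_sides :: "'a::euclidean_space set \<Rightarrow> 'a set set \<Rightarrow> 'a set set" where
  "boundary_sides \<Omega> \<T> = {S \<in> sides \<T>. S \<subseteq> frontier \<Omega>}"

definition sides_on :: "'a::euclidean_space set \<Rightarrow> 'a set set \<Rightarrow> 'a set \<Rightarrow> 'a set set" where
  "sides_on \<Omega> \<T> \<Gamma> = {S \<in> boundary_sides \<Omega> \<T>. rel_interior S \<subseteq> \<Gamma>}"

text \<open>Used for boundary sides, which belong to exactly one element.\<close>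

definition side_element :: "'a::euclidean_space set set \<Rightarrow> 'a set \<Rightarrow> 'a set" where
  "side_element \<T> S = (THE T. T \<in> \<T> \<and> S facet_of T)"

definition outer_normal :: "'a::euclidean_space set \<Rightarrow> 'a set \<Rightarrow> 'a" where
  "outer_normal T S = (THE n. norm n = 1 \<and> (\<forall>x\<in>S. \<forall>y\<in>T. n \<bullet> (y - x) \<le> 0))"

text \<open>The \<open>(d-1)\<close>-dimensional surface measure of a side \<open>S\<close>: the image of the Lebesgue measure on the
  right prism of height \<open>1\<close> with mid-section \<open>S\<close> under orthogonal projection onto the hyperplane
  spanned by \<open>S\<close>.  By Fubini's theorem this is the \<open>(d-1)\<close>-dimensional Lebesgue measure of that
  hyperplane, restricted to \<open>S\<close>; for \<open>d = 1\<close> it is the unit mass at the point of \<open>S\<close>.\<close>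

definition side_measure :: "'a::euclidean_space set \<Rightarrow> 'a measure" where
  "side_measure S =
     (let P = closest_point (affine hull S)
      in distr (restrict_space lborel {z. P z \<in> S \<and> dist z (P z) \<le> 1/2}) borel P)"

definition surface_area :: "'a::euclidean_space set \<Rightarrow> 'a set set \<Rightarrow> 'a set \<Rightarrow> real" where
  "surface_area \<Omega> \<T> \<Gamma> = (\<Sum>S\<in>boundary_sides \<Omega> \<T>. measure (side_measure S) \<Gamma>)"

definition boundary_decomposition ::
  "'a::euclidean_space set \<Rightarrow> 'a set set \<Rightarrow> 'a set \<Rightarrow> 'a set \<Rightarrow> bool" where
  "boundary_decomposition \<Omega> \<T> \<Gamma>D \<Gamma>N \<longleftrightarrow>
     frontier \<Omega> = closure \<Gamma>D \<union> closure \<Gamma>N \<and> \<Gamma>D \<inter> \<Gamma>N = {} \<and>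
     openin (top_of_set (frontier \<Omega>)) \<Gamma>D \<and> openin (top_of_set (frontier \<Omega>)) \<Gamma>N \<and>
     surface_area \<Omega> \<T> \<Gamma>D > 0 \<and>
     (\<forall>S\<in>boundary_sides \<Omega> \<T>. (S \<in> sides_on \<Omega> \<T> \<Gamma>D) \<noteq> (S \<in> sides_on \<Omega> \<T> \<Gamma>N))"


section \<open>Element-wise calculus\<close>

definition L2_inner ::
  "'a::euclidean_space set \<Rightarrow> ('a \<Rightarrow> 'b::real_inner) \<Rightarrow> ('a \<Rightarrow> 'b) \<Rightarrow> real" where
  "L2_inner \<Omega> v w = (LINT x|lebesgue_on \<Omega>. v x \<bullet> w x)"

definition grad :: "('a::euclidean_space \<Rightarrow> real) \<Rightarrow> 'a \<Rightarrow> 'a" where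
  "grad v x = (\<Sum>b\<in>Basis. frechet_derivative v (at x) b *\<^sub>R b)"

definition divergence :: "('a::euclidean_space \<Rightarrow> 'a) \<Rightarrow> 'a \<Rightarrow> real" where
  "divergence y x = (\<Sum>b\<in>Basis. frechet_derivative y (at x) b \<bullet> b)"

text \<open>The value of \<open>v\<close> restricted to \<open>T\<close> at a point of \<open>T\<close>, in particular of a side of \<open>T\<close>.\<close>

definition elem_trace ::
  "'a::euclidean_space set \<Rightarrow> ('a \<Rightarrow> 'b::t2_space) \<Rightarrow> 'a \<Rightarrow> 'b" where
  "elem_trace T v x = Lim (at x within interior T) v"

definition normal_trace :: "'a::euclidean_space set \<Rightarrow> 'a set \<Rightarrow> ('a \<Rightarrow> 'a) \<Rightarrow> 'a \<Rightarrow> real" where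
  "normal_trace T S y x = elem_trace T y x \<bullet> outer_normal T S"

definition boundary_flux ::
  "'a::euclidean_space set set \<Rightarrow> 'a set \<Rightarrow> ('a \<Rightarrow> 'a) \<Rightarrow> 'a \<Rightarrow> real" where
  "boundary_flux \<T> S = normal_trace (side_element \<T> S) S"

definition side_average :: "'a::euclidean_space set \<Rightarrow> ('a \<Rightarrow> real) \<Rightarrow> real" where
  "side_average S w = (LINT x|side_measure S. w x) / measure (side_measure S) S"

text \<open>Side-wise constant functions, such as \<open>\<pi>\<^sub>h v\<close> and the boundary data, are functions from
  sides to values; \<open>side_proj\<close> is used on boundary sides.  Accordingly, integrals over a boundary
  part are sums over the sides whose relative interior lies in it.\<close>

definition side_proj :: "'a::euclidean_space set set \<Rightarrow> ('a \<Rightarrow> real) \<Rightarrow> 'a set \<Rightarrow> real" where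
  "side_proj \<T> v S = side_average S (elem_trace (side_element \<T> S) v)"

definition elem_proj ::
  "'a::euclidean_space set set \<Rightarrow> ('a \<Rightarrow> 'b::euclidean_space) \<Rightarrow> 'a \<Rightarrow> 'b" where
  "elem_proj \<T> v x = (\<Sum>T\<in>\<T>. indicat_real (interior T) x *\<^sub>R
     ((LINT t|lebesgue_on T. v t) /\<^sub>R measure lebesgue T))"


section \<open>Finite element spaces\<close>

definition L0 :: "'a::euclidean_space set set \<Rightarrow> ('a \<Rightarrow> real) set" where
  "L0 \<T> = {v. \<forall>T\<in>\<T>. \<exists>c. \<forall>x\<in>interior T. v x = c}"

definition L1 :: "'a::euclidean_space set set \<Rightarrow> ('a \<Rightarrow> real) set" where
  "L1 \<T> = {v. \<forall>T\<in>\<T>. \<exists>a c. \<forall>x\<in>interior T. v x = a \<bullet> x + c}"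

definition CR :: "'a::euclidean_space set \<Rightarrow> 'a set set \<Rightarrow> ('a \<Rightarrow> real) set" where
  "CR \<Omega> \<T> = {v \<in> L1 \<T>. \<forall>S\<in>interior_sides \<Omega> \<T>. \<forall>T\<in>\<T>. \<forall>T'\<in>\<T>.
     T \<noteq> T' \<and> S facet_of T \<and> S facet_of T' \<longrightarrow>
       side_average S (\<lambda>x. elem_trace T v x - elem_trace T' v x) = 0}"

definition RT :: "'a::euclidean_space set \<Rightarrow> 'a set set \<Rightarrow> ('a \<Rightarrow> 'a) set" where
  "RT \<Omega> \<T> = {y. (\<forall>b\<in>Basis. (\<lambda>x. y x \<bullet> b) \<in> L1 \<T>) \<and>
     (\<forall>T\<in>\<T>. \<forall>S. S facet_of T \<longrightarrow> (\<exists>c. \<forall>x\<in>S. normal_trace T S y x = c)) \<and>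
     (\<forall>S\<in>interior_sides \<Omega> \<T>. \<forall>T\<in>\<T>. \<forall>T'\<in>\<T>.
        T \<noteq> T' \<and> S facet_of T \<and> S facet_of T' \<longrightarrow>
          (\<forall>x\<in>S. normal_trace T S y x + normal_trace T' S y x = 0))}"

definition RT_N :: "'a::euclidean_space set \<Rightarrow> 'a set set \<Rightarrow> 'a set \<Rightarrow> ('a \<Rightarrow> 'a) set" where
  "RT_N \<Omega> \<T> \<Gamma>N = {y \<in> RT \<Omega> \<T>.
     \<forall>S\<in>sides_on \<Omega> \<T> \<Gamma>N. AE x in side_measure S. boundary_flux \<T> S y x = 0}"

definition flux_pairing ::
  "'a::euclidean_space set \<Rightarrow> 'a set set \<Rightarrow> 'a set \<Rightarrow> ('a \<Rightarrow> 'a) \<Rightarrow> ('a set \<Rightarrow> real) \<Rightarrow> real" where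
  "flux_pairing \<Omega> \<T> \<Gamma> y u =
     (\<Sum>S\<in>sides_on \<Omega> \<T> \<Gamma>. LINT x|side_measure S. boundary_flux \<T> S y x * u S)"

definition side_pairing ::
  "'a::euclidean_space set \<Rightarrow> 'a set set \<Rightarrow> 'a set \<Rightarrow> ('a set \<Rightarrow> real) \<Rightarrow> ('a set \<Rightarrow> real) \<Rightarrow> real" where
  "side_pairing \<Omega> \<T> \<Gamma> g u = (\<Sum>S\<in>sides_on \<Omega> \<T> \<Gamma>. LINT x|side_measure S. g S * u S)"


section \<open>Discrete primal and dual problems\<close>

definition phi_star :: "('a::euclidean_space \<Rightarrow> real) \<Rightarrow> 'a \<Rightarrow> 'a \<Rightarrow> real" where
  "phi_star \<zeta> x s =
     (if norm s \<le> \<zeta> x then (norm s)\<^sup>2 / 2 else \<zeta> x * norm s - (\<zeta> x)\<^sup>2 / 2)"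

definition Dt_phi_star :: "('a::euclidean_space \<Rightarrow> real) \<Rightarrow> 'a \<Rightarrow> 'a \<Rightarrow> 'a" where
  "Dt_phi_star \<zeta> x s = (if norm s \<le> \<zeta> x then s else (\<zeta> x / norm s) *\<^sub>R s)"

definition K_cr ::
  "'a::euclidean_space set \<Rightarrow> 'a set set \<Rightarrow> 'a set \<Rightarrow> ('a \<Rightarrow> real) \<Rightarrow> ('a set \<Rightarrow> real) \<Rightarrow>
   ('a \<Rightarrow> real) set" where
  "K_cr \<Omega> \<T> \<Gamma>D \<zeta> uD = {v \<in> CR \<Omega> \<T>.
     (AE x in lebesgue_on \<Omega>. norm (grad v x) \<le> \<zeta> x) \<and>
     (\<forall>S\<in>sides_on \<Omega> \<T> \<Gamma>D. side_proj \<T> v S = uD S)}"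

definition I_cr ::
  "'a::euclidean_space set \<Rightarrow> 'a set set \<Rightarrow> 'a set \<Rightarrow> 'a set \<Rightarrow> ('a \<Rightarrow> real) \<Rightarrow> ('a \<Rightarrow> real) \<Rightarrow>
   ('a set \<Rightarrow> real) \<Rightarrow> ('a set \<Rightarrow> real) \<Rightarrow> ('a \<Rightarrow> real) \<Rightarrow> ereal" where
  "I_cr \<Omega> \<T> \<Gamma>D \<Gamma>N \<zeta> f g uD v =
     (if v \<in> K_cr \<Omega> \<T> \<Gamma>D \<zeta> uD
      then ereal ((1/2) * (LINT x|lebesgue_on \<Omega>. (norm (grad v x))\<^sup>2)
        - L2_inner \<Omega> f (elem_proj \<T> v)
        - side_pairing \<Omega> \<T> \<Gamma>N g (side_proj \<T> v))
      else \<infinity>)"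

definition K_rt ::
  "'a::euclidean_space set \<Rightarrow> 'a set set \<Rightarrow> 'a set \<Rightarrow> ('a \<Rightarrow> real) \<Rightarrow> ('a set \<Rightarrow> real) \<Rightarrow>
   ('a \<Rightarrow> 'a) set" where
  "K_rt \<Omega> \<T> \<Gamma>N f g = {y \<in> RT \<Omega> \<T>.
     (AE x in lebesgue_on \<Omega>. divergence y x = - f x) \<and>
     (\<forall>S\<in>sides_on \<Omega> \<T> \<Gamma>N. AE x in side_measure S. boundary_flux \<T> S y x = g S)}"

definition D_rt ::
  "'a::euclidean_space set \<Rightarrow> 'a set set \<Rightarrow> 'a set \<Rightarrow> 'a set \<Rightarrow> ('a \<Rightarrow> real) \<Rightarrow> ('a \<Rightarrow> real) \<Rightarrow>
   ('a set \<Rightarrow> real) \<Rightarrow> ('a set \<Rightarrow> real) \<Rightarrow> ('a \<Rightarrow> 'a) \<Rightarrow> ereal" where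
  "D_rt \<Omega> \<T> \<Gamma>D \<Gamma>N \<zeta> f g uD y =
     (if y \<in> K_rt \<Omega> \<T> \<Gamma>N f g
      then ereal (- (LINT x|lebesgue_on \<Omega>. phi_star \<zeta> x (elem_proj \<T> y x))
        + flux_pairing \<Omega> \<T> \<Gamma>D y uD)
      else - \<infinity>)"

end

theory Submission
  imports Defs
begin

text \<open>On an element \<open>T\<close> a Raviart-Thomas field is the combination
\<open>\<Sum>\<^sub>S (F T S / h\<^sub>S) (x - p\<^sub>S)\<close> over the facets \<open>S\<close> of \<open>T\<close>, where \<open>p\<^sub>S\<close> is the vertex opposite to
\<open>S\<close>, \<open>h\<^sub>S\<close> its distance from the hyperplane of \<open>S\<close>, and \<open>F T S\<close> the normal flux through \<open>S\<close>.
Integration by parts of one such term against an affine function \<open>v\<close> compares the mean of \<open>v\<close> over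
\<open>T\<close> with the mean over \<open>S\<close>; it amounts to the cone formula \<open>d |T| = h\<^sub>S |S|\<close> together with the fact
that centroids are averages of vertices (\<open>facet_field_green\<close>).  Summed over the mesh, it turns the volume
integrals of \<open>\<nabla>v \<bullet> y + v div y\<close> into fluxes times side averages.

Let \<open>v\<close> be the right-hand side of the Marini formula, and \<open>s\<close> its element-wise gradient
\<open>D\<^sub>t\<phi>*(\<cdot>, \<Pi>z)\<close>.  Testing the multiplier equation with the field whose only fluxes are \<open>1\<close> and \<open>-1\<close>
on the two sides of one interior facet shows that the average of the jump of \<open>v\<close> vanishes there, and
testing with a field that has a single flux through a facet in \<open>\<Gamma>D\<close> identifies the
average of \<open>v\<close> with the boundary datum (\<open>multiplier_reconstruction_CR\<close>).  Hence \<open>v\<close> is admissible for the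
primal problem, because \<open>|s| \<le> \<zeta>\<close>.

A dual maximizer satisfies the divergence and flux constraints, since some
Raviart-Thomas field does (\<open>exists_flux_with_div\<close>).  Integration by parts with \<open>z\<close> therefore rewrites the
primal energy of every admissible \<open>w\<close> as a constant plus the sum over \<open>T\<close> of
\<open>|T| (|\<nabla>w|\<^sup>2 / 2 - \<nabla>w \<bullet> \<Pi>z)\<close> (\<open>primal_energy_eq\<close>).  Under the constraint \<open>|\<nabla>w| \<le> \<zeta>\<close> each summand
is minimized exactly by the projection of \<open>\<Pi>z\<close> onto the ball of radius \<open>\<zeta>\<close>, and this
projection is \<open>D\<^sub>t\<phi>*(\<cdot>, \<Pi>z) = s\<close>.  So the minimizer \<open>u\<close> has the gradient of \<open>v\<close>.  The difference \<open>u - v\<close> is then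
constant on each element, takes equal values across interior facets and vanishes next to \<open>\<Gamma>D\<close>.

The last step, and the existence of an admissible field, propagate information from element to
element.  Both rest on \<open>side_connected\<close>: any two elements of the mesh of a connected domain are
linked by a chain in which consecutive elements share an interior facet.\<close>

section \<open>Lebesgue measure under linear maps\<close>

text \<open>Uniqueness of the translation-invariant measure up to a factor: by Fubini's theorem the double integral of
\<open>1\<^sub>A(x) 1\<^sub>B(x + y)\<close> equals one side when integrated over \<open>y\<close> first, and the other after the substitution
\<open>x \<mapsto> x - y\<close>.\<close>

lemma translation_invariant_measure_proportional:
  fixes \<mu> :: "'a::euclidean_space measure"
  assumes sets [measurable_cong]: "sets \<mu> = sets borel" and "sigma_finite_measure \<mu>"
    and inv: "\<And>a. distr \<mu> borel ((+) a) = \<mu>"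
    and A [measurable]: "A \<in> sets borel" and B [measurable]: "B \<in> sets borel"
  shows "emeasure \<mu> A * emeasure lborel B = emeasure \<mu> B * emeasure lborel A"
proof -
  interpret sigma_finite_measure \<mu> by fact
  interpret P: pair_sigma_finite \<mu> lborel
    by (intro pair_sigma_finite.intro sigma_finite_lborel assms)
  have refl: "distr lborel borel (\<lambda>y. x - y) = (lborel :: 'a measure)" for x
    using lborel_affine[of "-1" x] by (simp add: density_1)
  have "emeasure \<mu> A * emeasure lborel B
      = (\<integral>\<^sup>+x. \<integral>\<^sup>+y. indicator A x * indicator B (x + y) \<partial>lborel \<partial>\<mu>)"
  proof -
    have "(\<integral>\<^sup>+y. indicator B (x + y) \<partial>lborel) = emeasure lborel B" for x
    proof -
      have "(\<integral>\<^sup>+y. indicator B (x + y) \<partial>lborel) = (\<integral>\<^sup>+y. indicator B y \<partial>distr lborel borel ((+) x))"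
        by (subst nn_integral_distr) auto
      then show ?thesis by (simp add: lborel_distr_plus)
    qed
    then show ?thesis
      by (subst nn_integral_cmult) (auto simp: nn_integral_multc)
  qed
  also have "\<dots> = (\<integral>\<^sup>+y. \<integral>\<^sup>+x. indicator A x * indicator B (x + y) \<partial>\<mu> \<partial>lborel)"
    by (rule P.Fubini'[symmetric]) measurable
  also have "\<dots> = (\<integral>\<^sup>+y. \<integral>\<^sup>+x. indicator A (x - y) * indicator B x \<partial>\<mu> \<partial>lborel)"
  proof (rule nn_integral_cong)
    fix y :: 'a
    have "(\<integral>\<^sup>+x. indicator A (x - y) * indicator B x \<partial>\<mu>)
        = (\<integral>\<^sup>+x. indicator A (x - y) * indicator B x \<partial>distr \<mu> borel ((+) y))"
      by (simp add: inv)
    also have "\<dots> = (\<integral>\<^sup>+x. indicator A x * indicator B (x + y) \<partial>\<mu>)"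
      by (subst nn_integral_distr) (auto simp: add.commute)
    finally show "(\<integral>\<^sup>+x. indicator A x * indicator B (x + y) \<partial>\<mu>)
        = (\<integral>\<^sup>+x. indicator A (x - y) * indicator B x \<partial>\<mu>)" ..
  qed
  also have "\<dots> = (\<integral>\<^sup>+x. \<integral>\<^sup>+y. indicator A (x - y) * indicator B x \<partial>lborel \<partial>\<mu>)"
    by (rule P.Fubini') measurable
  also have "\<dots> = emeasure \<mu> B * emeasure lborel A"
  proof -
    have "(\<integral>\<^sup>+y. indicator A (x - y) \<partial>lborel) = emeasure lborel A" for x
    proof -
      have "(\<integral>\<^sup>+y. indicator A (x - y) \<partial>lborel) = (\<integral>\<^sup>+y. indicator A y \<partial>distr lborel borel (\<lambda>y. x - y))"
        by (subst nn_integral_distr) auto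
      then show ?thesis by (simp add: refl)
    qed
    then show ?thesis
      by (subst nn_integral_multc) (auto simp: nn_integral_cmult nn_integral_multc mult.commute)
  qed
  finally show ?thesis .
qed

text \<open>The factor by which taking preimages under a linear bijection scales volumes, that is, the inverse of the
absolute value of its determinant.\<close>

definition preimage_scale :: "('a::euclidean_space \<Rightarrow> 'a) \<Rightarrow> real" where
  "preimage_scale f = measure lborel (f -` cbox 0 One)"

lemma bounded_vimage_linear:
  fixes f :: "'a::euclidean_space \<Rightarrow> 'a"
  assumes "linear f" "inj f" "bounded B"
  shows "bounded (f -` B)"
proof -
  obtain g where g: "linear g" "\<And>x. g (f x) = x"
    using assms linear_injective_left_inverse[of f] by (auto simp: fun_eq_iff)
  have "f -` B \<subseteq> g ` B" using g(2) by (metis image_eqI subsetI vimageD)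
  then show ?thesis
    using bounded_linear_image[OF \<open>bounded B\<close>] g(1) bounded_subset linear_conv_bounded_linear by blast
qed

lemma borel_measurable_linear:
  fixes f :: "'a::euclidean_space \<Rightarrow> 'b::euclidean_space"
  assumes "linear f" shows "f \<in> borel_measurable borel"
  using assms by (intro borel_measurable_continuous_onI linear_continuous_on)
    (simp add: linear_conv_bounded_linear)

text \<open>The image of Lebesgue measure under \<open>f\<close> is again translation invariant, hence a multiple of Lebesgue
measure; evaluating at the unit cube gives the factor.\<close>

lemma emeasure_vimage_linear:
  fixes f :: "'a::euclidean_space \<Rightarrow> 'a"
  assumes f: "linear f" "inj f" and A: "A \<in> sets borel"
  shows "emeasure lborel (f -` A) = ennreal (preimage_scale f) * emeasure lborel A"
proof -
  note [measurable] = borel_measurable_linear[OF f(1)]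
  have emf: "emeasure (distr lborel borel f) B = emeasure lborel (f -` B)" if "B \<in> sets borel" for B
    using that by (simp add: emeasure_distr)
  have fin: "emeasure lborel (f -` B) < \<infinity>" if "bounded B" for B
    using bounded_vimage_linear[OF f that] by (rule emeasure_bounded_finite)
  have "sigma_finite_measure (distr lborel borel f)"
  proof (rule sigma_finite_measure.intro, intro exI conjI)
    show "countable (range (\<lambda>n::nat. ball (0::'a) (real n)))" by simp
    show "range (\<lambda>n::nat. ball (0::'a) (real n)) \<subseteq> sets (distr lborel borel f)" by auto
    show "\<Union> (range (\<lambda>n::nat. ball (0::'a) (real n))) = space (distr lborel borel f)"
      by (auto simp: dist_norm intro: reals_Archimedean2)
    show "\<forall>a\<in>range (\<lambda>n::nat. ball (0::'a) (real n)). emeasure (distr lborel borel f) a \<noteq> \<infinity>"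
      using fin by (auto simp: emf less_top[symmetric])
  qed
  moreover have "distr (distr lborel borel f) borel ((+) a) = distr lborel borel f" for a
  proof -
    obtain b where b: "a = f b"
      using linear_injective_imp_surjective[OF f] by (metis surj_def)
    have "distr (distr lborel borel f) borel ((+) a) = distr lborel borel (\<lambda>x. f (b + x))"
      by (simp add: distr_distr comp_def b linear_add[OF f(1)])
    also have "\<dots> = distr (distr lborel borel ((+) b)) borel f"
      by (simp add: distr_distr comp_def)
    finally show ?thesis by (simp add: lborel_distr_plus)
  qed
  ultimately have "emeasure (distr lborel borel f) A * emeasure lborel (cbox 0 (One::'a))
      = emeasure (distr lborel borel f) (cbox 0 One) * emeasure lborel A"
    by (intro translation_invariant_measure_proportional A) auto
  moreover have "emeasure lborel (f -` cbox 0 One) = ennreal (preimage_scale f)"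
    unfolding preimage_scale_def using fin[OF bounded_cbox[of 0 "One::'a"]] by (intro emeasure_eq_ennreal_measure) (auto simp: less_top)
  ultimately show ?thesis
    using A by (simp add: emf emeasure_lborel_cbox_eq)
qed

lemma measure_vimage_linear:
  fixes f :: "'a::euclidean_space \<Rightarrow> 'a"
  assumes "linear f" "inj f" "A \<in> sets borel"
  shows "measure lborel (f -` A) = preimage_scale f * measure lborel A"
  using emeasure_vimage_linear[OF assms]
  by (simp add: measure_def enn2real_mult preimage_scale_def)

lemma preimage_scale_comp:
  fixes f g :: "'a::euclidean_space \<Rightarrow> 'a"
  assumes "linear f" "inj f" "linear g" "inj g"
  shows "preimage_scale (f \<circ> g) = preimage_scale f * preimage_scale g"
proof -
  have [measurable]: "f -` cbox 0 One \<in> sets borel"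
    using measurable_sets[OF borel_measurable_linear[OF assms(1)], of "cbox 0 One"] by simp
  show ?thesis
    unfolding preimage_scale_def[of "f \<circ> g"] vimage_comp[symmetric]
    by (simp add: measure_vimage_linear[OF assms(3,4)]) (simp add: preimage_scale_def)
qed

lemma preimage_scale_id: "preimage_scale (\<lambda>x. x) = 1"
  by (simp add: preimage_scale_def)

text \<open>The factor is multiplicative and nonnegative, so that an involution, whose factor squares to \<open>1\<close>,
preserves volume.\<close>

lemma preimage_scale_involution:
  fixes f :: "'a::euclidean_space \<Rightarrow> 'a"
  assumes "linear f" "\<And>x. f (f x) = x"
  shows "preimage_scale f = 1"
proof -
  have "inj f" by (metis assms(2) injI)
  then have "preimage_scale f * preimage_scale f = 1"
    using preimage_scale_comp[of f f] assms by (simp add: comp_def preimage_scale_id)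
  moreover have "preimage_scale f \<ge> 0" by (simp add: preimage_scale_def)
  ultimately show ?thesis
    unfolding square_eq_1_iff by auto
qed

lemma linear_rank_one_update:
  fixes u k :: "'a::euclidean_space"
  shows "linear (\<lambda>x. x + (k \<bullet> x) *\<^sub>R u)"
  by (intro linearI) (simp_all add: algebra_simps)

lemma inj_rank_one_update:
  fixes u k :: "'a::euclidean_space"
  assumes "1 + k \<bullet> u \<noteq> 0"
  shows "inj (\<lambda>x. x + (k \<bullet> x) *\<^sub>R u)"
proof (rule linear_injective_0[OF linear_rank_one_update, THEN iffD2], intro allI impI)
  fix x assume x: "x + (k \<bullet> x) *\<^sub>R u = 0"
  then have "k \<bullet> (x + (k \<bullet> x) *\<^sub>R u) = 0" by simp
  then have "(k \<bullet> x) * (1 + k \<bullet> u) = 0" by (simp add: inner_add_right algebra_simps)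
  then show "x = 0" using assms x by auto
qed

text \<open>The condition \<open>k \<bullet> u = -2\<close> makes the map an involution; it is an oblique reflection in the
hyperplane \<open>k \<bullet> x = 0\<close>.\<close>

lemma preimage_scale_reflection:
  fixes u k :: "'a::euclidean_space"
  assumes "k \<bullet> u = -2"
  shows "preimage_scale (\<lambda>x. x + (k \<bullet> x) *\<^sub>R u) = 1"
  by (rule preimage_scale_involution[OF linear_rank_one_update])
     (simp add: inner_add_right assms algebra_simps)

lemma preimage_scale_dilation_Basis:
  fixes b :: "'a::euclidean_space"
  assumes b: "b \<in> Basis" and h: "h > 0"
  shows "preimage_scale (\<lambda>x. x + (b \<bullet> x) *\<^sub>R ((h - 1) *\<^sub>R b)) = 1 / h"
proof -
  let ?D = "\<lambda>x::'a. x + (b \<bullet> x) *\<^sub>R ((h - 1) *\<^sub>R b)"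
  let ?c = "\<lambda>j. if j = b then h else 1"
  have "(\<Sum>j\<in>Basis. (?c j * (x \<bullet> j)) *\<^sub>R j) = ?D x" for x
  proof (rule euclidean_eqI)
    fix i :: 'a assume i: "i \<in> Basis"
    have "(\<Sum>j\<in>Basis. (?c j * (x \<bullet> j)) *\<^sub>R j) \<bullet> i = ?c i * (x \<bullet> i)"
      using i by (simp add: inner_sum_left inner_Basis if_distrib cong: if_cong)
    also have "\<dots> = ?D x \<bullet> i"
      using i b by (auto simp: inner_add_left inner_Basis algebra_simps inner_commute)
    finally show "(\<Sum>j\<in>Basis. (?c j * (x \<bullet> j)) *\<^sub>R j) \<bullet> i = ?D x \<bullet> i" .
  qed
  then have D: "lborel = density (distr lborel borel ?D) (\<lambda>_. ennreal (\<Prod>j\<in>Basis. \<bar>?c j\<bar>))"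
    using lborel_affine_euclidean[of ?c 0] h by simp
  have p: "(\<Prod>j\<in>Basis. \<bar>?c j\<bar>) = h"
    using b h by (simp add: if_distrib prod.If_cases cong: if_cong)
  have [measurable]: "?D \<in> borel_measurable borel"
    by (rule borel_measurable_linear[OF linear_rank_one_update])
  have "emeasure lborel (cbox 0 (One::'a)) = ennreal h * emeasure lborel (?D -` cbox 0 One)"
    by (subst D) (simp add: p emeasure_density nn_integral_cmult_indicator emeasure_distr)
  also have "emeasure lborel (?D -` cbox 0 One) = ennreal (preimage_scale ?D)"
    using b h by (subst emeasure_vimage_linear[OF linear_rank_one_update inj_rank_one_update])
      (simp_all add: emeasure_lborel_cbox_eq)
  finally have "1 = h * preimage_scale ?D"
    using h by (simp add: ennreal_mult[symmetric] preimage_scale_def emeasure_lborel_cbox_eq flip: ennreal_1)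
  then show ?thesis using h by (simp add: field_simps)
qed

text \<open>A reflection carries \<open>n\<close> to a basis vector, so that conjugation reduces a dilation along \<open>n\<close> to a
scaling of one coordinate.\<close>

lemma preimage_scale_dilation:
  fixes n :: "'a::euclidean_space"
  assumes n: "norm n = 1" and h: "h > 0"
  shows "preimage_scale (\<lambda>x. x + (n \<bullet> x) *\<^sub>R ((h - 1) *\<^sub>R n)) = 1 / h"
proof -
  obtain b :: 'a where b: "b \<in> Basis" using nonempty_Basis by blast
  show ?thesis
  proof (cases "n = b")
    case True then show ?thesis using preimage_scale_dilation_Basis[OF b h] by simp
  next
    case False
    define e k where "e = n - b" and "k = (- 2 / (e \<bullet> e)) *\<^sub>R e"
    have nn: "n \<bullet> n = 1" "b \<bullet> b = 1" using n b by (auto simp: norm_eq_1)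
    have e0: "e \<bullet> e \<noteq> 0" using False by (simp add: e_def)
    have ke: "k \<bullet> e = -2" using e0 by (simp add: k_def)
    have ee: "e \<bullet> e = 2 * (e \<bullet> n)" "e \<bullet> e = - 2 * (e \<bullet> b)"
      using nn by (simp_all add: e_def inner_diff_left inner_diff_right inner_commute)
    let ?R = "\<lambda>x. x + (k \<bullet> x) *\<^sub>R e"
    let ?D = "\<lambda>n x. x + (n \<bullet> x) *\<^sub>R ((h - 1) *\<^sub>R n)"
    have kn: "k \<bullet> n = -1" using e0 ee(1) by (simp add: k_def field_simps)
    have kb: "k \<bullet> b = 1" using e0 ee(2) by (simp add: k_def field_simps)
    have Rn: "?R n = b" using kn by (simp add: e_def)
    have bR: "b \<bullet> (?R x) = n \<bullet> x" for x
    proof -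
      have "b \<bullet> e = - (e \<bullet> e) / 2" using ee(2) by (simp add: inner_commute)
      then have "(k \<bullet> x) * (b \<bullet> e) = e \<bullet> x" using e0 by (simp add: k_def)
      then show ?thesis by (simp add: inner_add_right e_def inner_diff_left)
    qed
    have RR: "?R (?R x) = x" for x by (simp add: inner_add_right ke algebra_simps)
    have lin: "linear ?R" "linear (?D b)" "linear (?D n)"
      by (rule linear_rank_one_update)+
    have inj: "inj ?R" "inj (?D b)" "inj (?D n)"
      using h nn ke by (intro inj_rank_one_update; simp)+
    have "?D n = ?R \<circ> (?D b \<circ> ?R)"
    proof
      fix x
      have "?R (?D b (?R x)) = ?R (?R x + (n \<bullet> x) *\<^sub>R ((h - 1) *\<^sub>R b))"
        by (simp only: bR)
      also have "\<dots> = ?R (?R x) + (n \<bullet> x) *\<^sub>R ((h - 1) *\<^sub>R ?R b)"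
        by (simp only: linear_add[OF lin(1)] linear_scale[OF lin(1)])
      also have "?R b = n" using RR[of n] by (simp only: Rn)
      finally show "?D n x = (?R \<circ> (?D b \<circ> ?R)) x" by (simp only: RR comp_def)
    qed
    then have "preimage_scale (?D n) = preimage_scale ?R * (preimage_scale (?D b) * preimage_scale ?R)"
      using lin inj inj_compose[OF inj(2) inj(1)]
      by (simp only: preimage_scale_comp linear_compose)
    then show ?thesis
      using preimage_scale_dilation_Basis[OF b h] preimage_scale_reflection[OF ke] by simp
  qed
qed

text \<open>The reflection in the hyperplane orthogonal to \<open>n\<close> conjugates a shear to its inverse.  Both therefore
have the same factor, whose square is \<open>1\<close>.\<close>

lemma preimage_scale_shear:
  fixes n v :: "'a::euclidean_space"
  assumes n: "norm n = 1" and v: "n \<bullet> v = 0"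
  shows "preimage_scale (\<lambda>x. x + (n \<bullet> x) *\<^sub>R v) = 1"
proof -
  let ?S = "\<lambda>v x. x + (n \<bullet> x) *\<^sub>R v"
  let ?R = "\<lambda>x. x + (n \<bullet> x) *\<^sub>R (- 2 *\<^sub>R n)"
  have nn: "n \<bullet> n = 1" using n by (simp add: norm_eq_1)
  have lin: "linear ?R" "linear (?S v)" "linear (?S (- v))" by (rule linear_rank_one_update)+
  have inj: "inj ?R" "inj (?S v)" "inj (?S (- v))" using nn v by (intro inj_rank_one_update; simp)+
  have "?S (- v) = ?R \<circ> (?S v \<circ> ?R)"
    by (rule ext) (simp add: inner_add_right inner_diff_right nn v algebra_simps)
  then have "preimage_scale (?S (- v)) = preimage_scale ?R * (preimage_scale (?S v) * preimage_scale ?R)"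
    using lin inj inj_compose[OF inj(2) inj(1)] by (simp only: preimage_scale_comp linear_compose)
  moreover have "preimage_scale ?R = 1"
    by (rule preimage_scale_reflection) (simp add: nn)
  moreover have "?S v \<circ> ?S (- v) = (\<lambda>x. x)"
    by (rule ext) (simp add: inner_add_right inner_diff_right v algebra_simps)
  then have "preimage_scale (?S v) * preimage_scale (?S (- v)) = 1"
    using preimage_scale_comp[OF lin(2) inj(2) lin(3) inj(3)] preimage_scale_id by metis
  moreover have "preimage_scale (?S v) \<ge> 0" by (simp add: preimage_scale_def)
  ultimately have "preimage_scale (?S v) * preimage_scale (?S v) = 1" "preimage_scale (?S v) \<ge> 0"
    by simp_all
  then show ?thesis unfolding square_eq_1_iff by auto
qed

lemma preimage_scale_scaleR:
  assumes "r > 0"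
  shows "preimage_scale (\<lambda>x::'a::euclidean_space. r *\<^sub>R x) = 1 / r ^ DIM('a)"
proof -
  let ?D = "\<lambda>x::'a. r *\<^sub>R x"
  have lin: "linear ?D" and inj: "inj ?D" using assms by (auto intro!: linearI injI simp: algebra_simps)
  have D: "lborel = density (distr lborel borel ?D) (\<lambda>_. ennreal (r ^ DIM('a)))"
    using lborel_affine[of r 0] assms by simp
  have [measurable]: "?D \<in> borel_measurable borel" by (rule borel_measurable_linear[OF lin])
  have "emeasure lborel (cbox 0 (One::'a)) = ennreal (r ^ DIM('a)) * emeasure lborel (?D -` cbox 0 One)"
    by (subst D) (simp add: emeasure_density nn_integral_cmult_indicator emeasure_distr)
  also have "emeasure lborel (?D -` cbox 0 One) = ennreal (preimage_scale ?D)"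
    by (subst emeasure_vimage_linear[OF lin inj]) (simp_all add: emeasure_lborel_cbox_eq)
  finally have "1 = r ^ DIM('a) * preimage_scale ?D"
    using assms by (simp add: ennreal_mult[symmetric] preimage_scale_def emeasure_lborel_cbox_eq flip: ennreal_1)
  then show ?thesis using assms by (simp add: field_simps)
qed

lemma preimage_scale_rank_one_update:
  fixes n u :: "'a::euclidean_space"
  assumes n: "norm n = 1" and r: "r > 0" and u: "r + n \<bullet> u > 0"
  shows "preimage_scale (\<lambda>x. r *\<^sub>R x + (n \<bullet> x) *\<^sub>R u) = 1 / (r ^ (DIM('a) - 1) * (r + n \<bullet> u))"
    and "linear (\<lambda>x. r *\<^sub>R x + (n \<bullet> x) *\<^sub>R u)" and "inj (\<lambda>x. r *\<^sub>R x + (n \<bullet> x) *\<^sub>R u)"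
proof -
  define u' where "u' = u /\<^sub>R r"
  define h where "h = 1 + n \<bullet> u'"
  define v where "v = u' - (n \<bullet> u') *\<^sub>R n"
  have nn: "n \<bullet> n = 1" using n by (simp add: norm_eq_1)
  have h: "h > 0" "r * h = r + n \<bullet> u" using r u by (auto simp: h_def u'_def field_simps)
  have nv: "n \<bullet> v = 0" by (simp add: v_def inner_diff_right nn)
  let ?M = "\<lambda>x::'a. r *\<^sub>R x" and ?D = "\<lambda>x. x + (n \<bullet> x) *\<^sub>R ((h - 1) *\<^sub>R n)"
    and ?S = "\<lambda>x. x + (n \<bullet> x) *\<^sub>R v"
  have lin: "linear ?D" "linear ?S" "linear ?M"
    by (rule linear_rank_one_update)+ (auto intro!: linearI simp: algebra_simps)
  have inj: "inj ?D" "inj ?S" "inj ?M"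
    using h r nn nv by (intro inj_rank_one_update; simp)+ (use r in \<open>auto intro!: injI\<close>)
  \<comment> \<open>The map is a shear, followed by a dilation along \<open>n\<close> and a uniform scaling.\<close>
  have eq: "(\<lambda>x. r *\<^sub>R x + (n \<bullet> x) *\<^sub>R u) = ?M \<circ> (?D \<circ> ?S)"
  proof
    fix x
    have "v + (h - 1) *\<^sub>R n = u'" by (simp add: v_def h_def)
    then have "(?M \<circ> (?D \<circ> ?S)) x = r *\<^sub>R (x + (n \<bullet> x) *\<^sub>R u')"
      by (simp add: inner_add_right nv flip: scaleR_add_right scaleR_scaleR)
    also have "\<dots> = r *\<^sub>R x + (n \<bullet> x) *\<^sub>R u"
      using r by (simp add: u'_def scaleR_add_right)
    finally show "r *\<^sub>R x + (n \<bullet> x) *\<^sub>R u = (?M \<circ> (?D \<circ> ?S)) x" ..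
  qed
  show "linear (\<lambda>x. r *\<^sub>R x + (n \<bullet> x) *\<^sub>R u)" "inj (\<lambda>x. r *\<^sub>R x + (n \<bullet> x) *\<^sub>R u)"
    unfolding eq by (intro linear_compose inj_compose lin inj)+
  have "preimage_scale (?M \<circ> (?D \<circ> ?S)) = preimage_scale ?M * (preimage_scale ?D * preimage_scale ?S)"
    using lin inj inj_compose[OF inj(1,2)] by (simp only: preimage_scale_comp linear_compose)
  also have "\<dots> = 1 / (r ^ DIM('a) * h)"
    using preimage_scale_dilation[OF n h(1)] preimage_scale_shear[OF n nv] preimage_scale_scaleR[OF r, where 'a='a]
    by simp
  also have "r ^ DIM('a) = r ^ (DIM('a) - 1) * r"
    by (metis DIM_positive Suc_diff_1 power_Suc2)
  finally show "preimage_scale (\<lambda>x. r *\<^sub>R x + (n \<bullet> x) *\<^sub>R u) = 1 / (r ^ (DIM('a) - 1) * (r + n \<bullet> u))"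
    unfolding eq h(2)[symmetric] by (simp only: mult.assoc)
qed

section \<open>Volume of a cone\<close>

lemma lborel_distr_linear:
  fixes f :: "'a::euclidean_space \<Rightarrow> 'a"
  assumes "linear f" "inj f" "preimage_scale f = 1"
  shows "distr lborel borel f = lborel"
proof (rule measure_eqI)
  fix A assume "A \<in> sets (distr lborel borel f)"
  then show "emeasure (distr lborel borel f) A = emeasure lborel A"
    using assms by (simp add: emeasure_distr borel_measurable_linear emeasure_vimage_linear)
qed simp

text \<open>The oblique reflection \<open>x \<mapsto> x + (k \<bullet> x + \<kappa>) w\<close> preserves \<open>A\<close> and Lebesgue measure and changes the sign of
the integrand.  Applied to reflections that exchange two vertices, this locates centroids.\<close>

lemma integral_antisymmetric_eq_0:
  fixes k w :: "'a::euclidean_space"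
  assumes kw: "k \<bullet> w = -2" and A [measurable]: "A \<in> sets borel"
    and inv: "\<And>x. x \<in> A \<Longrightarrow> x + (k \<bullet> x + \<kappa>) *\<^sub>R w \<in> A"
  shows "(LINT x:A|lborel. k \<bullet> x + \<kappa>) = 0"
proof -
  define R where "R = (\<lambda>x. x + (k \<bullet> x) *\<^sub>R w)"
  define f where "f = (\<lambda>x. x + (k \<bullet> x + \<kappa>) *\<^sub>R w)"
  define \<phi> where "\<phi> = (\<lambda>x. k \<bullet> x + \<kappa>)"
  have R: "linear R" "inj R" "preimage_scale R = 1"
    unfolding R_def using kw
    by (auto intro!: linear_rank_one_update inj_rank_one_update preimage_scale_reflection)
  note [measurable] = borel_measurable_linear[OF R(1)]
  have f_eq: "f = (\<lambda>x. \<kappa> *\<^sub>R w + R x)" by (auto simp: f_def R_def algebra_simps)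
  then have [measurable]: "f \<in> borel_measurable borel" by simp
  have [measurable]: "\<phi> \<in> borel_measurable borel" by (simp add: \<phi>_def)
  have "distr (distr lborel borel R) borel ((+) (\<kappa> *\<^sub>R w)) = distr lborel borel f"
    by (simp add: distr_distr comp_def f_eq)
  then have distr: "distr lborel borel f = lborel"
    by (simp add: lborel_distr_linear[OF R] lborel_distr_plus)
  have \<phi>f: "\<phi> (f x) = - \<phi> x" for x
    by (simp add: \<phi>_def f_def inner_add_right kw algebra_simps)
  have "f (f x) = x" for x
  proof -
    have "f (f x) = f x + \<phi> (f x) *\<^sub>R w" by (simp add: f_def \<phi>_def)
    also have "\<dots> = x" by (simp only: \<phi>f) (simp add: f_def \<phi>_def algebra_simps)
    finally show ?thesis .
  qed
  moreover have "f x \<in> A" if "x \<in> A" for x using inv[OF that] by (simp add: f_def)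
  ultimately have "f x \<in> A \<longleftrightarrow> x \<in> A" for x by metis
  then have ind: "indicator A (f x) = (indicator A x :: real)" for x
    by (simp add: indicator_def)
  have "(LINT x|lborel. indicator A x * \<phi> x) = (LINT x|distr lborel borel f. indicator A x * \<phi> x)"
    by (simp add: distr)
  also have "\<dots> = (LINT x|lborel. indicator A (f x) * \<phi> (f x))"
    by (rule integral_distr) measurable
  also have "\<dots> = - (LINT x|lborel. indicator A x * \<phi> x)"
    by (simp add: ind \<phi>f)
  finally show ?thesis by (simp add: set_lebesgue_integral_def \<phi>_def)
qed

definition hyperplane_proj :: "'a::euclidean_space \<Rightarrow> real \<Rightarrow> 'a \<Rightarrow> 'a" where
  "hyperplane_proj n \<beta> z = z - (n \<bullet> z - \<beta>) *\<^sub>R n"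

lemma inner_hyperplane_proj: "norm n = 1 \<Longrightarrow> n \<bullet> hyperplane_proj n \<beta> z = \<beta>"
  by (simp add: hyperplane_proj_def inner_diff_right norm_eq_1)

lemma hyperplane_proj_add:
  assumes "norm n = 1" "n \<bullet> x = \<beta>" "n \<bullet> v = 0"
  shows "hyperplane_proj n \<beta> (x + t *\<^sub>R n + v) = x + v"
  using assms by (simp add: hyperplane_proj_def inner_add_right norm_eq_1)

lemma continuous_on_hyperplane_proj [continuous_intros]: "continuous_on A (hyperplane_proj n \<beta>)"
  unfolding hyperplane_proj_def by (intro continuous_intros)

lemma closest_point_hyperplane:
  assumes n: "norm n = 1"
  shows "closest_point {x. n \<bullet> x = \<beta>} = hyperplane_proj n \<beta>"
proof
  fix z :: 'a
  have "hyperplane_proj n \<beta> z = closest_point {x. n \<bullet> x = \<beta>} z"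
  proof (rule closest_point_unique)
    show "\<forall>y\<in>{x. n \<bullet> x = \<beta>}. dist z (hyperplane_proj n \<beta> z) \<le> dist z y"
    proof safe
      fix y assume "\<beta> = n \<bullet> y"
      have "\<bar>n \<bullet> (z - y)\<bar> \<le> norm n * norm (z - y)" by (rule Cauchy_Schwarz_ineq2)
      then show "dist z (hyperplane_proj (n) (n \<bullet> y) z) \<le> dist z y"
        using n by (simp add: hyperplane_proj_def dist_norm inner_diff_right)
    qed
  qed (auto simp: convex_hyperplane closed_hyperplane inner_hyperplane_proj[OF n])
  then show "closest_point {x. n \<bullet> x = \<beta>} z = hyperplane_proj n \<beta> z" ..
qed

text \<open>The set whose volume is, by definition of the surface measure, the area of the flat set \<open>S\<close>.\<close>

definition prism :: "'a::euclidean_space \<Rightarrow> real \<Rightarrow> 'a set \<Rightarrow> 'a set" where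
  "prism n \<beta> S = {z. hyperplane_proj n \<beta> z \<in> S \<and> \<bar>n \<bullet> z - \<beta>\<bar> \<le> 1/2}"

lemma compact_prism:
  assumes "norm n = 1" "compact S"
  shows "compact (prism n \<beta> S)"
proof -
  have "prism n \<beta> S = hyperplane_proj n \<beta> -` S \<inter> {z. \<bar>n \<bullet> z - \<beta>\<bar> \<le> 1/2}"
    by (auto simp: prism_def)
  moreover have "closed (hyperplane_proj n \<beta> -` S)"
    using assms(2) by (intro closed_vimage compact_imp_closed)
      (auto simp: continuous_on_hyperplane_proj)
  moreover have "closed {z. \<bar>n \<bullet> z - \<beta>\<bar> \<le> 1/2}"
    by (intro closed_Collect_le continuous_intros)
  ultimately have "closed (prism n \<beta> S)" by auto
  moreover obtain B where B: "\<And>x. x \<in> S \<Longrightarrow> norm x \<le> B"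
    using compact_imp_bounded[OF assms(2)] by (auto simp: bounded_iff)
  have "norm z \<le> B + 1/2" if "z \<in> prism n \<beta> S" for z
  proof -
    have "norm z \<le> norm (hyperplane_proj n \<beta> z) + norm ((n \<bullet> z - \<beta>) *\<^sub>R n)"
      unfolding hyperplane_proj_def using norm_triangle_sub[of z "(n \<bullet> z - \<beta>) *\<^sub>R n"] by simp
    then show ?thesis using that B assms(1) by (fastforce simp: prism_def)
  qed
  then have "bounded (prism n \<beta> S)" by (auto simp: bounded_iff)
  ultimately show ?thesis by (simp add: compact_eq_bounded_closed)
qed

lemma measure_translate_lborel:
  fixes c :: "'a::euclidean_space"
  assumes A: "A \<in> sets borel" shows "measure lborel ((\<lambda>y. c + y) -` A) = measure lborel A"
proof -
  have "emeasure (distr lborel borel ((+) c)) A = emeasure lborel A" by (simp add: lborel_distr_plus)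
  then show ?thesis using A by (simp add: emeasure_distr measure_def)
qed

lemma measure_affine_image:
  fixes f :: "'a::euclidean_space \<Rightarrow> 'a"
  assumes f: "linear f" "inj f" and A: "compact A"
  shows "preimage_scale f * measure lborel ((\<lambda>x. c + f x) ` A) = measure lborel A"
proof -
  let ?g = "\<lambda>x. c + f x"
  have "compact (?g ` A)"
    by (intro compact_continuous_image A continuous_intros linear_continuous_on)
       (use f(1) in \<open>simp add: linear_conv_bounded_linear\<close>)
  then have B: "?g ` A \<in> sets borel" by (simp add: borel_compact)
  have c: "(\<lambda>y. c + y) -` (?g ` A) \<in> sets borel"
    using measurable_sets[OF _ B, of "(\<lambda>y. c + y)" borel] by simp
  have "A = f -` ((\<lambda>y. c + y) -` (?g ` A))"
    using f(2) unfolding inj_def by auto metis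
  then have "measure lborel A = preimage_scale f * measure lborel ((\<lambda>y. c + y) -` (?g ` A))"
    using measure_vimage_linear[OF f c] by simp
  then show ?thesis by (simp add: measure_translate_lborel[OF B])
qed

text \<open>The map sends the right prism over \<open>S\<close> to the prism over a copy of \<open>S\<close> scaled by the factor \<open>r\<close> about \<open>q\<close>,
with axis along \<open>q - p\<close> and occupying the last fraction \<open>e\<close> of the way from \<open>p\<close> to \<open>q\<close>.\<close>

lemma measure_oblique_prism:
  fixes n p q :: "'a::euclidean_space"
  assumes n: "norm n = 1" and S: "compact S" and q: "n \<bullet> q = \<beta>" and p: "n \<bullet> p = \<beta> - h" and h: "h > 0"
    and r: "r > 0" and e: "e > 0"
  shows "measure lborel ((\<lambda>z. p + (1 - e * (1/2 - (n \<bullet> z - \<beta>))) *\<^sub>R (q - p)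
             + r *\<^sub>R (hyperplane_proj n \<beta> z - q)) ` prism n \<beta> S)
         = r ^ (DIM('a) - 1) * (e * h) * measure lborel (prism n \<beta> S)"
proof -
  define u where "u = e *\<^sub>R (q - p) - r *\<^sub>R n"
  define c where "c = p + (1 - e / 2 - e * \<beta>) *\<^sub>R (q - p) - r *\<^sub>R q + (r * \<beta>) *\<^sub>R n"
  have eq: "p + (1 - e * (1/2 - (n \<bullet> z - \<beta>))) *\<^sub>R (q - p) + r *\<^sub>R (hyperplane_proj n \<beta> z - q)
      = c + (r *\<^sub>R z + (n \<bullet> z) *\<^sub>R u)" for z
    by (simp add: c_def u_def hyperplane_proj_def algebra_simps)
  have nu: "r + n \<bullet> u = e * h"
  proof -
    have "n \<bullet> u = e * (n \<bullet> q - n \<bullet> p) - r"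
      using n by (simp add: u_def inner_diff_right norm_eq_1)
    then show ?thesis by (simp add: q p)
  qed
  then have pos: "r + n \<bullet> u > 0" using e h by simp
  show ?thesis
    unfolding eq
    using measure_affine_image[OF preimage_scale_rank_one_update(2,3)[OF n r pos] compact_prism[OF n S], of c \<beta>]
      preimage_scale_rank_one_update(1)[OF n r pos] r e h nu
    by (simp add: field_simps)
qed

lemma cone_mem_iff:
  fixes p :: "'a::euclidean_space"
  assumes "convex S" "S \<noteq> {}"
  shows "y \<in> convex hull (insert p S) \<longleftrightarrow> (\<exists>s x. 0 \<le> s \<and> s \<le> 1 \<and> x \<in> S \<and> y = p + s *\<^sub>R (x - p))"
proof -
  have "y \<in> convex hull (insert p S) \<longleftrightarrow> (\<exists>u\<ge>0. \<exists>v\<ge>0. \<exists>b\<in>S. u + v = 1 \<and> y = u *\<^sub>R p + v *\<^sub>R b)"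
    using assms by (simp add: convex_hull_insert hull_same Bex_def)
  also have "\<dots> \<longleftrightarrow> (\<exists>s x. 0 \<le> s \<and> s \<le> 1 \<and> x \<in> S \<and> y = p + s *\<^sub>R (x - p))"
  proof safe
    fix u v b assume "(0::real) \<le> u" "0 \<le> v" "b \<in> S" "u + v = 1"
    then show "\<exists>s x. 0 \<le> s \<and> s \<le> 1 \<and> x \<in> S \<and> u *\<^sub>R p + v *\<^sub>R b = p + s *\<^sub>R (x - p)"
      by (intro exI[of _ v] exI[of _ b]) (auto simp: algebra_simps simp flip: scaleR_add_left)
  next
    fix s x assume "(0::real) \<le> s" "s \<le> 1" "x \<in> S"
    then show "\<exists>u\<ge>0. \<exists>v\<ge>0. \<exists>b\<in>S. u + v = 1 \<and> p + s *\<^sub>R (x - p) = u *\<^sub>R p + v *\<^sub>R b"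
      by (intro exI[of _ "1 - s"] conjI exI[of _ s] bexI[of _ x]) (auto simp: algebra_simps)
  qed
  finally show ?thesis .
qed

text \<open>The frustum between the cone and its copy shrunk by \<open>a\<close> towards the apex is squeezed between two oblique
prisms, one over \<open>S\<close> and one over a copy of \<open>S\<close> shrunk by \<open>a\<close>.\<close>

lemma cone_volume_bounds:
  fixes n p :: "'a::euclidean_space"
  assumes n: "norm n = 1" and S: "compact S" "convex S" "S \<noteq> {}" and Sn: "\<And>x. x \<in> S \<Longrightarrow> n \<bullet> x = \<beta>"
    and p: "n \<bullet> p = \<beta> - h" and h: "h > 0" and a: "0 < a" "a < 1"
  defines "V \<equiv> measure lborel (convex hull (insert p S))"
    and "W \<equiv> measure lborel (prism n \<beta> S)"
  shows "(1 - a ^ DIM('a)) * V \<le> (1 - a) * h * W"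
    and "a ^ DIM('a) * (1 - a) * h * W \<le> (1 - a ^ DIM('a)) * V"
proof -
  obtain q where q: "q \<in> S" using S by blast
  let ?T = "convex hull (insert p S)"
  let ?O = "\<lambda>r e z. p + (1 - e * (1/2 - (n \<bullet> z - \<beta>))) *\<^sub>R (q - p) + r *\<^sub>R (hyperplane_proj n \<beta> z - q)"
  define Ta where "Ta = (\<lambda>y. p + a *\<^sub>R (y - p)) ` ?T"
  note mem = cone_mem_iff[OF S(2,3), of _ p]
  have nT: "n \<bullet> (p + s *\<^sub>R (x - p)) = \<beta> - h + s * h" if "x \<in> S" for s x
  proof -
    have "n \<bullet> (p + s *\<^sub>R (x - p)) = n \<bullet> p + s * (n \<bullet> x - n \<bullet> p)"
      by (simp add: inner_add_right inner_diff_right)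
    then show ?thesis by (simp add: p Sn[OF that])
  qed
  have "compact ?T"
    using S(1) by (intro compact_convex_hull) (simp add: compact_insert)
  then have cT: "compact Ta"
    unfolding Ta_def by (intro compact_continuous_image continuous_intros)
  have mTa: "measure lborel Ta = a ^ DIM('a) * V"
  proof -
    have "Ta = (\<lambda>x. (p - a *\<^sub>R p) + a *\<^sub>R x) ` ?T"
      unfolding Ta_def by (rule image_cong) (auto simp: algebra_simps)
    then have "preimage_scale (\<lambda>x::'a. a *\<^sub>R x) * measure lborel Ta = V"
      using a measure_affine_image[OF _ _ \<open>compact ?T\<close>, of "\<lambda>x. a *\<^sub>R x" "p - a *\<^sub>R p"]
      by (simp add: V_def linear_scale_self inj_def linearI algebra_simps)
    then show ?thesis using a by (simp add: preimage_scale_scaleR field_simps)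
  qed
  have sub: "Ta \<subseteq> ?T"
  proof
    fix y assume "y \<in> Ta"
    then obtain s x where "0 \<le> s" "s \<le> 1" "x \<in> S" "y = p + a *\<^sub>R (s *\<^sub>R (x - p))"
      unfolding Ta_def using mem by auto
    then show "y \<in> ?T" unfolding mem using a
      by (intro exI[of _ "a * s"] exI[of _ x]) (auto simp: mult_le_one)
  qed
  have Ta_le: "n \<bullet> y \<le> \<beta> - h + a * h" if yT: "y \<in> Ta" for y
  proof -
    obtain s x where s: "0 \<le> s" "s \<le> 1" "x \<in> S" and y: "y = p + a *\<^sub>R (s *\<^sub>R (x - p))"
      using yT unfolding Ta_def using mem by auto
    have "n \<bullet> y = \<beta> - h + (a * s) * h" using nT[OF s(3), of "a * s"] y by simp
    then show ?thesis using s a h by (simp add: mult_left_le)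
  qed
  have Ta_I: "p + s *\<^sub>R (x - p) \<in> Ta" if "0 \<le> s" "s \<le> a" "x \<in> S" for s x
  proof -
    have "p + (s / a) *\<^sub>R (x - p) \<in> ?T"
      unfolding mem using that a by (intro exI[of _ "s / a"] exI[of _ x]) auto
    then show ?thesis unfolding Ta_def
      by (rule rev_image_eqI) (use a in simp)
  qed
  have fin: "emeasure lborel A \<noteq> \<infinity>" "A \<in> sets lborel" if "compact A" for A :: "'a set"
    using that emeasure_compact_finite[OF that] by (auto simp: borel_compact)
  have diff: "measure lborel (?T - Ta) = (1 - a ^ DIM('a)) * V"
    using measure_Diff[of lborel ?T Ta] fin[OF \<open>compact ?T\<close>] fin[OF cT] sub mTa
    by (simp add: V_def algebra_simps)
  have cO: "compact (?O r e ` prism n \<beta> S)" for r e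
    by (intro compact_continuous_image continuous_intros compact_prism n S)
  have fm: "A \<in> fmeasurable lborel" if "compact A" for A :: "'a set"
    using fin[OF that] by (auto intro!: fmeasurableI simp: less_top)
  have fm2: "?T - Ta \<in> fmeasurable lborel"
    using fm[OF \<open>compact ?T\<close>] fm[OF cT] by (intro fmeasurable_Diff) auto
  have "?T - Ta \<subseteq> ?O 1 (1 - a) ` prism n \<beta> S"
  proof
    fix y assume y: "y \<in> ?T - Ta"
    then obtain s x where s: "0 \<le> s" "s \<le> 1" "x \<in> S" "y = p + s *\<^sub>R (x - p)" using mem by blast
    then have sa: "a < s" using Ta_I[of s x] y by force
    define x' where "x' = q + s *\<^sub>R (x - q)"
    define t where "t = 1/2 - (1 - s) / (1 - a)"
    have "x' = (1 - s) *\<^sub>R q + s *\<^sub>R x" by (simp add: x'_def algebra_simps)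
    then have x': "x' \<in> S" using convexD_alt[OF S(2) q s(3,1,2)] by simp
    have "0 \<le> (1 - s) / (1 - a)" "(1 - s) / (1 - a) \<le> 1" using sa s a by auto
    then have t: "\<bar>t\<bar> \<le> 1/2" "(1 - a) * (1/2 - t) = 1 - s"
      using a unfolding t_def by (linarith, simp)
    have P: "hyperplane_proj n \<beta> (x' + t *\<^sub>R n) = x'" "n \<bullet> (x' + t *\<^sub>R n) = \<beta> + t"
      using hyperplane_proj_add[OF n Sn[OF x'], of 0 t] Sn[OF x'] n
      by (auto simp: inner_add_right norm_eq_1)
    have "y = ?O 1 (1 - a) (x' + t *\<^sub>R n)"
      by (simp add: P t(2) s(4)) (simp add: x'_def algebra_simps)
    moreover have "x' + t *\<^sub>R n \<in> prism n \<beta> S" using x' t by (simp add: prism_def P)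
    ultimately show "y \<in> ?O 1 (1 - a) ` prism n \<beta> S" by (rule image_eqI)
  qed
  then have "measure lborel (?T - Ta) \<le> measure lborel (?O 1 (1 - a) ` prism n \<beta> S)"
    by (intro measure_mono_fmeasurable fm[OF cO] fmeasurableD[OF fm2])
  also have "\<dots> = (1 - a) * h * W"
    using measure_oblique_prism[OF n S(1) Sn[OF q] p h, of 1 "1 - a"] a by (simp add: W_def)
  finally show "(1 - a ^ DIM('a)) * V \<le> (1 - a) * h * W" by (simp add: diff)
  \<comment> \<open>The inner prism has the relative height \<open>a (1 - a)\<close> instead of \<open>1 - a\<close>: it then stays away from\<close>
  \<comment> \<open>the smaller cone, with no overlap even in a null set, and the loss disappears as \<open>a\<close> tends to \<open>1\<close>.\<close>
  have "?O a (a * (1 - a)) ` prism n \<beta> S \<subseteq> ?T - Ta"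
  proof
    fix y assume "y \<in> ?O a (a * (1 - a)) ` prism n \<beta> S"
    then obtain z where z: "z \<in> prism n \<beta> S" "y = ?O a (a * (1 - a)) z" by blast
    define x where "x = hyperplane_proj n \<beta> z"
    define s where "s = 1 - a * (1 - a) * (1/2 - (n \<bullet> z - \<beta>))"
    have x: "x \<in> S" and t: "\<bar>n \<bullet> z - \<beta>\<bar> \<le> 1/2" using z by (auto simp: prism_def x_def)
    have b: "0 \<le> 1/2 - (n \<bullet> z - \<beta>)" "1/2 - (n \<bullet> z - \<beta>) \<le> 1" using t unfolding abs_le_iff by linarith+
    define m where "m = a * (1 - a)"
    have "m < 1 * (1 - a)" unfolding m_def using a by (intro mult_strict_right_mono) auto
    moreover define \<tau> where "\<tau> = 1/2 - (n \<bullet> z - \<beta>)"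
    have "m * \<tau> \<le> m * 1"
      using b a by (intro mult_left_mono) (auto simp: m_def \<tau>_def)
    ultimately have "m * \<tau> < 1 - a" by simp
    then have "a < s" by (simp add: s_def m_def \<tau>_def)
    moreover have "s \<le> 1" using a b by (simp add: s_def)
    ultimately have s: "a < s" "0 < s" "s \<le> 1" using a by auto
    define x' where "x' = q + (a / s) *\<^sub>R (x - q)"
    have "x' = (1 - a / s) *\<^sub>R q + (a / s) *\<^sub>R x" by (simp add: x'_def algebra_simps)
    then have x': "x' \<in> S" using convexD_alt[OF S(2) q x, of "a / s"] s a by simp
    have y: "y = p + s *\<^sub>R (x' - p)"
    proof -
      have "y = p + s *\<^sub>R (q - p) + a *\<^sub>R (x - q)" by (simp add: z(2) s_def x_def)
      also have "a *\<^sub>R (x - q) = s *\<^sub>R ((a / s) *\<^sub>R (x - q))" using s by simp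
      finally show ?thesis by (simp add: x'_def algebra_simps)
    qed
    then have "y \<in> ?T" unfolding mem using s x' by (intro exI[of _ s] exI[of _ x']) auto
    moreover have "n \<bullet> y > \<beta> - h + a * h" using nT[OF x', of s] y s h by simp
    ultimately show "y \<in> ?T - Ta" using Ta_le by fastforce
  qed
  then have "measure lborel (?O a (a * (1 - a)) ` prism n \<beta> S) \<le> measure lborel (?T - Ta)"
    by (intro measure_mono_fmeasurable fm2 fmeasurableD[OF fm[OF cO]])
  moreover have "measure lborel (?O a (a * (1 - a)) ` prism n \<beta> S)
      = a ^ (DIM('a) - 1) * (a * (1 - a) * h) * W"
    using measure_oblique_prism[OF n S(1) Sn[OF q] p h a(1), of "a * (1 - a)"] a by (simp add: W_def)
  moreover have "a ^ DIM('a) = a ^ (DIM('a) - 1) * a"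
    by (metis DIM_positive Suc_diff_1 power_Suc2)
  ultimately show "a ^ DIM('a) * (1 - a) * h * W \<le> (1 - a ^ DIM('a)) * V"
    by (simp only: diff mult.assoc)
qed

text \<open>Dividing the bounds by \<open>1 - a\<close> leaves the geometric sum \<open>1 + a + \<dots> + a\<^bsup>d - 1\<^esup>\<close>, which tends to \<open>d\<close>.\<close>

lemma cone_volume:
  fixes n p :: "'a::euclidean_space"
  assumes n: "norm n = 1" and S: "compact S" "convex S" "S \<noteq> {}" and Sn: "\<And>x. x \<in> S \<Longrightarrow> n \<bullet> x = \<beta>"
    and p: "n \<bullet> p = \<beta> - h" and h: "h > 0"
  shows "DIM('a) * measure lborel (convex hull (insert p S)) = h * measure lborel (prism n \<beta> S)"
proof -
  define V where "V = measure lborel (convex hull (insert p S))"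
  define W where "W = measure lborel (prism n \<beta> S)"
  define a where "a = (\<lambda>k::nat. 1 - inverse (real (Suc (Suc k))))"
  have a: "0 < a k" "a k < 1" for k by (auto simp: a_def field_simps)
  have "(\<lambda>k. inverse (real (Suc k))) \<longlonglongrightarrow> 0" by (rule LIMSEQ_inverse_real_of_nat)
  then have "(\<lambda>k. inverse (real (Suc (Suc k)))) \<longlonglongrightarrow> 0" by (rule LIMSEQ_Suc)
  then have lim: "a \<longlonglongrightarrow> 1" unfolding a_def using tendsto_diff[OF tendsto_const[of "1::real"]] by fastforce
  have geo: "1 - x ^ DIM('a) = (1 - x) * (\<Sum>i<DIM('a). x ^ i)" for x :: real
    by (rule one_diff_power_eq)
  have up: "(\<Sum>i<DIM('a). a k ^ i) * V \<le> h * W" for k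
  proof -
    have "(1 - a k) * ((\<Sum>i<DIM('a). a k ^ i) * V) \<le> (1 - a k) * (h * W)"
      using cone_volume_bounds(1)[OF n S Sn p h a] unfolding geo V_def W_def by (simp add: mult.assoc)
    then show ?thesis using a[of k] by simp
  qed
  have low: "a k ^ DIM('a) * (h * W) \<le> (\<Sum>i<DIM('a). a k ^ i) * V" for k
  proof -
    have "(1 - a k) * (a k ^ DIM('a) * (h * W)) \<le> (1 - a k) * ((\<Sum>i<DIM('a). a k ^ i) * V)"
      using cone_volume_bounds(2)[OF n S Sn p h a] unfolding geo V_def W_def by (simp add: mult_ac)
    then show ?thesis using a[of k] by simp
  qed
  have l1: "(\<lambda>k. (\<Sum>i<DIM('a). a k ^ i) * V) \<longlonglongrightarrow> (\<Sum>i<DIM('a). 1 ^ i) * V"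
    by (intro tendsto_intros lim)
  have l2: "(\<lambda>k. a k ^ DIM('a) * (h * W)) \<longlonglongrightarrow> 1 ^ DIM('a) * (h * W)"
    by (intro tendsto_intros lim)
  have "(\<Sum>i<DIM('a). 1 ^ i) * V \<le> h * W"
    using up by (intro LIMSEQ_le_const2[OF l1]) auto
  moreover have "1 ^ DIM('a) * (h * W) \<le> (\<Sum>i<DIM('a). 1 ^ i) * V"
    using low by (intro LIMSEQ_le[OF l2 l1]) auto
  ultimately show ?thesis by (simp add: V_def W_def)
qed

section \<open>Facets of a simplex\<close>

definition facet_apex :: "'a::euclidean_space set \<Rightarrow> 'a set \<Rightarrow> 'a" where
  "facet_apex T S = (THE p. p extreme_point_of T \<and> p \<notin> S)"

text \<open>The choice of the point is immaterial: \<open>S\<close> lies in a hyperplane orthogonal to the normal.\<close>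

definition facet_offset :: "'a::euclidean_space set \<Rightarrow> 'a set \<Rightarrow> real" where
  "facet_offset T S = outer_normal T S \<bullet> (SOME x. x \<in> S)"

definition facet_height :: "'a::euclidean_space set \<Rightarrow> 'a set \<Rightarrow> real" where
  "facet_height T S = facet_offset T S - outer_normal T S \<bullet> facet_apex T S"

text \<open>Each coordinate vanishes on the hyperplane spanned by the other vertices and is normalized to \<open>1\<close> at its
own vertex.\<close>

lemma barycentric_coordinates:
  fixes C :: "'a::euclidean_space set"
  assumes indep: "\<not> affine_dependent C" and card: "card C = DIM('a) + 1"
  obtains k \<kappa> where "\<And>c c'. c \<in> C \<Longrightarrow> c' \<in> C \<Longrightarrow> k c \<bullet> c' + \<kappa> c = (if c' = c then 1 else 0 :: real)"
    and "\<And>x. (\<Sum>c\<in>C. k c \<bullet> x + \<kappa> c) = 1"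
    and "\<And>x. (\<Sum>c\<in>C. (k c \<bullet> x + \<kappa> c) *\<^sub>R c) = x"
proof -
  have fin: "finite C" using indep by (rule aff_independent_finite)
  have "\<exists>a b. a \<bullet> c \<noteq> b \<and> (\<forall>c'\<in>C - {c}. a \<bullet> c' = b)" if c: "c \<in> C" for c
  proof -
    have i: "\<not> affine_dependent (C - {c})"
      using indep affine_dependent_subset by blast
    have "aff_dim (C - {c}) = int (card (C - {c})) - 1"
      using aff_dim_affine_independent[OF i] by simp
    then have "aff_dim (C - {c}) = int (DIM('a)) - 1"
      using card c fin by simp
    then obtain a b where ab: "affine hull (C - {c}) = {x. a \<bullet> x = b}"
      using aff_dim_eq_hyperplane[of "C - {c}"] by (auto simp: of_nat_diff)
    have "c \<notin> affine hull (C - {c})" using indep c by (auto simp: affine_dependent_def)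
    moreover have "C - {c} \<subseteq> affine hull (C - {c})" by (rule hull_subset)
    ultimately show ?thesis unfolding ab by blast
  qed
  then obtain a b where ab: "\<And>c. c \<in> C \<Longrightarrow> a c \<bullet> c \<noteq> b c"
    "\<And>c c'. c \<in> C \<Longrightarrow> c' \<in> C \<Longrightarrow> c' \<noteq> c \<Longrightarrow> a c \<bullet> c' = b c" by (metis DiffI empty_iff insert_iff)
  define k where "k = (\<lambda>c. a c /\<^sub>R (a c \<bullet> c - b c))"
  define \<kappa> where "\<kappa> = (\<lambda>c. - b c / (a c \<bullet> c - b c))"
  have k\<kappa>: "k c \<bullet> x + \<kappa> c = (a c \<bullet> x - b c) / (a c \<bullet> c - b c)" for c x
    by (simp add: k_def \<kappa>_def field_simps diff_divide_distrib)
  have delta: "k c \<bullet> c' + \<kappa> c = (if c' = c then 1 else 0)" if "c \<in> C" "c' \<in> C" for c c'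
    using ab(1)[OF that(1)] ab(2)[OF that] by (auto simp: k\<kappa>)
  have rep: "(\<Sum>c\<in>C. k c \<bullet> x + \<kappa> c) = 1 \<and> (\<Sum>c\<in>C. (k c \<bullet> x + \<kappa> c) *\<^sub>R c) = x" for x
  proof -
    have "aff_dim C = int (DIM('a))"
      using aff_dim_affine_independent[OF indep] card by simp
    then have "x \<in> affine hull C" by (simp add: aff_dim_eq_full)
    then obtain u where u: "sum u C = 1" "(\<Sum>v\<in>C. u v *\<^sub>R v) = x"
      using affine_hull_finite[OF fin] by auto
    have "k c \<bullet> x + \<kappa> c = u c" if c: "c \<in> C" for c
    proof -
      have "k c \<bullet> x = (\<Sum>v\<in>C. u v * (k c \<bullet> v))"
        unfolding u(2)[symmetric] by (simp add: inner_sum_right)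
      moreover have "\<kappa> c = (\<Sum>v\<in>C. u v * \<kappa> c)" using u(1) by (simp flip: sum_distrib_right)
      ultimately have "k c \<bullet> x + \<kappa> c = (\<Sum>v\<in>C. u v * (k c \<bullet> v)) + (\<Sum>v\<in>C. u v * \<kappa> c)"
        by simp
      also have "\<dots> = (\<Sum>v\<in>C. u v * (k c \<bullet> v + \<kappa> c))"
        by (simp add: sum.distrib distrib_left)
      also have "\<dots> = (\<Sum>v\<in>C. if v = c then u v else 0)"
        using delta[OF c] by (intro sum.cong) auto
      finally show ?thesis using c fin by simp
    qed
    then show ?thesis using u by simp
  qed
  show ?thesis by (rule that[OF delta rep[THEN conjunct1] rep[THEN conjunct2]])
qed

locale barycentric_frame =
  fixes T C :: "'a::euclidean_space set" and k :: "'a \<Rightarrow> 'a" and \<kappa> :: "'a \<Rightarrow> real"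
  assumes indep: "\<not> affine_dependent C" and card_vertices: "card C = DIM('a) + 1"
    and simplex_eq: "T = convex hull C"
    and delta: "\<And>c c'. c \<in> C \<Longrightarrow> c' \<in> C \<Longrightarrow> k c \<bullet> c' + \<kappa> c = (if c' = c then 1 else 0)"
    and coords_sum: "\<And>x. (\<Sum>c\<in>C. k c \<bullet> x + \<kappa> c) = 1"
    and coords_rep: "\<And>x. (\<Sum>c\<in>C. (k c \<bullet> x + \<kappa> c) *\<^sub>R c) = x"
begin

lemma finite_vertices: "finite C"
  using indep by (rule aff_independent_finite)

lemma extreme_points: "x extreme_point_of T \<longleftrightarrow> x \<in> C"
  unfolding simplex_eq by (rule extreme_point_of_convex_hull_affine_independent[OF indep])

lemma coords_drop:
  assumes "u \<in> C" "k u \<bullet> x + \<kappa> u = 0"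
  shows "(\<Sum>c\<in>C - {u}. k c \<bullet> x + \<kappa> c) = 1" "(\<Sum>c\<in>C - {u}. (k c \<bullet> x + \<kappa> c) *\<^sub>R c) = x"
  using coords_sum[of x] coords_rep[of x] assms finite_vertices by (simp_all add: sum.remove)

lemma simplex_iff: "x \<in> T \<longleftrightarrow> (\<forall>c\<in>C. 0 \<le> k c \<bullet> x + \<kappa> c)"
proof
  have "0 \<le> k c \<bullet> x + \<kappa> c \<longleftrightarrow> k c \<bullet> x \<ge> - \<kappa> c" for c x by linarith
  then have "{x. \<forall>c\<in>C. 0 \<le> k c \<bullet> x + \<kappa> c} = (\<Inter>c\<in>C. {x. k c \<bullet> x \<ge> - \<kappa> c})" by auto
  then have "convex {x. \<forall>c\<in>C. 0 \<le> k c \<bullet> x + \<kappa> c}" by (simp add: convex_INT convex_halfspace_ge)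
  then have "T \<subseteq> {x. \<forall>c\<in>C. 0 \<le> k c \<bullet> x + \<kappa> c}"
    unfolding simplex_eq using delta by (intro hull_minimal) auto
  then show "x \<in> T \<Longrightarrow> \<forall>c\<in>C. 0 \<le> k c \<bullet> x + \<kappa> c" by blast
  assume "\<forall>c\<in>C. 0 \<le> k c \<bullet> x + \<kappa> c"
  then show "x \<in> T"
    unfolding simplex_eq convex_hull_finite[OF finite_vertices]
    by (intro CollectI exI[of _ "\<lambda>c. k c \<bullet> x + \<kappa> c"] conjI coords_sum coords_rep)
qed

lemma affine_hull_opposite:
  assumes u: "u \<in> C"
  shows "affine hull (C - {u}) = {x. k u \<bullet> x + \<kappa> u = 0}"
proof
  have "{x. k u \<bullet> x + \<kappa> u = 0} = {x. k u \<bullet> x = - \<kappa> u}" by (auto simp: add_eq_0_iff2)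
  then have "affine {x. k u \<bullet> x + \<kappa> u = 0}" by (simp add: affine_hyperplane)
  then show "affine hull (C - {u}) \<subseteq> {x. k u \<bullet> x + \<kappa> u = 0}"
    using delta u by (intro hull_minimal) auto
  show "{x. k u \<bullet> x + \<kappa> u = 0} \<subseteq> affine hull (C - {u})"
  proof
    fix x assume "x \<in> {x. k u \<bullet> x + \<kappa> u = 0}"
    then have "k u \<bullet> x + \<kappa> u = 0" by simp
    note drop = coords_drop[OF u this]
    have "finite (C - {u})" using finite_vertices by simp
    then show "x \<in> affine hull (C - {u})"
      unfolding affine_hull_finite[OF \<open>finite (C - {u})\<close>]
      by (intro CollectI exI[of _ "\<lambda>c. k c \<bullet> x + \<kappa> c"] conjI drop)
  qed
qed

lemma convex_hull_opposite:
  assumes u: "u \<in> C"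
  shows "x \<in> convex hull (C - {u}) \<longleftrightarrow> x \<in> T \<and> k u \<bullet> x + \<kappa> u = 0"
proof
  assume "x \<in> convex hull (C - {u})"
  moreover have "convex hull (C - {u}) \<subseteq> T" unfolding simplex_eq by (rule hull_mono) blast
  ultimately show "x \<in> T \<and> k u \<bullet> x + \<kappa> u = 0"
    using convex_hull_subset_affine_hull[of "C - {u}"] affine_hull_opposite[OF u] by auto
next
  assume x: "x \<in> T \<and> k u \<bullet> x + \<kappa> u = 0"
  then have drop: "k u \<bullet> x + \<kappa> u = 0" and pos: "\<forall>c\<in>C - {u}. 0 \<le> k c \<bullet> x + \<kappa> c"
    using simplex_iff by auto
  have "finite (C - {u})" using finite_vertices by simp
  then show "x \<in> convex hull (C - {u})"
    unfolding convex_hull_finite[OF \<open>finite (C - {u})\<close>]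
    by (intro CollectI exI[of _ "\<lambda>c. k c \<bullet> x + \<kappa> c"] conjI coords_drop[OF u drop] pos)
qed

lemma facet_iff: "S facet_of T \<longleftrightarrow> (\<exists>u\<in>C. S = convex hull (C - {u}))"
proof -
  have "convex hull (C - {u}) \<noteq> {}" for u
  proof
    assume "convex hull (C - {u}) = {}"
    then have "C - {u} = {}" by simp
    then have "card C \<le> card {u}" by (intro card_mono) auto
    then show False by (simp add: card_vertices)
  qed
  then show ?thesis
    unfolding simplex_eq facet_of_convex_hull_affine_independent[OF indep] by blast
qed

end

lemma simplex_barycentric:
  fixes T :: "'a::euclidean_space set"
  assumes "int DIM('a) simplex T"
  obtains C k \<kappa> where "barycentric_frame T C k \<kappa>"
proof -
  obtain C where C: "\<not> affine_dependent C" "int (card C) = int (DIM('a)) + 1" "T = convex hull C"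
    using assms unfolding simplex_def by blast
  have card: "card C = DIM('a) + 1" using C(2) by linarith
  show ?thesis
  proof (rule barycentric_coordinates[OF C(1) card])
    fix k \<kappa>
    assume "\<And>c c'. c \<in> C \<Longrightarrow> c' \<in> C \<Longrightarrow> k c \<bullet> c' + \<kappa> c = (if c' = c then 1 else 0 :: real)"
      and "\<And>x. (\<Sum>c\<in>C. k c \<bullet> x + \<kappa> c) = 1" and "\<And>x. (\<Sum>c\<in>C. (k c \<bullet> x + \<kappa> c) *\<^sub>R c) = x"
    note coords = this
    have "barycentric_frame T C k \<kappa>"
      by (intro barycentric_frame.intro C(1) card C(3) coords)
    then show thesis by (rule that)
  qed
qed

text \<open>The outer normal of the facet opposite to a vertex is the normalized negative gradient of the barycentric
coordinate of that vertex.\<close>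

lemma
  fixes T :: "'a::euclidean_space set"
  assumes T: "int DIM('a) simplex T" and S: "S facet_of T"
  shows norm_outer_normal: "norm (outer_normal T S) = 1"
    and affine_hull_facet: "affine hull S = {x. outer_normal T S \<bullet> x = facet_offset T S}"
    and outer_normal_le: "\<And>x. x \<in> T \<Longrightarrow> outer_normal T S \<bullet> x \<le> facet_offset T S"
    and outer_normal_facet: "\<And>x. x \<in> S \<Longrightarrow> outer_normal T S \<bullet> x = facet_offset T S"
    and facet_height_pos: "facet_height T S > 0"
    and facet_apex_mem: "facet_apex T S \<in> T"
    and facet_apex_unique: "\<And>p. p extreme_point_of T \<Longrightarrow> p \<notin> S \<Longrightarrow> p = facet_apex T S"
    and simplex_eq_cone: "T = convex hull (insert (facet_apex T S) S)"
    and compact_facet: "compact S" and convex_facet: "convex S" and facet_nonempty: "S \<noteq> {}"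
proof -
  obtain C k \<kappa> where "barycentric_frame T C k \<kappa>" by (rule simplex_barycentric[OF T])
  then interpret barycentric_frame T C k \<kappa> .
  obtain u where u: "u \<in> C" and Su: "S = convex hull (C - {u})" using S facet_iff by blast
  show cS: "compact S" "convex S" using finite_vertices Su by (auto simp: finite_imp_compact_convex_hull)
  show ne: "S \<noteq> {}" using S by (simp add: facet_of_def)
  then obtain x0 where x0: "x0 \<in> S" by blast
  have uu: "k u \<bullet> u + \<kappa> u = 1" using delta[OF u u] by simp
  have S_eq: "S = {x\<in>T. k u \<bullet> x + \<kappa> u = 0}" using convex_hull_opposite[OF u] Su by auto
  have uS: "u \<notin> S" using uu S_eq by simp
  have uT: "u \<in> T" using u simplex_eq hull_subset[of C convex] by auto
  have k0: "k u \<noteq> 0"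
  proof
    assume "k u = 0"
    then show False using uu x0 S_eq by simp
  qed
  have apex_uniq: "p = u" if "p extreme_point_of T" "p \<notin> S" for p
  proof (rule ccontr)
    assume "p \<noteq> u"
    then have "p \<in> C - {u}" using that extreme_points by auto
    then show False using that Su hull_subset[of "C - {u}" convex] by auto
  qed
  have apex: "facet_apex T S = u"
    unfolding facet_apex_def using u uS extreme_points apex_uniq by (intro the_equality) blast+
  define n where "n = - k u /\<^sub>R norm (k u)"
  have n1: "norm n = 1" using k0 by (simp add: n_def)
  then have nn: "n \<bullet> n = 1" by (simp add: norm_eq_1)
  have nk: "n \<bullet> x = - (k u \<bullet> x) / norm (k u)" for x by (simp add: n_def divide_inverse)
  have aff_S: "affine hull S = {x. k u \<bullet> x + \<kappa> u = 0}"
    using affine_hull_opposite[OF u] Su by (simp add: affine_hull_convex_hull)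
  have normal: "outer_normal T S = n"
    unfolding outer_normal_def
  proof (rule the_equality)
    show "norm n = 1 \<and> (\<forall>x\<in>S. \<forall>y\<in>T. n \<bullet> (y - x) \<le> 0)"
    proof (intro conjI ballI n1)
      fix x y assume "x \<in> S" "y \<in> T"
      then have "k u \<bullet> x \<le> k u \<bullet> y" using S_eq simplex_iff[of y] u by auto
      then show "n \<bullet> (y - x) \<le> 0" by (simp add: nk inner_diff_right divide_simps)
    qed
  next
    \<comment> \<open>A competing normal is orthogonal to the hyperplane of \<open>S\<close>, hence \<open>n\<close> or \<open>-n\<close>, and the vertex \<open>u\<close>\<close>
    \<comment> \<open>excludes the latter.\<close>
    fix n' assume n': "norm n' = 1 \<and> (\<forall>x\<in>S. \<forall>y\<in>T. n' \<bullet> (y - x) \<le> 0)"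
    have ST: "S \<subseteq> T" using S_eq by auto
    have "n' \<bullet> x = n' \<bullet> x0" if "x \<in> S" for x
    proof -
      have "n' \<bullet> (x - x0) \<le> 0" "n' \<bullet> (x0 - x) \<le> 0" using n' that x0 ST by auto
      then show ?thesis by (simp add: inner_diff_right)
    qed
    then have "affine hull S \<subseteq> {x. n' \<bullet> x = n' \<bullet> x0}"
      by (intro hull_minimal) (auto simp: affine_hyperplane)
    moreover define w where "w = n' - (n \<bullet> n') *\<^sub>R n"
    have nw: "n \<bullet> w = 0" by (simp add: w_def inner_diff_right nn)
    then have "k u \<bullet> w = 0" using k0 by (simp add: nk)
    then have "x0 + w \<in> affine hull S" using x0 S_eq unfolding aff_S by (simp add: inner_add_right)
    ultimately have "n' \<bullet> w = 0" by (auto simp: inner_add_right)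
    then have "w \<bullet> w = 0" using nw by (simp add: w_def inner_diff_left)
    then have n'n: "n' = (n \<bullet> n') *\<^sub>R n" by (simp add: w_def)
    then have "\<bar>n \<bullet> n'\<bar> = 1" using n' n1 by (metis mult.right_neutral norm_scaleR)
    moreover have "n \<bullet> n' \<noteq> -1"
    proof
      assume "n \<bullet> n' = -1"
      then have "n' = - n" using n'n by simp
      moreover have "n' \<bullet> (u - x0) \<le> 0" using n' x0 uT by blast
      moreover have "k u \<bullet> x0 + \<kappa> u = 0" using x0 S_eq by simp
      then have "k u \<bullet> (u - x0) = 1" using uu by (simp add: inner_diff_right)
      then have "n \<bullet> (u - x0) < 0" using k0 by (simp add: nk)
      ultimately show False by simp
    qed
    ultimately have "n \<bullet> n' = 1" by linarith
    then show "n' = n" using n'n by simp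
  qed
  have off: "facet_offset T S = \<kappa> u / norm (k u)"
  proof -
    have "(SOME x. x \<in> S) \<in> S" using x0 by (rule someI)
    then have "k u \<bullet> (SOME x. x \<in> S) = - \<kappa> u" using S_eq by (simp add: add_eq_0_iff2)
    then show ?thesis by (simp add: facet_offset_def normal nk)
  qed
  show "norm (outer_normal T S) = 1" by (simp add: normal n1)
  show "affine hull S = {x. outer_normal T S \<bullet> x = facet_offset T S}"
    unfolding aff_S normal off nk using k0 by (auto simp: field_simps add_eq_0_iff)
  show "outer_normal T S \<bullet> x \<le> facet_offset T S" if "x \<in> T" for x
  proof -
    have "0 \<le> k u \<bullet> x + \<kappa> u" using that simplex_iff u by blast
    then show ?thesis unfolding normal off nk by (intro divide_right_mono) auto
  qed
  show "outer_normal T S \<bullet> x = facet_offset T S" if "x \<in> S" for x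
    using that S_eq unfolding normal off nk by (auto simp: add_eq_0_iff)
  have "facet_height T S = (\<kappa> u + k u \<bullet> u) / norm (k u)"
    unfolding facet_height_def normal off nk apex by (simp add: add_divide_distrib)
  then show "facet_height T S > 0" using uu k0 by (simp add: add.commute)
  show "facet_apex T S \<in> T" using apex uT by simp
  show "p = facet_apex T S" if "p extreme_point_of T" "p \<notin> S" for p using apex_uniq[OF that] apex by simp
  have "T = convex hull (insert u (C - {u}))" using simplex_eq u by (simp add: insert_absorb)
  also have "\<dots> = convex hull (insert u S)"
    unfolding Su by (metis hull_hull hull_insert)
  finally show "T = convex hull (insert (facet_apex T S) S)" unfolding apex .
qed

lemma facet_apex_other:
  fixes T :: "'a::euclidean_space set"
  assumes T: "int DIM('a) simplex T" and S: "S facet_of T" "S' facet_of T" "S' \<noteq> S"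
  shows "facet_apex T S \<in> S'"
proof -
  obtain C k \<kappa> where "barycentric_frame T C k \<kappa>" by (rule simplex_barycentric[OF T])
  then interpret barycentric_frame T C k \<kappa> .
  obtain u where u: "u \<in> C" and Su: "S = convex hull (C - {u})" using S(1) facet_iff by blast
  obtain v where v: "v \<in> C" and Sv: "S' = convex hull (C - {v})" using S(2) facet_iff by blast
  have "u \<notin> S" using convex_hull_opposite[OF u] delta[OF u u] by (simp add: Su)
  then have "u = facet_apex T S" using facet_apex_unique[OF T S(1)] u extreme_points by auto
  moreover have "u \<noteq> v" using Su Sv S(3) by blast
  ultimately show ?thesis using u Sv hull_subset[of "C - {v}" convex] by auto
qed

lemma finite_facets:
  fixes T :: "'a::euclidean_space set"
  assumes "int DIM('a) simplex T" shows "finite {S. S facet_of T}"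
  using assms by (intro finite_polytope_facets simplex_imp_polytope)

text \<open>The lowest-order Raviart-Thomas field on \<open>T\<close> with prescribed normal fluxes: the term of \<open>S\<close> has normal
component \<open>F T S\<close> on \<open>S\<close>, and is tangential to the other facets because they contain the apex.\<close>

definition local_field :: "('a::euclidean_space set \<Rightarrow> 'a set \<Rightarrow> real) \<Rightarrow> 'a set \<Rightarrow> 'a \<Rightarrow> 'a" where
  "local_field F T x = (\<Sum>S | S facet_of T. (F T S / facet_height T S) *\<^sub>R (x - facet_apex T S))"

lemma local_field_normal:
  fixes T :: "'a::euclidean_space set"
  assumes T: "int DIM('a) simplex T" and S: "S facet_of T" and x: "x \<in> S"
  shows "outer_normal T S \<bullet> local_field F T x = F T S"
proof -
  let ?n = "outer_normal T S"
  have 0: "?n \<bullet> (x - facet_apex T S') = (if S' = S then facet_height T S else 0)" if "S' facet_of T" for S'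
    using outer_normal_facet[OF T S x] outer_normal_facet[OF T S facet_apex_other[OF T that S]]
    by (auto simp: inner_diff_right facet_height_def)
  have "?n \<bullet> local_field F T x = (\<Sum>S' | S' facet_of T. (F T S' / facet_height T S') * (?n \<bullet> (x - facet_apex T S')))"
    by (simp add: local_field_def inner_sum_right)
  also have "\<dots> = (\<Sum>S' | S' facet_of T. if S' = S then F T S else 0)"
    using facet_height_pos[OF T S] by (intro sum.cong) (auto simp: 0)
  also have "\<dots> = F T S" using S finite_facets[OF T] by simp
  finally show ?thesis .
qed

text \<open>The difference of the two fields is tangential to every facet.  At a vertex it is tangential to all
facets through that vertex, which forces it to vanish there; an affine field that vanishes at all
vertices is zero.\<close>

lemma affine_eq_local_field:
  fixes T :: "'a::euclidean_space set" and w L :: "'a \<Rightarrow> 'a"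
  assumes T: "int DIM('a) simplex T" and L: "linear L" and w: "\<And>x. w x = L x + a"
    and \<sigma>: "\<And>S x. S facet_of T \<Longrightarrow> x \<in> S \<Longrightarrow> outer_normal T S \<bullet> w x = F T S"
  shows "w x = local_field F T x"
proof -
  obtain C k \<kappa> where "barycentric_frame T C k \<kappa>" by (rule simplex_barycentric[OF T])
  then interpret barycentric_frame T C k \<kappa> .
  define D where "D x = w x - local_field F T x" for x
  define D0 where "D0 x = L x - (\<Sum>S | S facet_of T. F T S / facet_height T S) *\<^sub>R x" for x
  define e where "e = a + (\<Sum>S | S facet_of T. (F T S / facet_height T S) *\<^sub>R facet_apex T S)"
  have D_eq: "D x = D0 x + e" for x
    by (simp add: D_def D0_def e_def w local_field_def scaleR_diff_right sum_subtractf scaleR_sum_left)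
  have D0: "linear D0"
    unfolding D0_def using L by (intro linear_compose_sub linear_scale_self)
  have nD: "outer_normal T S \<bullet> D x = 0" if "S facet_of T" "x \<in> S" for S x
    using \<sigma>[OF that] local_field_normal[OF T that] by (simp add: D_def inner_diff_right)
  have Dc: "D c = 0" if c: "c \<in> C" for c
  proof -
    \<comment> \<open>Moving from \<open>c\<close> in the direction \<open>D c\<close> stays in the hyperplanes of all facets through \<open>c\<close>.\<close>
    have other: "k c' \<bullet> (c + D c) + \<kappa> c' = 0" if c': "c' \<in> C" "c' \<noteq> c" for c'
    proof -
      let ?S = "convex hull (C - {c'})"
      have S: "?S facet_of T" using facet_iff c' by blast
      have cS: "c \<in> ?S" using c c' hull_subset[of "C - {c'}" convex] by auto
      have "outer_normal T ?S \<bullet> (c + D c) = facet_offset T ?S"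
        using nD[OF S cS] outer_normal_facet[OF T S cS] by (simp add: inner_add_right)
      then have "c + D c \<in> affine hull ?S" unfolding affine_hull_facet[OF T S] by blast
      then show ?thesis using affine_hull_opposite[OF c'(1)] by (simp add: affine_hull_convex_hull)
    qed
    have "(\<Sum>c'\<in>C. k c' \<bullet> (c + D c) + \<kappa> c') = (\<Sum>c'\<in>{c}. k c' \<bullet> (c + D c) + \<kappa> c')"
      using c finite_vertices other by (intro sum.mono_neutral_right) auto
    then have "k c \<bullet> (c + D c) + \<kappa> c = 1" by (simp only: coords_sum) simp
    moreover have "(\<Sum>c'\<in>C. (k c' \<bullet> (c + D c) + \<kappa> c') *\<^sub>R c')
        = (\<Sum>c'\<in>{c}. (k c' \<bullet> (c + D c) + \<kappa> c') *\<^sub>R c')"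
      using c finite_vertices other by (intro sum.mono_neutral_right) auto
    ultimately have "c + D c = c" by (simp only: coords_rep) simp
    then show ?thesis by simp
  qed
  have "D x = 0"
  proof -
    have "D0 x = (\<Sum>c\<in>C. (k c \<bullet> x + \<kappa> c) *\<^sub>R D0 c)"
      by (subst coords_rep[of x, symmetric]) (simp add: linear_sum[OF D0] linear_scale[OF D0])
    moreover have "e = (\<Sum>c\<in>C. (k c \<bullet> x + \<kappa> c) *\<^sub>R e)"
      by (simp add: coords_sum flip: scaleR_sum_left)
    ultimately have "D x = (\<Sum>c\<in>C. (k c \<bullet> x + \<kappa> c) *\<^sub>R D c)"
      by (simp add: D_eq scaleR_add_right sum.distrib)
    then show ?thesis using Dc by simp
  qed
  then show ?thesis by (simp add: D_def)
qed

section \<open>Centroids and integration by parts on a simplex\<close>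

definition side_area :: "'a::euclidean_space set \<Rightarrow> real" where
  "side_area S = measure (side_measure S) S"

definition side_centroid :: "'a::euclidean_space set \<Rightarrow> 'a" where
  "side_centroid S = (LINT x|side_measure S. x) /\<^sub>R side_area S"

definition centroid :: "'a::euclidean_space set \<Rightarrow> 'a" where
  "centroid T = (LINT x|lebesgue_on T. x) /\<^sub>R measure lebesgue T"

lemma borel_measurable_hyperplane_proj [measurable]: "hyperplane_proj n \<beta> \<in> borel_measurable borel"
  by (intro borel_measurable_continuous_onI continuous_intros)

lemma measure_simplex_pos:
  fixes T :: "'a::euclidean_space set"
  assumes T: "int DIM('a) simplex T" shows "measure lebesgue T > 0" "interior T \<noteq> {}"
proof -
  have "affine hull T = UNIV" using aff_dim_simplex[OF T] by (simp add: aff_dim_eq_full)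
  moreover have "T \<noteq> {}" using aff_dim_simplex[OF T] by auto
  ultimately show i: "interior T \<noteq> {}"
    using rel_interior_interior rel_interior_eq_empty convex_simplex[OF T] by metis
  then have "\<not> negligible T" using negligible_convex_interior convex_simplex[OF T] by metis
  moreover have "T \<in> lmeasurable" using compact_simplex[OF T] by (rule lmeasurable_compact)
  ultimately show "measure lebesgue T > 0"
    by (metis completion.complete_measure_axioms linorder_neqE measure_nonneg negligible_iff_measure0 not_less order_le_less)
qed

lemma integral_lebesgue_on_compact:
  fixes f :: "'a::euclidean_space \<Rightarrow> 'b::euclidean_space"
  assumes K: "compact K" and f: "continuous_on UNIV f"
  shows "(LINT x|lebesgue_on K. f x) = (LINT x:K|lborel. f x)"
    and "integrable (lebesgue_on K) f" and "set_integrable lborel K f"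
proof -
  have [measurable]: "K \<in> sets borel" using K by (rule borel_compact)
  have [measurable]: "f \<in> borel_measurable borel" using f by (rule borel_measurable_continuous_onI)
  show i: "set_integrable lborel K f"
    unfolding set_integrable_def using K f continuous_on_subset by (intro borel_integrable_compact) blast+
  show "(LINT x|lebesgue_on K. f x) = (LINT x:K|lborel. f x)"
    by (subst integral_restrict_space) (auto simp: set_lebesgue_integral_def integral_completion)
  show "integrable (lebesgue_on K) f"
    using i by (subst integrable_restrict_space) (auto simp: set_integrable_def integrable_completion)
qed

context
  fixes T S :: "'a::euclidean_space set"
  assumes T: "int DIM('a) simplex T" and S: "S facet_of T"
begin

abbreviation (input) "nrm \<equiv> outer_normal T S"
abbreviation (input) "ofs \<equiv> facet_offset T S"

lemma side_measure_facet:
  "side_measure S = distr (restrict_space lborel (prism nrm ofs S)) borel (hyperplane_proj nrm ofs)"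
proof -
  have n: "norm nrm = 1" by (rule norm_outer_normal[OF T S])
  have "dist z (hyperplane_proj nrm ofs z) = \<bar>nrm \<bullet> z - ofs\<bar>" for z
    using n by (simp add: hyperplane_proj_def dist_norm)
  then show ?thesis
    unfolding side_measure_def Let_def affine_hull_facet[OF T S] closest_point_hyperplane[OF n] prism_def
    by simp
qed

lemma compact_side_prism: "compact (prism nrm ofs S)"
  by (rule compact_prism[OF norm_outer_normal[OF T S] compact_facet[OF T S]])

lemma sets_side_prism [measurable]: "prism nrm ofs S \<in> sets borel"
  using compact_side_prism by (rule borel_compact)

lemma measurable_side_proj [measurable]:
  "hyperplane_proj nrm ofs \<in> restrict_space lborel (prism nrm ofs S) \<rightarrow>\<^sub>M borel"
  by (rule measurable_restrict_space1) simp

lemma integral_side_measure: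
  fixes w :: "'a \<Rightarrow> 'b::euclidean_space"
  assumes "w \<in> borel_measurable borel"
  shows "(LINT x|side_measure S. w x) = (LINT z:prism nrm ofs S|lborel. w (hyperplane_proj nrm ofs z))"
  unfolding side_measure_facet using assms
  by (subst integral_distr) (auto simp: integral_restrict_space set_lebesgue_integral_def)

lemma measure_side_measure:
  assumes "A \<in> sets borel"
  shows "measure (side_measure S) A = measure lborel {z \<in> prism nrm ofs S. hyperplane_proj nrm ofs z \<in> A}"
proof -
  have "hyperplane_proj nrm ofs -` A \<inter> prism nrm ofs S = {z \<in> prism nrm ofs S. hyperplane_proj nrm ofs z \<in> A}"
    by auto
  then show ?thesis
    unfolding side_measure_facet using assms
    by (simp add: measure_distr space_restrict_space measure_restrict_space)
qed

lemma sets_facet: "S \<in> sets borel"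
  using compact_facet[OF T S] by (rule borel_compact)

lemma side_area_eq: "side_area S = measure lborel (prism nrm ofs S)"
  unfolding side_area_def measure_side_measure[OF sets_facet]
  by (rule arg_cong[where f="measure lborel"]) (auto simp: prism_def)

lemma measure_side_measure_UNIV: "measure (side_measure S) UNIV = side_area S"
  unfolding side_area_eq by (subst measure_side_measure) auto

lemma facet_volume: "DIM('a) * measure lebesgue T = facet_height T S * side_area S"
proof -
  have "nrm \<bullet> facet_apex T S = ofs - facet_height T S" by (simp add: facet_height_def)
  from cone_volume[OF norm_outer_normal[OF T S] compact_facet[OF T S] convex_facet[OF T S]
      facet_nonempty[OF T S] outer_normal_facet[OF T S] this facet_height_pos[OF T S]]
  have "DIM('a) * measure lborel T = facet_height T S * side_area S"
    unfolding side_area_eq simplex_eq_cone[OF T S, symmetric] .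
  then show ?thesis
    using borel_compact[OF compact_simplex[OF T]] by (simp add: measure_completion)
qed

lemma side_area_pos: "side_area S > 0"
  using facet_volume measure_simplex_pos(1)[OF T] facet_height_pos[OF T S]
  by (metis DIM_positive mult_pos_pos of_nat_0_less_iff zero_less_mult_pos)

lemma AE_side_measure: "AE x in side_measure S. x \<in> S"
  unfolding side_measure_facet
proof (subst AE_distr_iff)
  show "AE x in restrict_space lborel (prism nrm ofs S). hyperplane_proj nrm ofs x \<in> S"
    by (rule AE_I2) (auto simp: prism_def space_restrict_space)
qed (use sets_facet in auto)

lemma finite_side_measure: "finite_measure (side_measure S)"
proof
  have "emeasure (side_measure S) (space (side_measure S)) = emeasure lborel (prism nrm ofs S)"
    unfolding side_measure_facet
    by (subst emeasure_distr) (auto simp: space_restrict_space emeasure_restrict_space)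
  then show "emeasure (side_measure S) (space (side_measure S)) \<noteq> \<infinity>"
    using emeasure_compact_finite[OF compact_side_prism] by (auto simp: less_top)
qed

lemma space_side_measure: "space (side_measure S) = UNIV"
  by (simp add: side_measure_facet)

lemma borel_measurable_side_measure: "borel_measurable (side_measure S) = borel_measurable borel"
  by (rule measurable_cong_sets) (simp_all add: side_measure_facet)

lemma integrable_side_prism:
  fixes w :: "'a \<Rightarrow> 'b::euclidean_space"
  assumes "continuous_on UNIV w"
  shows "set_integrable lborel (prism nrm ofs S) (\<lambda>z. w (hyperplane_proj nrm ofs z))"
  unfolding set_integrable_def
  by (intro borel_integrable_compact compact_side_prism continuous_on_compose2[OF assms] continuous_intros) auto

lemma integral_side_affine:
  "(LINT x|side_measure S. \<alpha> \<bullet> x + \<gamma>) = side_area S * (\<alpha> \<bullet> side_centroid S + \<gamma>)"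
proof -
  interpret finite_measure "side_measure S" by (rule finite_side_measure)
  have "set_integrable lborel (prism nrm ofs S) (\<lambda>z. hyperplane_proj nrm ofs z)"
    by (rule integrable_side_prism[of "\<lambda>x. x"]) (rule continuous_on_id)
  then have i: "integrable (side_measure S) (\<lambda>x. x)"
    unfolding side_measure_facet
    by (subst integrable_distr_eq) (auto simp: integrable_restrict_space set_integrable_def)
  have "integrable (side_measure S) (\<lambda>x. \<gamma>)" by simp
  then have "(LINT x|side_measure S. \<alpha> \<bullet> x + \<gamma>) = \<alpha> \<bullet> (LINT x|side_measure S. x) + \<gamma> * side_area S"
    using i by (subst Bochner_Integration.integral_add) (auto simp: space_side_measure measure_side_measure_UNIV)
  then show ?thesis using side_area_pos by (simp add: side_centroid_def field_simps)
qed

lemma side_average_affine: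
  assumes w: "w \<in> borel_measurable borel" "\<And>x. x \<in> S \<Longrightarrow> w x = \<alpha> \<bullet> x + \<gamma>"
  shows "side_average S w = \<alpha> \<bullet> side_centroid S + \<gamma>"
proof -
  have "(LINT x|side_measure S. w x) = (LINT x|side_measure S. \<alpha> \<bullet> x + \<gamma>)"
  proof (rule integral_cong_AE)
    show "w \<in> borel_measurable (side_measure S)" "(\<lambda>x. \<alpha> \<bullet> x + \<gamma>) \<in> borel_measurable (side_measure S)"
      using w(1) by (simp_all add: borel_measurable_side_measure)
    show "AE x in side_measure S. w x = \<alpha> \<bullet> x + \<gamma>"
      using AE_side_measure w(2) by auto
  qed
  then show ?thesis
    using side_area_pos by (simp add: side_average_def integral_side_affine flip: side_area_def)
qed

end

lemma integral_simplex_affine: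
  fixes T :: "'a::euclidean_space set"
  assumes T: "int DIM('a) simplex T"
  shows "(LINT x|lebesgue_on T. \<alpha> \<bullet> x + \<gamma>) = measure lebesgue T * (\<alpha> \<bullet> centroid T + \<gamma>)"
proof -
  note i = integral_lebesgue_on_compact(2)[OF compact_simplex[OF T] continuous_on_id]
  have fin: "integrable (lebesgue_on T) (\<lambda>x. \<gamma>)"
    by (rule integral_lebesgue_on_compact(2)[OF compact_simplex[OF T] continuous_on_const])
  have m: "measure (lebesgue_on T) T = measure lebesgue T"
    using compact_simplex[OF T] by (simp add: measure_restrict_space lmeasurable_compact fmeasurableD)
  have "(LINT x|lebesgue_on T. \<alpha> \<bullet> x + \<gamma>) = \<alpha> \<bullet> (LINT x|lebesgue_on T. x) + \<gamma> * measure lebesgue T"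
    using i fin m by (subst Bochner_Integration.integral_add) auto
  then show ?thesis using measure_simplex_pos[OF T] by (simp add: centroid_def field_simps)
qed

context barycentric_frame
begin

lemma equal_coords_mean:
  assumes D: "D \<subseteq> C" and eq: "\<And>a b. a \<in> D \<Longrightarrow> b \<in> D \<Longrightarrow> k a \<bullet> x + \<kappa> a = k b \<bullet> x + \<kappa> b"
    and zero: "\<And>c. c \<in> C - D \<Longrightarrow> k c \<bullet> x + \<kappa> c = 0"
  shows "card D *\<^sub>R x = \<Sum>D"
proof -
  obtain t where t: "\<And>a. a \<in> D \<Longrightarrow> k a \<bullet> x + \<kappa> a = t" using eq by metis
  have "(\<Sum>c\<in>C. k c \<bullet> x + \<kappa> c) = (\<Sum>c\<in>D. t)"
    using D zero t finite_vertices by (intro sum.mono_neutral_cong_right) auto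
  then have one: "card D * t = 1" by (simp add: coords_sum)
  have "(\<Sum>c\<in>C. (k c \<bullet> x + \<kappa> c) *\<^sub>R c) = (\<Sum>c\<in>D. t *\<^sub>R c)"
    using D zero t finite_vertices by (intro sum.mono_neutral_cong_right) auto
  then have "x = t *\<^sub>R \<Sum>D" by (simp add: coords_rep scaleR_sum_right)
  then have "card D *\<^sub>R x = (card D * t) *\<^sub>R \<Sum>D" by (simp only: scaleR_scaleR)
  then show ?thesis by (simp only: one scaleR_one)
qed

lemma k_diff:
  assumes "a \<in> C" "b \<in> C" "c \<in> C"
  shows "k c \<bullet> (b - a) = (if b = c then 1 else 0) - (if a = c then 1 else 0)"
  using delta[OF assms(3,1)] delta[OF assms(3,2)] by (simp add: inner_diff_right)

text \<open>The affine reflection that exchanges the vertices \<open>a\<close> and \<open>b\<close> exchanges the two barycentric coordinates, so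
that all of them remain nonnegative.\<close>

lemma swap_mem:
  assumes a: "a \<in> C" and b: "b \<in> C" and ab: "a \<noteq> b" and x: "x \<in> T"
  shows "x + ((k a - k b) \<bullet> x + (\<kappa> a - \<kappa> b)) *\<^sub>R (b - a) \<in> T"
  unfolding simplex_iff
proof
  fix c assume c: "c \<in> C"
  let ?t = "(k a - k b) \<bullet> x + (\<kappa> a - \<kappa> b)"
  have "k c \<bullet> (x + ?t *\<^sub>R (b - a)) + \<kappa> c = k c \<bullet> x + \<kappa> c + ?t * (k c \<bullet> (b - a))"
    by (simp add: inner_add_right)
  also have "\<dots> = (if c = a then k b \<bullet> x + \<kappa> b else if c = b then k a \<bullet> x + \<kappa> a else k c \<bullet> x + \<kappa> c)"
    using a b c ab by (auto simp: k_diff inner_diff_left)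
  finally show "0 \<le> k c \<bullet> (x + ?t *\<^sub>R (b - a)) + \<kappa> c"
    using x a b c unfolding simplex_iff by (auto split: if_splits)
qed

lemma simplex_antisymmetric_integral:
  assumes A: "A \<in> sets borel" and ab: "a \<in> C" "b \<in> C" "a \<noteq> b"
    and P: "\<And>x. (k a - k b) \<bullet> P x + (\<kappa> a - \<kappa> b) = m \<bullet> x + \<mu>"
    and m: "m \<bullet> (b - a) = (k a - k b) \<bullet> (b - a)"
    and inv: "\<And>x. x \<in> A \<Longrightarrow> x + (m \<bullet> x + \<mu>) *\<^sub>R (b - a) \<in> A"
  shows "(LINT x:A|lborel. (k a - k b) \<bullet> P x + (\<kappa> a - \<kappa> b)) = 0"
  unfolding P
proof (rule integral_antisymmetric_eq_0[OF _ A inv])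
  show "m \<bullet> (b - a) = -2" unfolding m using ab by (simp add: inner_diff_left k_diff)
qed

text \<open>By symmetry under exchange of two vertices all barycentric coordinates of the centroid agree.\<close>

lemma centroid_vertices:
  assumes T: "int DIM('a) simplex T"
  shows "(DIM('a) + 1) *\<^sub>R centroid T = \<Sum>C"
proof -
  have eq: "k a \<bullet> centroid T + \<kappa> a = k b \<bullet> centroid T + \<kappa> b" if ab: "a \<in> C" "b \<in> C" for a b
  proof (cases "a = b")
    case False
    have "(LINT x:T|lborel. (k a - k b) \<bullet> x + (\<kappa> a - \<kappa> b)) = 0"
      by (rule simplex_antisymmetric_integral[OF _ ab False])
         (auto intro!: borel_compact compact_simplex[OF T] swap_mem ab simp: False)
    then have "(LINT x|lebesgue_on T. (k a - k b) \<bullet> x + (\<kappa> a - \<kappa> b)) = 0"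
      by (subst integral_lebesgue_on_compact(1)[OF compact_simplex[OF T]]) (auto intro!: continuous_intros)
    then have "(k a - k b) \<bullet> centroid T + (\<kappa> a - \<kappa> b) = 0"
      using measure_simplex_pos(1)[OF T] by (simp only: integral_simplex_affine[OF T]) simp
    then show ?thesis by (simp add: inner_diff_left)
  qed simp
  have "card C *\<^sub>R centroid T = \<Sum>C"
    by (rule equal_coords_mean[OF order_refl eq]) auto
  then show ?thesis by (simp only: card_vertices)
qed

text \<open>The same symmetry for a facet, applied to the prism that defines its surface measure: the reflection acts
on the projection onto the hyperplane of the facet and leaves the height unchanged.\<close>

lemma side_centroid_vertices:
  assumes T: "int DIM('a) simplex T" and u: "u \<in> C" and S: "S = convex hull (C - {u})"
  shows "DIM('a) *\<^sub>R side_centroid S = \<Sum>(C - {u})"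
proof -
  have facet: "S facet_of T" using facet_iff u S by blast
  let ?n = "outer_normal T S" and ?\<beta> = "facet_offset T S"
  let ?P = "hyperplane_proj ?n ?\<beta>" and ?A = "prism ?n ?\<beta> S"
  note n1 = norm_outer_normal[OF T facet]
  note meas = sets_side_prism[OF T facet]
  have SI: "x \<in> S \<longleftrightarrow> x \<in> T \<and> k u \<bullet> x + \<kappa> u = 0" for x unfolding S by (rule convex_hull_opposite[OF u])
  have eq: "k a \<bullet> side_centroid S + \<kappa> a = k b \<bullet> side_centroid S + \<kappa> b" if ab: "a \<in> C - {u}" "b \<in> C - {u}" for a b
  proof (cases "a = b")
    case False
    have ab': "a \<in> C" "b \<in> C" using ab by auto
    have "a \<in> S" "b \<in> S" using ab S hull_subset[of "C - {u}" convex] by auto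
    then have nw: "?n \<bullet> (b - a) = 0" using outer_normal_facet[OF T facet] by (simp add: inner_diff_right)
    let ?K = "k a - k b" and ?c = "\<kappa> a - \<kappa> b"
    let ?m = "?K - (?K \<bullet> ?n) *\<^sub>R ?n" and ?\<mu> = "?c + ?\<beta> * (?K \<bullet> ?n)"
    have P: "?K \<bullet> ?P x + ?c = ?m \<bullet> x + ?\<mu>" for x
      by (simp add: hyperplane_proj_def inner_diff_left inner_diff_right algebra_simps)
    have "(LINT x:?A|lborel. ?K \<bullet> ?P x + ?c) = 0"
    proof (rule simplex_antisymmetric_integral[OF meas ab' False P])
      show "?m \<bullet> (b - a) = ?K \<bullet> (b - a)" using nw by (simp add: inner_diff_left)
      fix x assume x: "x \<in> ?A"
      let ?t = "?m \<bullet> x + ?\<mu>"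
      have Px: "?P (x + ?t *\<^sub>R (b - a)) = ?P x + ?t *\<^sub>R (b - a)"
        using nw by (simp add: hyperplane_proj_def inner_add_right)
      have "?P x \<in> S" using x by (simp add: prism_def)
      then have "?P x \<in> T" "k u \<bullet> ?P x + \<kappa> u = 0" using SI by auto
      moreover have "k u \<bullet> (b - a) = 0" using ab u by (subst k_diff) auto
      ultimately have "?P x + ?t *\<^sub>R (b - a) \<in> S"
        using swap_mem[OF ab' False] unfolding SI P[symmetric] by (simp add: inner_add_right)
      moreover have "?n \<bullet> (x + ?t *\<^sub>R (b - a)) = ?n \<bullet> x" using nw by (simp add: inner_add_right)
      ultimately show "x + ?t *\<^sub>R (b - a) \<in> ?A"
        using x unfolding prism_def mem_Collect_eq Px by simp
    qed
    then have "(LINT x|side_measure S. ?K \<bullet> x + ?c) = 0"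
      by (subst integral_side_measure[OF T facet]) auto
    then have "?K \<bullet> side_centroid S + ?c = 0"
      using side_area_pos[OF T facet] by (simp only: integral_side_affine[OF T facet]) simp
    then show ?thesis by (simp add: inner_diff_left)
  qed simp
  have zero: "k u \<bullet> side_centroid S + \<kappa> u = 0"
  proof -
    have "(LINT x|side_measure S. k u \<bullet> x + \<kappa> u) = (LINT x|side_measure S. 0)"
      using AE_side_measure[OF T facet] SI
      by (intro integral_cong_AE) (auto simp: borel_measurable_side_measure[OF T facet])
    then show ?thesis
      using side_area_pos[OF T facet] by (simp only: integral_side_affine[OF T facet]) simp
  qed
  have "card (C - {u}) *\<^sub>R side_centroid S = \<Sum>(C - {u})"
    by (rule equal_coords_mean[OF _ eq]) (use zero in auto)
  then show ?thesis using u card_vertices finite_vertices by simp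
qed

end

lemma centroid_eq_apex_side_centroid:
  fixes T :: "'a::euclidean_space set"
  assumes T: "int DIM('a) simplex T" and S: "S facet_of T"
  shows "(DIM('a) + 1) *\<^sub>R centroid T = facet_apex T S + DIM('a) *\<^sub>R side_centroid S"
proof -
  obtain C k \<kappa> where "barycentric_frame T C k \<kappa>" by (rule simplex_barycentric[OF T])
  then interpret barycentric_frame T C k \<kappa> .
  obtain u where u: "u \<in> C" and Su: "S = convex hull (C - {u})" using S facet_iff by blast
  have "u \<notin> S" using convex_hull_opposite[OF u] delta[OF u u] Su by simp
  then have "u = facet_apex T S" using facet_apex_unique[OF T S] u extreme_points by auto
  then show ?thesis
    using centroid_vertices[OF T] side_centroid_vertices[OF T u Su] u finite_vertices
    by (simp add: sum.remove)
qed

text \<open>Integration by parts for the field \<open>(x - p) / h\<close>, with \<open>p\<close> the apex and \<open>h\<close> the height over \<open>S\<close>, against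
an affine function.  Both sides are evaluated at centroids, where the relation
\<open>(d + 1) m\<^sub>T = p + d m\<^sub>S\<close> and the volume formula \<open>d |T| = h |S|\<close> match.\<close>

lemma facet_field_green:
  fixes T :: "'a::euclidean_space set"
  assumes T: "int DIM('a) simplex T" and S: "S facet_of T"
  shows "measure lebesgue T * ((\<alpha> \<bullet> (centroid T - facet_apex T S) + DIM('a) * (\<alpha> \<bullet> centroid T + \<gamma>)) / facet_height T S)
      = side_area S * (\<alpha> \<bullet> side_centroid S + \<gamma>)"
proof -
  have "\<alpha> \<bullet> ((DIM('a) + 1) *\<^sub>R centroid T) = \<alpha> \<bullet> (facet_apex T S + DIM('a) *\<^sub>R side_centroid S)"
    by (simp only: centroid_eq_apex_side_centroid[OF T S])
  then have "\<alpha> \<bullet> (centroid T - facet_apex T S) + DIM('a) * (\<alpha> \<bullet> centroid T + \<gamma>)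
      = DIM('a) * (\<alpha> \<bullet> side_centroid S + \<gamma>)"
    by (simp add: inner_add_right inner_diff_right algebra_simps)
  then have "measure lebesgue T * ((\<alpha> \<bullet> (centroid T - facet_apex T S) + DIM('a) * (\<alpha> \<bullet> centroid T + \<gamma>)) / facet_height T S)
      = (DIM('a) * measure lebesgue T) * (\<alpha> \<bullet> side_centroid S + \<gamma>) / facet_height T S"
    by simp
  also have "\<dots> = side_area S * (\<alpha> \<bullet> side_centroid S + \<gamma>)"
    using facet_height_pos[OF T S] by (simp add: facet_volume[OF T S])
  finally show ?thesis .
qed

section \<open>Triangulations of a Lipschitz domain\<close>

lemma lebesgue_integral_spike:
  fixes f g :: "'a::euclidean_space \<Rightarrow> 'b::euclidean_space"
  assumes N: "negligible N" and eq: "\<And>x. x \<notin> N \<Longrightarrow> f x = g x" and g: "g \<in> borel_measurable lebesgue"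
  shows "(LINT x|lebesgue. f x) = (LINT x|lebesgue. g x)"
proof (rule integral_cong_AE[OF _ g])
  have "AE x in lebesgue. x \<notin> N" using N unfolding negligible_iff_null_sets by (rule AE_not_in)
  then show "AE x in lebesgue. f x = g x" by eventually_elim (simp add: eq)
  show "f \<in> borel_measurable lebesgue"
  proof (rule measurableI)
    fix B :: "'b set" assume B: "B \<in> sets borel"
    have "f -` B = (g -` B - N) \<union> (f -` B \<inter> N)" using eq by auto
    moreover have "g -` B \<in> sets lebesgue" using measurable_sets[OF g B] by simp
    moreover have "N \<in> sets lebesgue" using N negligible_imp_sets by blast
    moreover have "f -` B \<inter> N \<in> sets lebesgue"
      using negligible_subset[OF N, of "f -` B \<inter> N"] negligible_imp_sets by blast
    ultimately have "f -` B \<in> sets lebesgue" by (metis sets.Diff sets.Un)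
    then show "f -` B \<inter> space lebesgue \<in> sets lebesgue" by simp
  qed simp
qed

text \<open>Near a boundary point the domain lies on one side of a graph, so that points slightly beyond the graph
are not in the closure.  In particular a Lipschitz domain has no slits.\<close>

lemma interior_closure_lipschitz_domain:
  fixes \<Omega> :: "'a::euclidean_space set"
  assumes lip: "lipschitz_domain \<Omega>"
  shows "interior (closure \<Omega>) = \<Omega>"
proof
  have op: "open \<Omega>" using lip by (simp add: lipschitz_domain_def)
  show "\<Omega> \<subseteq> interior (closure \<Omega>)" by (simp add: interior_maximal closure_subset op)
  show "interior (closure \<Omega>) \<subseteq> \<Omega>"
  proof (rule ccontr)
    assume "\<not> interior (closure \<Omega>) \<subseteq> \<Omega>"
    then obtain x where x: "x \<in> interior (closure \<Omega>)" "x \<notin> \<Omega>" by blast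
    then have fr: "x \<in> frontier \<Omega>"
      using interior_subset op by (auto simp: frontier_def interior_open)
    then obtain \<nu> r L \<gamma> where \<nu>: "norm \<nu> = 1" and r: "r > 0" and \<gamma>: "L-lipschitz_on {y. y \<bullet> \<nu> = 0} \<gamma>"
      and graph: "\<Omega> \<inter> ball x r = {y \<in> ball x r. (y - x) \<bullet> \<nu> < \<gamma> ((y - x) - ((y - x) \<bullet> \<nu>) *\<^sub>R \<nu>)}"
      using bspec[OF lip[unfolded lipschitz_domain_def, THEN conjunct2, THEN conjunct2, THEN conjunct2] fr]
      by blast
    have \<nu>\<nu>: "\<nu> \<bullet> \<nu> = 1" using \<nu> by (simp add: norm_eq_1)
    let ?q = "\<lambda>y. (y - x) - ((y - x) \<bullet> \<nu>) *\<^sub>R \<nu>"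
    define d where "d = (\<lambda>y. (y - x) \<bullet> \<nu> - \<gamma> (?q y))"
    have cont: "continuous_on UNIV d"
      unfolding d_def
    proof (intro continuous_intros continuous_on_compose2[OF lipschitz_on_continuous_on[OF \<gamma>]])
      show "range ?q \<subseteq> {y. y \<bullet> \<nu> = 0}" by (auto simp: inner_diff_left \<nu>\<nu>)
    qed
    have mem: "y \<in> \<Omega> \<longleftrightarrow> d y < 0" if "y \<in> ball x r" for y
    proof -
      have "y \<in> \<Omega> \<inter> ball x r \<longleftrightarrow> y \<in> ball x r \<and> (y - x) \<bullet> \<nu> < \<gamma> (?q y)"
        unfolding graph by blast
      then show ?thesis using that by (simp add: d_def)
    qed
    \<comment> \<open>Moving along \<open>\<nu>\<close> increases \<open>d\<close> at unit rate, while the points of the domain have \<open>d < 0\<close>.\<close>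
    have d0: "d x \<ge> 0" using mem[of x] x(2) r by auto
    have d_up: "d (x + t *\<^sub>R \<nu>) = t + d x" for t
      by (simp add: d_def \<nu>\<nu>)
    obtain e where e: "e > 0" "ball x e \<subseteq> closure \<Omega>"
      using x(1) by (meson mem_interior)
    define t where "t = min (r/2) (e/2)"
    have t: "0 < t" "t < r" "t < e" using r e by (auto simp: t_def)
    have "x + t *\<^sub>R \<nu> \<in> ball x e" using t \<nu> by (simp add: dist_norm)
    then have cl: "x + t *\<^sub>R \<nu> \<in> closure \<Omega>" using e by blast
    have "open (ball x r \<inter> {y. 0 < d y})"
      by (intro open_Int open_ball open_Collect_less continuous_on_const cont)
    moreover have "x + t *\<^sub>R \<nu> \<in> ball x r \<inter> {y. 0 < d y}"
      using t \<nu> d0 by (simp add: dist_norm d_up)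
    ultimately have "(ball x r \<inter> {y. 0 < d y}) \<inter> \<Omega> \<noteq> {}"
      using cl open_Int_closure_eq_empty[of "ball x r \<inter> {y. 0 < d y}" \<Omega>] by blast
    then show False using mem by fastforce
  qed
qed

text \<open>Near \<open>x\<close> the half space is filled by the segments from \<open>p\<close> to points of \<open>S\<close> close to \<open>x\<close>: \<open>G y\<close> below is the
point where the ray from \<open>p\<close> through \<open>y\<close> meets the hyperplane.\<close>

lemma half_ball_subset_convex:
  fixes n :: "'a::euclidean_space"
  assumes S: "S \<subseteq> T" "affine hull S = {x. n \<bullet> x = \<beta>}" and T: "convex T" and p: "p \<in> T" "n \<bullet> p < \<beta>"
    and x: "x \<in> rel_interior S"
  obtains r where "r > 0" "\<And>y. y \<in> ball x r \<Longrightarrow> n \<bullet> y \<le> \<beta> \<Longrightarrow> y \<in> T"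
proof -
  obtain e where e: "e > 0" "ball x e \<inter> affine hull S \<subseteq> S"
    using x by (auto simp: mem_rel_interior_ball)
  have xS: "x \<in> S" using x rel_interior_subset by blast
  then have nx: "n \<bullet> x = \<beta>" using S(2) hull_subset[of S affine] by auto
  define h where "h = \<beta> - n \<bullet> p"
  have h: "h > 0" using p by (simp add: h_def)
  define \<tau> where "\<tau> = (\<lambda>y. (\<beta> - n \<bullet> y) / h)"
  define G where "G = (\<lambda>y. (1 / (1 - \<tau> y)) *\<^sub>R (y - \<tau> y *\<^sub>R p))"
  have \<tau>x: "\<tau> x = 0" by (simp add: \<tau>_def nx)
  have Gx: "G x = x" by (simp add: G_def \<tau>x)
  have c\<tau>: "isCont \<tau> x" unfolding \<tau>_def using h by (intro continuous_intros) auto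
  have cG: "isCont G x" unfolding G_def using \<tau>x by (intro continuous_intros c\<tau>) auto
  obtain r1 where r1: "r1 > 0" "\<And>y. dist y x < r1 \<Longrightarrow> dist (\<tau> y) (\<tau> x) < 1"
    using c\<tau> unfolding continuous_at_eps_delta by (metis zero_less_one)
  obtain r2 where r2: "r2 > 0" "\<And>y. dist y x < r2 \<Longrightarrow> dist (G y) (G x) < e"
    using cG e(1) unfolding continuous_at_eps_delta by metis
  show ?thesis
  proof (rule that[of "min r1 r2"])
    show "min r1 r2 > 0" using r1 r2 by simp
    fix y assume y: "y \<in> ball x (min r1 r2)" and ny: "n \<bullet> y \<le> \<beta>"
    have "\<bar>\<tau> y\<bar> < 1" using r1(2)[of y] y by (simp add: \<tau>x dist_commute)
    then have t: "0 \<le> \<tau> y" "\<tau> y < 1" using ny h by (auto simp: \<tau>_def)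
    have th: "\<tau> y * h = \<beta> - n \<bullet> y" using h by (simp add: \<tau>_def)
    have "n \<bullet> G y = (n \<bullet> y - \<tau> y * (n \<bullet> p)) / (1 - \<tau> y)"
      by (simp add: G_def inner_diff_right)
    also have "n \<bullet> y - \<tau> y * (n \<bullet> p) = (1 - \<tau> y) * \<beta>"
      using th by (simp add: h_def algebra_simps)
    finally have "n \<bullet> G y = \<beta>" using t by simp
    moreover have "G y \<in> ball x e" using r2(2)[of y] y by (simp add: Gx dist_commute)
    ultimately have "G y \<in> T" using e(2) S by auto
    moreover have "y = (1 - \<tau> y) *\<^sub>R G y + \<tau> y *\<^sub>R p" using t by (simp add: G_def)
    ultimately show "y \<in> T" using convexD[OF T \<open>G y \<in> T\<close> p(1), of "1 - \<tau> y" "\<tau> y"] t by simp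
  qed
qed

locale simplicial_mesh =
  fixes \<Omega> :: "'a::euclidean_space set" and \<T> :: "'a set set"
  assumes lipschitz: "lipschitz_domain \<Omega>" and triangulation: "triangulation_of \<Omega> \<T>"
begin

lemma open_domain: "open \<Omega>" and connected_domain: "connected \<Omega>"
  using lipschitz by (auto simp: lipschitz_domain_def)

lemma interior_closure_domain: "interior (closure \<Omega>) = \<Omega>"
  by (rule interior_closure_lipschitz_domain[OF lipschitz])

lemma finite_elements: "finite \<T>"
  using triangulation by (simp add: triangulation_of_def triangulation_def)

lemma Union_elements: "\<Union>\<T> = closure \<Omega>"
  using triangulation by (simp add: triangulation_of_def)

lemma element_simplex: "T \<in> \<T> \<Longrightarrow> int DIM('a) simplex T"
  using triangulation by (simp add: triangulation_of_def)

lemma element_convex: "T \<in> \<T> \<Longrightarrow> convex T" and element_compact: "T \<in> \<T> \<Longrightarrow> compact T"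
  and element_closed: "T \<in> \<T> \<Longrightarrow> closed T"
  and element_interior: "T \<in> \<T> \<Longrightarrow> interior T \<noteq> {}"
  using element_simplex convex_simplex compact_simplex closed_simplex measure_simplex_pos(2) by blast+

lemma inter_face_of: "T \<in> \<T> \<Longrightarrow> T' \<in> \<T> \<Longrightarrow> T \<inter> T' face_of T"
  using triangulation by (simp add: triangulation_of_def triangulation_def)

lemma interior_element_subset: "T \<in> \<T> \<Longrightarrow> interior T \<subseteq> \<Omega>"
  using interior_mono[of T "closure \<Omega>"] Union_elements interior_closure_domain by auto

lemma aff_dim_inter_less:
  assumes T: "T \<in> \<T>" "T' \<in> \<T>" "T \<noteq> T'"
  shows "aff_dim (T \<inter> T') < DIM('a)"
proof (cases "T \<inter> T' = T")
  case False
  then show ?thesis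
    using face_of_aff_dim_lt[OF element_convex[OF T(1)] inter_face_of[OF T(1,2)]]
      aff_dim_simplex[OF element_simplex[OF T(1)]] by simp
next
  case True
  then have "T' \<inter> T \<noteq> T'" using T(3) by auto
  then show ?thesis
    using face_of_aff_dim_lt[OF element_convex[OF T(2)] inter_face_of[OF T(2,1)]]
      aff_dim_simplex[OF element_simplex[OF T(2)]] by (simp add: Int_commute)
qed

lemma interior_inter_elements:
  assumes "T \<in> \<T>" "T' \<in> \<T>" "T \<noteq> T'" shows "interior (T \<inter> T') = {}"
  using aff_dim_inter_less[OF assms] aff_dim_nonempty_interior[of "T \<inter> T'"] by auto

lemma interiors_disjoint: "T \<in> \<T> \<Longrightarrow> T' \<in> \<T> \<Longrightarrow> x \<in> interior T \<Longrightarrow> x \<in> interior T' \<Longrightarrow> T = T'"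
  using interior_inter_elements[of T T'] by auto

lemma inter_eq_facet:
  assumes T: "T \<in> \<T>" "T' \<in> \<T>" "T \<noteq> T'" and S: "aff_dim (T \<inter> T') \<ge> int DIM('a) - 1"
  shows "(T \<inter> T') facet_of T"
proof -
  have "T \<inter> T' \<noteq> {}"
  proof
    assume "T \<inter> T' = {}"
    then show False using S DIM_positive[where 'a='a] by simp
  qed
  then show ?thesis
    using inter_face_of[OF T(1,2)] aff_dim_inter_less[OF T] S aff_dim_simplex[OF element_simplex[OF T(1)]]
    by (simp add: facet_of_def)
qed

lemma facet_nonempty_rel_interior:
  assumes "T \<in> \<T>" "S facet_of T" shows "rel_interior S \<noteq> {}"
  using assms facet_nonempty convex_facet element_simplex rel_interior_eq_empty by blast

text \<open>Two elements with a common facet lie on opposite sides of it and together fill a ball around each of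
its relative interior points.\<close>

lemma interior_union_neighbours:
  assumes T: "T \<in> \<T>" "T' \<in> \<T>" "T \<noteq> T'" and S: "S facet_of T" "S facet_of T'" and x: "x \<in> rel_interior S"
  shows "x \<in> interior (T \<union> T')"
proof -
  note sT = element_simplex[OF T(1)] and sT' = element_simplex[OF T(2)]
  let ?n = "outer_normal T S" and ?\<beta> = "facet_offset T S" and ?p = "facet_apex T S" and ?p' = "facet_apex T' S"
  note n1 = norm_outer_normal[OF sT S(1)]
  note aff = affine_hull_facet[OF sT S(1)]
  have sub: "S \<subseteq> T" "S \<subseteq> T'" using S facet_of_imp_subset by auto
  have np: "?n \<bullet> ?p < ?\<beta>" using facet_height_pos[OF sT S(1)] by (simp add: facet_height_def)
  obtain r where r: "r > 0" "\<And>y. y \<in> ball x r \<Longrightarrow> ?n \<bullet> y \<le> ?\<beta> \<Longrightarrow> y \<in> T"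
    using half_ball_subset_convex[OF sub(1) aff element_convex[OF T(1)] facet_apex_mem[OF sT S(1)] np x] by blast
  have nx: "?n \<bullet> x = ?\<beta>" using outer_normal_facet[OF sT S(1)] x rel_interior_subset by blast
  have "?p' \<notin> affine hull S"
    using facet_height_pos[OF sT' S(2)] unfolding affine_hull_facet[OF sT' S(2)] by (simp add: facet_height_def)
  then have ne: "?n \<bullet> ?p' \<noteq> ?\<beta>" unfolding aff by simp
  have "\<not> ?n \<bullet> ?p' < ?\<beta>"
  proof
    \<comment> \<open>If both elements lay on the same side of \<open>S\<close>, their interiors would overlap.\<close>
    assume p': "?n \<bullet> ?p' < ?\<beta>"
    obtain r' where r': "r' > 0" "\<And>y. y \<in> ball x r' \<Longrightarrow> ?n \<bullet> y \<le> ?\<beta> \<Longrightarrow> y \<in> T'"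
      using half_ball_subset_convex[OF sub(2) aff element_convex[OF T(2)] facet_apex_mem[OF sT' S(2)] p' x] by blast
    define t where "t = min r r' / 2"
    have t: "0 < t" "t < r" "t < r'" using r(1) r'(1) by (auto simp: t_def)
    let ?U = "ball x (min r r') \<inter> {y. ?n \<bullet> y < ?\<beta>}"
    have "?U \<subseteq> T \<inter> T'" using r(2) r'(2) by auto
    moreover have "open ?U" by (intro open_Int open_ball open_halfspace_lt)
    ultimately have "?U \<subseteq> interior (T \<inter> T')" by (rule interior_maximal)
    moreover have "x - t *\<^sub>R ?n \<in> ?U"
      using t n1 nx n1[unfolded norm_eq_1] by (simp add: dist_norm inner_diff_right)
    ultimately show False using interior_inter_elements[OF T] by blast
  qed
  then have p': "(- ?n) \<bullet> ?p' < - ?\<beta>" using ne by simp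
  have aff': "affine hull S = {x. (- ?n) \<bullet> x = - ?\<beta>}" unfolding aff by auto
  obtain r' where r': "r' > 0" "\<And>y. y \<in> ball x r' \<Longrightarrow> (- ?n) \<bullet> y \<le> - ?\<beta> \<Longrightarrow> y \<in> T'"
    using half_ball_subset_convex[OF sub(2) aff' element_convex[OF T(2)] facet_apex_mem[OF sT' S(2)] p' x] by blast
  have "ball x (min r r') \<subseteq> T \<union> T'"
  proof
    fix y assume y: "y \<in> ball x (min r r')"
    show "y \<in> T \<union> T'"
    proof (cases "?n \<bullet> y \<le> ?\<beta>")
      case True then show ?thesis using r(2)[of y] y by simp
    next
      case False then show ?thesis using r'(2)[of y] y by simp
    qed
  qed
  then show ?thesis using r(1) r'(1) by (intro interiorI[OF open_ball, of _ x "min r r'"]) auto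
qed

text \<open>Otherwise a boundary point would be interior to the closure of the domain, hence in the domain itself.\<close>

lemma boundary_side_unique:
  assumes S: "S \<in> boundary_sides \<Omega> \<T>" and T: "T \<in> \<T>" "T' \<in> \<T>" "S facet_of T" "S facet_of T'"
  shows "T = T'"
proof (rule ccontr)
  assume "T \<noteq> T'"
  obtain x where x: "x \<in> rel_interior S" using facet_nonempty_rel_interior[OF T(1,3)] by blast
  have "x \<in> interior (T \<union> T')" by (rule interior_union_neighbours[OF T(1,2) \<open>T \<noteq> T'\<close> T(3,4) x])
  moreover have "interior (T \<union> T') \<subseteq> interior (closure \<Omega>)"
    using T Union_elements by (intro interior_mono) auto
  ultimately have "x \<in> \<Omega>" using interior_closure_domain by auto
  moreover have "x \<in> frontier \<Omega>" using S x rel_interior_subset by (auto simp: boundary_sides_def)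
  ultimately show False using open_domain by (simp add: frontier_def interior_open)
qed

lemma side_element:
  assumes S: "S \<in> boundary_sides \<Omega> \<T>"
  shows "side_element \<T> S \<in> \<T>" "S facet_of side_element \<T> S"
    and "\<And>T. T \<in> \<T> \<Longrightarrow> S facet_of T \<Longrightarrow> T = side_element \<T> S"
proof -
  obtain T where T: "T \<in> \<T>" "S facet_of T" using S by (auto simp: boundary_sides_def sides_def)
  have eq: "side_element \<T> S = T"
    unfolding side_element_def using T boundary_side_unique[OF S] by (intro the_equality) blast+
  show "side_element \<T> S \<in> \<T>" "S facet_of side_element \<T> S" using T by (simp_all add: eq)
  show "T' = side_element \<T> S" if "T' \<in> \<T>" "S facet_of T'" for T'
    using boundary_side_unique[OF S T(1) that(1) T(2) that(2)] eq by simp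
qed

lemma interior_side_neighbour:
  assumes S: "S \<in> interior_sides \<Omega> \<T>" and T: "T \<in> \<T>" "S facet_of T"
  obtains T' where "T' \<in> \<T>" "T' \<noteq> T" "S facet_of T'"
    "\<And>T''. T'' \<in> \<T> \<Longrightarrow> S facet_of T'' \<Longrightarrow> T'' = T \<or> T'' = T'"
proof -
  note sT = element_simplex[OF T(1)]
  let ?n = "outer_normal T S" and ?\<beta> = "facet_offset T S"
  have ST: "S \<subseteq> T" using T(2) facet_of_imp_subset by blast
  have "S \<subseteq> closure \<Omega>" using ST T(1) Union_elements by blast
  then have "S \<inter> \<Omega> \<noteq> {}"
    using S open_domain by (auto simp: interior_sides_def frontier_def interior_open)
  moreover have "S \<subseteq> closure (rel_interior S)"
    using convex_closure_rel_interior[OF convex_facet[OF sT T(2)]] closure_subset by blast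
  ultimately have "\<Omega> \<inter> rel_interior S \<noteq> {}"
    using open_Int_closure_eq_empty[OF open_domain, of "rel_interior S"] by blast
  then obtain x where x: "x \<in> \<Omega>" "x \<in> rel_interior S" by blast
  have xS: "x \<in> S" using x rel_interior_subset by blast
  have closed: "closed (\<Union>(\<T> - {T}))"
    using finite_elements element_closed by (intro closed_Union) auto
  \<comment> \<open>Points slightly beyond \<open>S\<close> lie in the domain but not in \<open>T\<close>.\<close>
  have "x \<in> closure (\<Union>(\<T> - {T}))"
    unfolding closure_approachable
  proof (intro allI impI)
    fix e :: real assume e: "e > 0"
    obtain r where r: "r > 0" "ball x r \<subseteq> \<Omega>" using x(1) open_domain openE by blast
    define t where "t = min r e / 2"
    have t: "0 < t" "t < r" "t < e" using r e by (auto simp: t_def)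
    let ?y = "x + t *\<^sub>R ?n"
    note n1 = norm_outer_normal[OF sT T(2)]
    have "?y \<in> \<Omega>" using r t n1 by (auto simp: dist_norm)
    then have "?y \<in> \<Union>\<T>" using Union_elements closure_subset by blast
    moreover have "?n \<bullet> ?y = ?\<beta> + t"
      using outer_normal_facet[OF sT T(2) xS] n1[unfolded norm_eq_1] by (simp add: inner_add_right)
    then have "?y \<notin> T" using outer_normal_le[OF sT T(2), of ?y] t by auto
    ultimately have "?y \<in> \<Union>(\<T> - {T})" by blast
    moreover have "dist ?y x < e" using t n1 by (simp add: dist_norm)
    ultimately show "\<exists>y\<in>\<Union>(\<T> - {T}). dist y x < e" by blast
  qed
  then obtain T' where T': "T' \<in> \<T>" "T' \<noteq> T" "x \<in> T'" using closed closure_closed by blast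
  have "T \<inter> T' \<inter> rel_interior S \<noteq> {}" using T'(3) x(2) xS ST by blast
  then have sub: "S \<subseteq> T \<inter> T'" using subset_of_face_of[OF inter_face_of[OF T(1) T'(1)] ST] by blast
  have dimS: "aff_dim S = int DIM('a) - 1"
    using T(2) aff_dim_simplex[OF sT] by (simp add: facet_of_def)
  have ge: "aff_dim (T \<inter> T') \<ge> int DIM('a) - 1" using aff_dim_subset[OF sub] dimS by simp
  have F: "(T \<inter> T') facet_of T" "(T' \<inter> T) facet_of T'"
    using inter_eq_facet[OF T(1) T'(1)] inter_eq_facet[OF T'(1) T(1)] ge T'(2) by (auto simp: Int_commute)
  have "S face_of T \<inter> T'"
    using T(2) sub face_of_subset[of S T "T \<inter> T'"] by (auto simp: facet_of_def)
  moreover have "aff_dim S = aff_dim (T \<inter> T')"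
    using F(1) dimS aff_dim_simplex[OF sT] by (simp add: facet_of_def)
  moreover have "convex (T \<inter> T')" using element_convex T(1) T'(1) by (simp add: convex_Int)
  ultimately have "S = T \<inter> T'" using face_of_aff_dim_lt[of "T \<inter> T'" S] by auto
  then have ST': "S facet_of T'" using F(2) by (simp add: Int_commute)
  have "T'' = T \<or> T'' = T'" if T'': "T'' \<in> \<T>" "S facet_of T''" for T''
  proof (rule ccontr)
    assume ne: "\<not> (T'' = T \<or> T'' = T')"
    have "x \<in> T''" using T''(2) facet_of_imp_subset xS by blast
    also have "T'' = closure (interior T'')"
      using convex_closure_interior[OF element_convex[OF T''(1)] element_interior[OF T''(1)]]
        element_closed[OF T''(1)] by simp
    finally have "interior (T \<union> T') \<inter> interior T'' \<noteq> {}"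
      using interior_union_neighbours[OF T(1) T'(1) _ T(2) ST' x(2)] T'(2)
        open_Int_closure_eq_empty[OF open_interior, of "T \<union> T'" "interior T''"] by blast
    then have "interior (T \<union> T') \<inter> interior T'' - T \<inter> T'' \<noteq> {}"
    proof -
      let ?U = "interior (T \<union> T') \<inter> interior T''"
      assume "?U \<noteq> {}"
      show ?thesis
      proof
        assume "?U - T \<inter> T'' = {}"
        then have "?U \<subseteq> interior (T \<inter> T'')" by (intro interior_maximal) auto
        then show False using \<open>?U \<noteq> {}\<close> interior_inter_elements[OF T(1) T''(1)] ne by auto
      qed
    qed
    moreover have "interior (T \<union> T') \<inter> interior T'' - T \<inter> T'' \<subseteq> interior (T' \<inter> T'')"
    proof (rule interior_maximal)
      show "interior (T \<union> T') \<inter> interior T'' - T \<inter> T'' \<subseteq> T' \<inter> T''" using interior_subset by blast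
      show "open (interior (T \<union> T') \<inter> interior T'' - T \<inter> T'')"
        using element_closed T(1) T''(1) by (intro open_Diff) auto
    qed
    ultimately show False using interior_inter_elements[OF T'(1) T''(1)] ne by auto
  qed
  then show ?thesis using that T' ST' by blast
qed

lemma negligible_aff_dim_less:
  fixes K :: "'a set"
  assumes "aff_dim K < DIM('a)" shows "negligible (affine hull K)"
proof -
  have "interior (affine hull K) = {}"
    using assms aff_dim_nonempty_interior[of "affine hull K"] by (auto simp: aff_dim_affine_hull)
  then show ?thesis by (simp add: negligible_convex_interior affine_imp_convex)
qed

text \<open>If \<open>G\<close> were a proper subset, the elements in \<open>G\<close> and the remaining ones would cover the connected domain by
two closed sets, which meet at some point \<open>p\<close> of the domain.  Inside the domain two such elements share only
faces of codimension at least two.  A generic segment near \<open>p\<close> from one family to the other avoids these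
finitely many faces, but by connectedness it contains a point common to both families.\<close>

lemma side_connected:
  assumes G: "G \<subseteq> \<T>" "G \<noteq> {}"
    and step: "\<And>S T T'. S \<in> interior_sides \<Omega> \<T> \<Longrightarrow> T \<in> G \<Longrightarrow> T' \<in> \<T> \<Longrightarrow> S facet_of T \<Longrightarrow> S facet_of T' \<Longrightarrow> T' \<in> G"
  shows "G = \<T>"
proof (rule ccontr)
  assume "G \<noteq> \<T>"
  define H where "H = \<T> - G"
  have H: "H \<subseteq> \<T>" "H \<noteq> {}" "\<And>T T'. T \<in> G \<Longrightarrow> T' \<in> H \<Longrightarrow> T \<noteq> T'" using G \<open>G \<noteq> \<T>\<close> by (auto simp: H_def)
  have fin: "finite G" "finite H" using finite_elements G H finite_subset by blast+
  have closed: "closed (\<Union>G)" "closed (\<Union>H)"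
    using fin G H element_closed by (intro closed_Union; blast)+
  have cover: "closure \<Omega> = \<Union>G \<union> \<Union>H" unfolding Union_elements[symmetric] H_def using G(1) by blast
  have meet: "\<Union>G \<inter> \<Omega> \<noteq> {}" "\<Union>H \<inter> \<Omega> \<noteq> {}"
  proof -
    have "T \<inter> \<Omega> \<noteq> {}" if "T \<in> \<T>" for T
      using element_interior[OF that] interior_element_subset[OF that] interior_subset[of T] by blast
    then show "\<Union>G \<inter> \<Omega> \<noteq> {}" "\<Union>H \<inter> \<Omega> \<noteq> {}" using G H by blast+
  qed
  have "\<Union>G \<inter> \<Union>H \<inter> \<Omega> \<noteq> {}"
    using connected_closedD[OF connected_domain _ _ closed] meet cover closure_subset[of \<Omega>] by blast
  then obtain p T0 T0' where p: "p \<in> \<Omega>" "T0 \<in> G" "p \<in> T0" "T0' \<in> H" "p \<in> T0'" by blast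
  obtain r where r: "r > 0" "ball p r \<subseteq> \<Omega>" using p(1) open_domain openE by blast
  have near: "ball p r \<inter> interior T \<noteq> {}" if T: "T \<in> \<T>" "p \<in> T" for T
  proof -
    have "p \<in> closure (interior T)"
      using convex_closure_interior[OF element_convex[OF T(1)] element_interior[OF T(1)]]
        subsetD[OF closure_subset T(2)] by simp
    moreover have "p \<in> ball p r" using r(1) by simp
    ultimately show ?thesis using open_Int_closure_eq_empty[OF open_ball, of p r "interior T"] by blast
  qed
  define \<K> where "\<K> = {T \<inter> T' |T T'. T \<in> G \<and> T' \<in> H \<and> aff_dim (T \<inter> T') \<le> int DIM('a) - 2}"
  have fin\<K>: "finite \<K>"
  proof -
    have "\<K> \<subseteq> (\<lambda>(T, T'). T \<inter> T') ` (G \<times> H)" by (auto simp: \<K>_def)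
    then show ?thesis by (rule finite_subset) (use fin in simp)
  qed
  have avoid: "\<exists>y\<in>ball p r \<inter> interior T. y \<notin> N" if "T \<in> \<T>" "p \<in> T" "negligible N" for T N
  proof (rule ccontr)
    assume "\<not> ?thesis"
    then have "ball p r \<inter> interior T \<subseteq> N" by blast
    then have "negligible (ball p r \<inter> interior T)" by (rule negligible_subset[OF that(3)])
    moreover have "open (ball p r \<inter> interior T)" by (intro open_Int open_ball open_interior)
    ultimately show False using near[OF that(1,2)] open_not_negligible by blast
  qed
  have "negligible (\<Union>K\<in>\<K>. affine hull K)"
  proof (rule negligible_Union)
    show "finite ((\<lambda>K. affine hull K) ` \<K>)" using fin\<K> by simp
    fix N assume "N \<in> (\<lambda>K. affine hull K) ` \<K>"
    then show "negligible N" by (auto simp: \<K>_def intro!: negligible_aff_dim_less)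
  qed
  then obtain x where x: "x \<in> ball p r" "x \<in> interior T0" "\<And>K. K \<in> \<K> \<Longrightarrow> x \<notin> affine hull K"
  proof -
    have "\<exists>x\<in>ball p r \<inter> interior T0. x \<notin> (\<Union>K\<in>\<K>. affine hull K)"
      using p(2,3) G(1) \<open>negligible (\<Union>K\<in>\<K>. affine hull K)\<close> by (intro avoid) auto
    then show thesis using that by blast
  qed
  \<comment> \<open>A segment from \<open>x\<close> can hit \<open>K\<close> only if its other end lies in the affine hull of \<open>x\<close> and \<open>K\<close>, a null set.\<close>
  have "negligible (\<Union>K\<in>\<K>. affine hull (insert x K))"
  proof (rule negligible_Union)
    show "finite ((\<lambda>K. affine hull (insert x K)) ` \<K>)" using fin\<K> by simp
    fix N assume "N \<in> (\<lambda>K. affine hull (insert x K)) ` \<K>"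
    then obtain K where K: "K \<in> \<K>" and N: "N = affine hull (insert x K)" by blast
    have "aff_dim K \<le> int DIM('a) - 2" using K by (auto simp: \<K>_def)
    then show "negligible N" unfolding N by (intro negligible_aff_dim_less) (simp add: aff_dim_insert)
  qed
  then obtain y where y: "y \<in> ball p r" "y \<in> interior T0'" "\<And>K. K \<in> \<K> \<Longrightarrow> y \<notin> affine hull (insert x K)"
  proof -
    have "\<exists>y\<in>ball p r \<inter> interior T0'. y \<notin> (\<Union>K\<in>\<K>. affine hull (insert x K))"
      using p(4,5) H(1) \<open>negligible (\<Union>K\<in>\<K>. affine hull (insert x K))\<close> by (intro avoid) auto
    then show thesis using that by blast
  qed
  have seg: "closed_segment x y \<subseteq> \<Omega>"
    using closed_segment_subset[OF x(1) y(1) convex_ball] r(2) by (rule order_trans)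
  have "x \<in> \<Union>G" "y \<in> \<Union>H" using x(2) y(2) p(2,4) interior_subset[of T0] interior_subset[of T0'] by auto
  then have "\<Union>G \<inter> \<Union>H \<inter> closed_segment x y \<noteq> {}"
    using connected_closedD[OF connected_segment(1)[of x y] _ _ closed] seg cover closure_subset[of \<Omega>] by blast
  then obtain q T T' where q: "q \<in> closed_segment x y" "T \<in> G" "T' \<in> H" "q \<in> T \<inter> T'" by blast
  have T: "T \<in> \<T>" "T' \<in> \<T>" "T \<noteq> T'" using q G H by auto
  show False
  proof (cases "aff_dim (T \<inter> T') \<ge> int DIM('a) - 1")
    case True
    then have F: "(T \<inter> T') facet_of T" "(T \<inter> T') facet_of T'"
      using inter_eq_facet[OF T] inter_eq_facet[OF T(2,1)] T(3) by (auto simp: Int_commute)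
    have "\<not> T \<inter> T' \<subseteq> frontier \<Omega>"
      using q seg open_domain by (auto simp: frontier_def interior_open)
    then have "T \<inter> T' \<in> interior_sides \<Omega> \<T>" using F T by (auto simp: interior_sides_def sides_def)
    then have "T' \<in> G" using step q(2) T(2) F by blast
    then show False using q(3) by (simp add: H_def)
  next
    case False
    then have "aff_dim (T \<inter> T') \<le> int DIM('a) - 2" by linarith
    then have K: "T \<inter> T' \<in> \<K>" unfolding \<K>_def using q(2,3) by blast
    have "q \<noteq> x" using x(3)[OF K] q(4) hull_subset[of "T \<inter> T'" affine] by blast
    obtain t where t: "0 \<le> t" "q = (1 - t) *\<^sub>R x + t *\<^sub>R y" using q(1) by (auto simp: in_segment)
    have t0: "t \<noteq> 0" using \<open>q \<noteq> x\<close> t by auto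
    have "y = (1 - 1 / t) *\<^sub>R x + (1 / t) *\<^sub>R q"
      using t0 unfolding t(2) by (simp add: scaleR_add_right scaleR_diff_left scaleR_diff_right diff_divide_distrib)
    moreover have "x \<in> affine hull (insert x (T \<inter> T'))" "q \<in> affine hull (insert x (T \<inter> T'))"
      using q(4) hull_subset[of "insert x (T \<inter> T')" affine] by auto
    ultimately have "y \<in> affine hull (insert x (T \<inter> T'))"
      using mem_affine[OF affine_affine_hull, of x "insert x (T \<inter> T')" q "1 - 1/t" "1/t"] by simp
    then show False using y(3)[OF K] by blast
  qed
qed

lemma sets_domain: "\<Omega> \<in> sets lebesgue"
  using open_domain by (simp add: borel_open sets_completionI_sets)

lemma negligible_skeleton: "negligible (\<Omega> - (\<Union>T\<in>\<T>. interior T))"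
proof (rule negligible_subset)
  show "negligible (\<Union>(frontier ` \<T>))"
    using finite_elements element_convex by (intro negligible_Union) (auto intro: negligible_convex_frontier)
  show "\<Omega> - (\<Union>T\<in>\<T>. interior T) \<subseteq> \<Union>(frontier ` \<T>)"
  proof
    fix x assume x: "x \<in> \<Omega> - (\<Union>T\<in>\<T>. interior T)"
    then obtain T where "T \<in> \<T>" "x \<in> T" using Union_elements closure_subset by blast
    moreover have "x \<notin> interior T" using x \<open>T \<in> \<T>\<close> by blast
    ultimately show "x \<in> \<Union>(frontier ` \<T>)" by (auto simp: frontier_def element_closed)
  qed
qed

lemma AE_domainI:
  assumes "\<And>T x. T \<in> \<T> \<Longrightarrow> x \<in> interior T \<Longrightarrow> P x"
  shows "AE x in lebesgue_on \<Omega>. P x"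
proof -
  have "AE x in lebesgue. x \<notin> \<Omega> - (\<Union>T\<in>\<T>. interior T)"
    using negligible_skeleton unfolding negligible_iff_null_sets by (rule AE_not_in)
  then have "AE x in lebesgue. x \<in> \<Omega> \<longrightarrow> P x"
    by eventually_elim (use assms in blast)
  then show ?thesis using sets_domain by (simp add: AE_restrict_space_iff)
qed

lemma AE_domainD:
  assumes AE: "AE x in lebesgue_on \<Omega>. P x" and T: "T \<in> \<T>"
  obtains x where "x \<in> interior T" "P x"
proof -
  have "AE x in lebesgue. x \<in> \<Omega> \<longrightarrow> P x"
    using AE sets_domain by (simp add: AE_restrict_space_iff)
  then obtain N where N: "N \<in> null_sets lebesgue" "\<And>x. x \<notin> N \<Longrightarrow> x \<in> \<Omega> \<longrightarrow> P x"
    by (auto simp: eventually_ae_filter)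
  have "\<not> interior T \<subseteq> N"
  proof
    assume "interior T \<subseteq> N"
    then have "negligible (interior T)"
      using N(1) negligible_subset negligible_iff_null_sets by blast
    then show False using open_not_negligible[OF open_interior] element_interior[OF T] by blast
  qed
  then obtain x where "x \<in> interior T" "x \<notin> N" by blast
  then show thesis using that N(2) interior_element_subset[OF T] by blast
qed

lemma integral_domain:
  fixes \<phi> :: "'a \<Rightarrow> real"
  assumes \<psi>: "\<And>T. T \<in> \<T> \<Longrightarrow> continuous_on UNIV (\<psi> T)"
    and eq: "\<And>T x. T \<in> \<T> \<Longrightarrow> x \<in> interior T \<Longrightarrow> \<phi> x = \<psi> T x"
  shows "(LINT x|lebesgue_on \<Omega>. \<phi> x) = (\<Sum>T\<in>\<T>. LINT x|lebesgue_on T. \<psi> T x)"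
proof -
  define F where "F x = (\<Sum>T\<in>\<T>. indicator T x *\<^sub>R \<psi> T x)" for x
  define N where "N = (\<Union>T\<in>\<T>. frontier T)"
  have N: "negligible N"
    unfolding N_def using finite_elements element_convex
    by (intro negligible_Union) (auto intro: negligible_convex_frontier)
  have int: "integrable lebesgue (\<lambda>x. indicator T x *\<^sub>R \<psi> T x)" if "T \<in> \<T>" for T
    using integral_lebesgue_on_compact(2)[OF element_compact[OF that] \<psi>[OF that]] element_compact[OF that]
    by (subst integrable_restrict_space[symmetric]) (auto simp: lmeasurable_compact fmeasurableD)
  have iF: "integrable lebesgue F" unfolding F_def using int by simp
  have F: "F x = indicator \<Omega> x *\<^sub>R \<phi> x" if x: "x \<notin> N" for x
  proof (cases "\<exists>T\<in>\<T>. x \<in> interior T")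
    case True
    then obtain T where T: "T \<in> \<T>" "x \<in> interior T" by blast
    have "indicator T' x *\<^sub>R \<psi> T' x = (if T' = T then \<phi> x else 0)" if T': "T' \<in> \<T>" for T'
    proof (cases "T' = T")
      case True then show ?thesis using T eq interior_subset[of T] by auto
    next
      case False
      have "x \<notin> interior T'" using interiors_disjoint[OF T' T(1) _ T(2)] False by blast
      then have "x \<notin> T'" using x T' by (auto simp: N_def frontier_def element_closed)
      then show ?thesis using False by simp
    qed
    then have "F x = \<phi> x" unfolding F_def using T finite_elements by simp
    then show ?thesis using T interior_element_subset[OF T(1)] by auto
  next
    case False
    then have "x \<notin> T" if "T \<in> \<T>" for T
      using x that by (auto simp: N_def frontier_def element_closed)
    moreover from this have "x \<notin> \<Omega>" using Union_elements closure_subset by blast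
    ultimately show ?thesis by (simp add: F_def)
  qed
  have "(LINT x|lebesgue_on \<Omega>. \<phi> x) = (LINT x|lebesgue. indicator \<Omega> x *\<^sub>R \<phi> x)"
    using sets_domain by (simp add: integral_restrict_space)
  also have "\<dots> = (LINT x|lebesgue. F x)"
    using iF by (intro lebesgue_integral_spike[OF N]) (auto simp: F)
  also have "\<dots> = (\<Sum>T\<in>\<T>. LINT x|lebesgue. indicator T x *\<^sub>R \<psi> T x)"
    unfolding F_def using int by (simp add: Bochner_Integration.integral_sum)
  also have "\<dots> = (\<Sum>T\<in>\<T>. LINT x|lebesgue_on T. \<psi> T x)"
    using element_compact by (intro sum.cong) (auto simp: integral_restrict_space lmeasurable_compact fmeasurableD)
  finally show ?thesis .
qed

lemma side_element_cases:
  assumes "S \<in> sides \<T>" shows "(S \<in> interior_sides \<Omega> \<T>) \<noteq> (S \<in> boundary_sides \<Omega> \<T>)"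
  using assms by (auto simp: interior_sides_def boundary_sides_def)

lemma finite_sides: "finite (sides \<T>)"
proof -
  have "sides \<T> = (\<Union>T\<in>\<T>. {S. S facet_of T})" by (auto simp: sides_def)
  then show ?thesis using finite_elements finite_facets[OF element_simplex] by simp
qed

text \<open>If all boundary sides belonged to \<open>\<Gamma>N\<close>, they would be disjoint from \<open>\<Gamma>D\<close>, which would then have no area.\<close>

lemma exists_Dirichlet_side:
  assumes dec: "boundary_decomposition \<Omega> \<T> \<Gamma>D \<Gamma>N"
  shows "sides_on \<Omega> \<T> \<Gamma>D \<noteq> {}"
proof
  assume none: "sides_on \<Omega> \<T> \<Gamma>D = {}"
  have "measure (side_measure S) \<Gamma>D = 0" if S: "S \<in> boundary_sides \<Omega> \<T>" for S
  proof (cases "\<Gamma>D \<in> sets borel")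
    case True
    note sT = element_simplex[OF side_element(1)[OF S]]
    have "S \<in> sides_on \<Omega> \<T> \<Gamma>N" using dec S none by (auto simp: boundary_decomposition_def)
    then have "rel_interior S \<subseteq> \<Gamma>N" by (simp add: sides_on_def)
    \<comment> \<open>A relatively open set disjoint from \<open>\<Gamma>N\<close> is disjoint from its closure, which contains \<open>S\<close>.\<close>
    have "S \<inter> \<Gamma>D = {}"
    proof -
      obtain U where U: "open U" "\<Gamma>D = frontier \<Omega> \<inter> U"
        using dec by (auto simp: boundary_decomposition_def openin_open)
      have "rel_interior S \<inter> U = {}"
      proof -
        have "rel_interior S \<subseteq> frontier \<Omega>" using S rel_interior_subset by (auto simp: boundary_sides_def)
        moreover have "\<Gamma>D \<inter> \<Gamma>N = {}" using dec by (simp add: boundary_decomposition_def)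
        ultimately show ?thesis using \<open>rel_interior S \<subseteq> \<Gamma>N\<close> U(2) by blast
      qed
      then have "U \<inter> closure (rel_interior S) = {}"
        using open_Int_closure_eq_empty[OF U(1), of "rel_interior S"] by blast
      then have "U \<inter> closure S = {}"
        using convex_closure_rel_interior[OF convex_facet[OF sT side_element(2)[OF S]]] by simp
      then show ?thesis using U(2) closure_subset[of S] by blast
    qed
    then have "{z \<in> prism (outer_normal (side_element \<T> S) S) (facet_offset (side_element \<T> S) S) S.
        hyperplane_proj (outer_normal (side_element \<T> S) S) (facet_offset (side_element \<T> S) S) z \<in> \<Gamma>D} = {}"
      by (auto simp: prism_def)
    then show ?thesis unfolding measure_side_measure[OF sT side_element(2)[OF S] True] by (simp only: measure_empty)
  next
    case False
    then show ?thesis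
      by (intro measure_notin_sets) (simp add: side_measure_facet[OF element_simplex[OF side_element(1)[OF S]] side_element(2)[OF S]])
  qed
  then have "surface_area \<Omega> \<T> \<Gamma>D = 0" by (simp add: surface_area_def)
  then show False using dec by (simp add: boundary_decomposition_def)
qed

end

section \<open>Finite element functions by their coefficients\<close>

context simplicial_mesh
begin

lemma islimpt_interior_element:
  assumes T: "T \<in> \<T>" and x: "x \<in> T"
  shows "x islimpt interior T"
proof (cases "x \<in> interior T")
  case True then show ?thesis by (intro interior_limit_point) simp
next
  case False
  have "closure (interior T) = T"
    using convex_closure_interior[OF element_convex[OF T] element_interior[OF T]] element_closed[OF T] by simp
  then have "x \<in> closure (interior T)" using x by simp
  then show ?thesis using False by (simp add: closure_def)
qed

text \<open>Away from \<open>T\<close> the trace is a limit along the trivial filter, an unspecified value that does not depend on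
the point.  This makes traces Borel functions on the whole space, as the integrals over sides require.\<close>

lemma elem_trace_eq:
  fixes v :: "'a \<Rightarrow> 'b::t2_space"
  assumes T: "T \<in> \<T>" and v: "\<And>x. x \<in> interior T \<Longrightarrow> v x = w x" and w: "continuous_on UNIV w"
  shows "elem_trace T v = (\<lambda>x. if x \<in> T then w x else Lim bot v)"
proof
  fix x
  show "elem_trace T v x = (if x \<in> T then w x else Lim bot v)"
  proof (cases "x \<in> T")
    case True
    have "(w \<longlongrightarrow> w x) (at x within interior T)"
      using w continuous_on_subset[of UNIV w "insert x (interior T)"]
      by (meson UNIV_I continuous_on_def tendsto_within_subset subset_UNIV)
    moreover have "eventually (\<lambda>y. w y = v y) (at x within interior T)"
      by (auto simp: eventually_at_filter v)
    ultimately have "(v \<longlongrightarrow> w x) (at x within interior T)" by (rule Lim_transform_eventually)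
    moreover have "\<not> trivial_limit (at x within interior T)"
      using islimpt_interior_element[OF T True] by (simp add: trivial_limit_within)
    ultimately show ?thesis using True tendsto_Lim unfolding elem_trace_def by auto
  next
    case False
    have "closure (interior T - {x}) \<subseteq> T"
      using element_closed[OF T] interior_subset[of T] by (intro closure_minimal) auto
    then have "at x within interior T = bot" using False unfolding at_within_eq_bot_iff by blast
    then show ?thesis using False by (simp add: elem_trace_def)
  qed
qed

lemma elem_trace_borel:
  fixes v :: "'a \<Rightarrow> 'b::euclidean_space"
  assumes T: "T \<in> \<T>" and v: "\<And>x. x \<in> interior T \<Longrightarrow> v x = w x" and w: "continuous_on UNIV w"
  shows "elem_trace T v \<in> borel_measurable borel"
proof -
  have sT: "T \<in> sets borel" using element_closed[OF T] by (rule borel_closed)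
  have mw: "w \<in> borel_measurable borel" using w by (rule borel_measurable_continuous_onI)
  have "(\<lambda>x. if x \<in> T then w x else Lim bot v) \<in> borel_measurable borel"
    by (rule measurable_If_set) (use sT mw in auto)
  then show ?thesis by (simp only: elem_trace_eq[OF assms])
qed

text \<open>Fluxes are taken along the outer normal of each element, so that the two fluxes through an interior side
are opposite for a field without normal jump.\<close>

definition conforming :: "('a set \<Rightarrow> 'a set \<Rightarrow> real) \<Rightarrow> bool" where
  "conforming F \<longleftrightarrow> (\<forall>S\<in>interior_sides \<Omega> \<T>. \<forall>T\<in>\<T>. \<forall>T'\<in>\<T>.
     T \<noteq> T' \<and> S facet_of T \<and> S facet_of T' \<longrightarrow> F T S + F T' S = 0)"

text \<open>The divergence of \<open>local_field F T\<close>, each term of which is a multiple of \<open>x - p\<close>, of divergence \<open>d\<close>.\<close>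

definition local_div :: "('a set \<Rightarrow> 'a set \<Rightarrow> real) \<Rightarrow> 'a set \<Rightarrow> real" where
  "local_div F T = DIM('a) * (\<Sum>S | S facet_of T. F T S / facet_height T S)"

definition flux_field :: "('a set \<Rightarrow> 'a set \<Rightarrow> real) \<Rightarrow> 'a \<Rightarrow> 'a" where
  "flux_field F x = (\<Sum>T\<in>\<T>. indicat_real (interior T) x *\<^sub>R local_field F T x)"

definition has_fluxes :: "('a \<Rightarrow> 'a) \<Rightarrow> ('a set \<Rightarrow> 'a set \<Rightarrow> real) \<Rightarrow> bool" where
  "has_fluxes y F \<longleftrightarrow> (\<forall>T\<in>\<T>. \<forall>x\<in>interior T. y x = local_field F T x)"

definition has_pieces :: "('a \<Rightarrow> real) \<Rightarrow> ('a set \<Rightarrow> 'a) \<Rightarrow> ('a set \<Rightarrow> real) \<Rightarrow> bool" where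
  "has_pieces v \<alpha> \<gamma> \<longleftrightarrow> (\<forall>T\<in>\<T>. \<forall>x\<in>interior T. v x = \<alpha> T \<bullet> x + \<gamma> T)"

lemma sum_indicator_interior:
  fixes c :: "'a set \<Rightarrow> 'b::real_vector"
  assumes T: "T \<in> \<T>" and x: "x \<in> interior T"
  shows "(\<Sum>T'\<in>\<T>. indicat_real (interior T') x *\<^sub>R c T') = c T"
proof -
  have "indicat_real (interior T') x *\<^sub>R c T' = (if T' = T then c T else 0)" if T': "T' \<in> \<T>" for T'
  proof (cases "T' = T")
    case True then show ?thesis using x by simp
  next
    case False
    then have "x \<notin> interior T'" using interiors_disjoint[OF T' T _ x] by blast
    then show ?thesis using False by simp
  qed
  then show ?thesis using T finite_elements by simp
qed

lemma has_fluxes_flux_field: "has_fluxes (flux_field F) F"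
  by (simp add: has_fluxes_def flux_field_def sum_indicator_interior)

lemma local_field_alt:
  "local_field F T x = (local_div F T / DIM('a)) *\<^sub>R x - (\<Sum>S | S facet_of T. (F T S / facet_height T S) *\<^sub>R facet_apex T S)"
  by (simp add: local_field_def local_div_def scaleR_diff_right sum_subtractf scaleR_sum_left)

lemma continuous_local_field: "continuous_on UNIV (local_field F T)"
  unfolding local_field_def by (intro continuous_intros)

lemma has_fluxes_elem_trace:
  assumes y: "has_fluxes y F" and T: "T \<in> \<T>"
  shows "elem_trace T y = (\<lambda>x. if x \<in> T then local_field F T x else Lim bot y)"
    and "elem_trace T y \<in> borel_measurable borel"
  using elem_trace_eq[OF T _ continuous_local_field, of y F] elem_trace_borel[OF T _ continuous_local_field, of y F]
    y T by (auto simp: has_fluxes_def)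

lemma has_fluxes_normal_trace:
  assumes y: "has_fluxes y F" and T: "T \<in> \<T>" and S: "S facet_of T" and x: "x \<in> S"
  shows "normal_trace T S y x = F T S"
  using facet_of_imp_subset[OF S] x local_field_normal[OF element_simplex[OF T] S x]
  by (auto simp: normal_trace_def has_fluxes_elem_trace[OF y T] inner_commute)

lemma RT_fluxes:
  assumes y: "y \<in> RT \<Omega> \<T>"
  obtains F where "has_fluxes y F" "conforming F"
proof -
  define F where "F T S = normal_trace T S y (SOME x. x \<in> S)" for T S
  have "y x = local_field F T x" if T: "T \<in> \<T>" and x: "x \<in> interior T" for T x
  proof -
    note sT = element_simplex[OF T]
    have "\<forall>b\<in>Basis. \<exists>a c. \<forall>x\<in>interior T. y x \<bullet> b = a \<bullet> x + c"
      using y T by (simp add: RT_def L1_def)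
    then obtain a c where ac: "\<And>b x. b \<in> Basis \<Longrightarrow> x \<in> interior T \<Longrightarrow> y x \<bullet> b = a b \<bullet> x + c b"
      by metis
    define L where "L x = (\<Sum>b\<in>Basis. (a b \<bullet> x) *\<^sub>R b)" for x :: 'a
    define c0 where "c0 = (\<Sum>b\<in>Basis. c b *\<^sub>R b)"
    define w where "w x = L x + c0" for x
    have L: "linear L"
      unfolding L_def by (intro linear_compose_sum ballI linearI) (simp_all add: inner_add_right scaleR_add_left)
    have yw: "y x = w x" if x: "x \<in> interior T" for x
    proof -
      have "y x = (\<Sum>b\<in>Basis. (y x \<bullet> b) *\<^sub>R b)" by (simp add: euclidean_representation)
      also have "\<dots> = (\<Sum>b\<in>Basis. (a b \<bullet> x + c b) *\<^sub>R b)" using ac x by (intro sum.cong) auto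
      finally show ?thesis by (simp add: w_def L_def c0_def scaleR_add_left sum.distrib)
    qed
    have "continuous_on UNIV w"
      unfolding w_def using L by (intro continuous_intros linear_continuous_on) (simp add: linear_conv_bounded_linear)
    then have tr: "elem_trace T y x = w x" if "x \<in> T" for x
      using elem_trace_eq[OF T yw] that by simp
    have "outer_normal T S \<bullet> w x = F T S" if S: "S facet_of T" and x: "x \<in> S" for S x
    proof -
      have "\<exists>c. \<forall>x\<in>S. normal_trace T S y x = c"
        using y T S by (simp add: RT_def)
      then obtain c where c: "\<And>x. x \<in> S \<Longrightarrow> normal_trace T S y x = c" by blast
      have "(SOME x. x \<in> S) \<in> S" using x by (rule someI)
      then have "F T S = normal_trace T S y x" using c x by (simp add: F_def)
      then show ?thesis
        using tr facet_of_imp_subset[OF S] x by (auto simp: normal_trace_def inner_commute)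
    qed
    then show ?thesis
      using affine_eq_local_field[OF sT L w_def, of F] yw[OF x] by simp
  qed
  then have "has_fluxes y F" by (simp add: has_fluxes_def)
  moreover have "conforming F"
    unfolding conforming_def
  proof (intro ballI impI)
    fix S T T' assume *: "S \<in> interior_sides \<Omega> \<T>" "T \<in> \<T>" "T' \<in> \<T>" "T \<noteq> T' \<and> S facet_of T \<and> S facet_of T'"
    have "S \<noteq> {}" using * facet_nonempty[OF element_simplex[OF *(2)]] by blast
    then have "(SOME x. x \<in> S) \<in> S" by (simp add: some_in_eq)
    moreover have "\<forall>x\<in>S. normal_trace T S y x + normal_trace T' S y x = 0"
      using y * by (simp add: RT_def)
    ultimately show "F T S + F T' S = 0" by (simp add: F_def)
  qed
  ultimately show thesis by (rule that)
qed

lemma RT_flux_field: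
  assumes F: "conforming F"
  shows "flux_field F \<in> RT \<Omega> \<T>"
proof -
  note y = has_fluxes_flux_field[of F]
  have "(\<lambda>x. flux_field F x \<bullet> b) \<in> L1 \<T>" for b
    unfolding L1_def mem_Collect_eq
  proof (intro ballI exI)
    fix T x assume "T \<in> \<T>" "x \<in> interior T"
    then have "flux_field F x = local_field F T x" using y by (simp add: has_fluxes_def)
    then show "flux_field F x \<bullet> b = ((local_div F T / DIM('a)) *\<^sub>R b) \<bullet> x
        + - (\<Sum>S | S facet_of T. (F T S / facet_height T S) *\<^sub>R facet_apex T S) \<bullet> b"
      by (simp add: local_field_alt inner_diff_left inner_diff_right inner_minus_left inner_commute[of _ b])
  qed
  moreover have "\<exists>c. \<forall>x\<in>S. normal_trace T S (flux_field F) x = c" if "T \<in> \<T>" "S facet_of T" for T S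
    using has_fluxes_normal_trace[OF y that] by blast
  moreover have "normal_trace T S (flux_field F) x + normal_trace T' S (flux_field F) x = 0"
    if "S \<in> interior_sides \<Omega> \<T>" "T \<in> \<T>" "T' \<in> \<T>" "T \<noteq> T' \<and> S facet_of T \<and> S facet_of T'" "x \<in> S" for S T T' x
    using that F by (simp add: has_fluxes_normal_trace[OF y] conforming_def)
  ultimately show ?thesis by (simp add: RT_def)
qed

lemma has_fluxes_divergence:
  assumes y: "has_fluxes y F" and T: "T \<in> \<T>" and x: "x \<in> interior T"
  shows "divergence y x = local_div F T"
proof -
  let ?c = "local_div F T / DIM('a)"
  have "(local_field F T has_derivative (\<lambda>h. ?c *\<^sub>R h)) (at x)"
    unfolding local_field_alt[abs_def] by (auto intro!: derivative_eq_intros)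
  then have "(y has_derivative (\<lambda>h. ?c *\<^sub>R h)) (at x)"
    by (rule has_derivative_transform_within_open[OF _ open_interior x])
       (use y T in \<open>simp add: has_fluxes_def\<close>)
  then have "frechet_derivative y (at x) = (\<lambda>h. ?c *\<^sub>R h)"
    by (rule frechet_derivative_at[symmetric])
  then show ?thesis by (simp add: divergence_def)
qed

lemma has_pieces_grad:
  assumes v: "has_pieces v \<alpha> \<gamma>" and T: "T \<in> \<T>" and x: "x \<in> interior T"
  shows "grad v x = \<alpha> T"
proof -
  have "((\<lambda>x. \<alpha> T \<bullet> x + \<gamma> T) has_derivative (\<lambda>h. \<alpha> T \<bullet> h)) (at x)"
    by (auto intro!: derivative_eq_intros)
  then have "(v has_derivative (\<lambda>h. \<alpha> T \<bullet> h)) (at x)"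
    by (rule has_derivative_transform_within_open[OF _ open_interior x])
       (use v T in \<open>simp add: has_pieces_def\<close>)
  then have "frechet_derivative v (at x) = (\<lambda>h. \<alpha> T \<bullet> h)"
    by (rule frechet_derivative_at[symmetric])
  then show ?thesis by (simp add: grad_def euclidean_representation)
qed

lemma elem_average:
  fixes v :: "'a \<Rightarrow> 'b::euclidean_space"
  assumes T: "T \<in> \<T>" and v: "\<And>x. x \<in> interior T \<Longrightarrow> v x = w x" and w: "continuous_on UNIV w"
    and x: "x \<in> interior T"
  shows "elem_proj \<T> v x = (LINT t|lebesgue_on T. w t) /\<^sub>R measure lebesgue T"
proof -
  have sets: "T \<in> sets lebesgue" using element_compact[OF T] by (simp add: lmeasurable_compact fmeasurableD)
  have int: "integrable lebesgue (\<lambda>x. indicator T x *\<^sub>R w x)"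
    using integral_lebesgue_on_compact(2)[OF element_compact[OF T] w] sets
    by (subst integrable_restrict_space[symmetric]) auto
  have "(LINT t|lebesgue_on T. v t) = (LINT t|lebesgue. indicator T t *\<^sub>R v t)"
    using sets by (simp add: integral_restrict_space)
  also have "\<dots> = (LINT t|lebesgue. indicator T t *\<^sub>R w t)"
  proof (rule lebesgue_integral_spike)
    show "negligible (frontier T)" by (rule negligible_convex_frontier[OF element_convex[OF T]])
    show "indicator T t *\<^sub>R v t = indicator T t *\<^sub>R w t" if "t \<notin> frontier T" for t
      using that v element_closed[OF T] by (auto simp: frontier_def indicator_def)
  qed (use int in simp)
  also have "\<dots> = (LINT t|lebesgue_on T. w t)"
    using sets by (simp add: integral_restrict_space)
  finally show ?thesis unfolding elem_proj_def by (simp only: sum_indicator_interior[OF T x])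
qed

lemma elem_proj_id:
  assumes "T \<in> \<T>" "x \<in> interior T" shows "elem_proj \<T> (\<lambda>x. x) x = centroid T"
  using elem_average[OF assms(1) _ continuous_on_id assms(2), of "\<lambda>x. x"] by (simp add: centroid_def)

lemma has_pieces_elem_proj:
  assumes v: "has_pieces v \<alpha> \<gamma>" and T: "T \<in> \<T>" and x: "x \<in> interior T"
  shows "elem_proj \<T> v x = \<alpha> T \<bullet> centroid T + \<gamma> T"
proof -
  have "elem_proj \<T> v x = (LINT t|lebesgue_on T. \<alpha> T \<bullet> t + \<gamma> T) /\<^sub>R measure lebesgue T"
    by (rule elem_average[OF T _ _ x]) (use v T in \<open>auto simp: has_pieces_def intro!: continuous_intros\<close>)
  then show ?thesis
    using measure_simplex_pos(1)[OF element_simplex[OF T]]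
    by (simp add: integral_simplex_affine[OF element_simplex[OF T]])
qed

lemma has_fluxes_elem_proj:
  assumes y: "has_fluxes y F" and T: "T \<in> \<T>" and x: "x \<in> interior T"
  shows "elem_proj \<T> y x = local_field F T (centroid T)"
proof -
  let ?d = "local_div F T / DIM('a)" and ?e = "\<Sum>S | S facet_of T. (F T S / facet_height T S) *\<^sub>R facet_apex T S"
  have pos: "measure lebesgue T > 0" by (rule measure_simplex_pos(1)[OF element_simplex[OF T]])
  note cT = element_compact[OF T]
  have sets: "T \<in> sets lebesgue" using cT by (simp add: lmeasurable_compact fmeasurableD)
  have "elem_proj \<T> y x = (LINT t|lebesgue_on T. local_field F T t) /\<^sub>R measure lebesgue T"
    by (rule elem_average[OF T _ continuous_local_field x]) (use y T in \<open>auto simp: has_fluxes_def\<close>)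
  also have "(LINT t|lebesgue_on T. local_field F T t) = ?d *\<^sub>R (LINT t|lebesgue_on T. t) - measure lebesgue T *\<^sub>R ?e"
    unfolding local_field_alt
    using integral_lebesgue_on_compact(2)[OF cT continuous_on_id] integral_lebesgue_on_compact(2)[OF cT continuous_on_const, of ?e] sets
    by (subst Bochner_Integration.integral_diff) (auto simp: measure_restrict_space)
  finally show ?thesis
    using pos by (simp add: local_field_alt centroid_def scaleR_diff_right)
qed

lemma local_green:
  assumes T: "T \<in> \<T>"
  shows "measure lebesgue T * (\<alpha> \<bullet> local_field F T (centroid T) + (\<alpha> \<bullet> centroid T + \<gamma>) * local_div F T)
    = (\<Sum>S | S facet_of T. F T S * (side_area S * (\<alpha> \<bullet> side_centroid S + \<gamma>)))"
proof -
  note sT = element_simplex[OF T]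
  let ?m = "centroid T"
  have "\<alpha> \<bullet> local_field F T ?m + (\<alpha> \<bullet> ?m + \<gamma>) * local_div F T
      = (\<Sum>S | S facet_of T. F T S * ((\<alpha> \<bullet> (?m - facet_apex T S) + DIM('a) * (\<alpha> \<bullet> ?m + \<gamma>)) / facet_height T S))"
  proof -
    have "\<alpha> \<bullet> local_field F T ?m = (\<Sum>S | S facet_of T. F T S * ((\<alpha> \<bullet> (?m - facet_apex T S)) / facet_height T S))"
      by (simp add: local_field_def inner_sum_right)
    moreover have "(\<alpha> \<bullet> ?m + \<gamma>) * local_div F T = (\<Sum>S | S facet_of T. F T S * ((DIM('a) * (\<alpha> \<bullet> ?m + \<gamma>)) / facet_height T S))"
      by (simp add: local_div_def sum_distrib_left mult_ac)
    ultimately show ?thesis by (simp add: add_divide_distrib distrib_left flip: sum.distrib)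
  qed
  then have "measure lebesgue T * (\<alpha> \<bullet> local_field F T ?m + (\<alpha> \<bullet> ?m + \<gamma>) * local_div F T)
      = (\<Sum>S | S facet_of T. F T S * (measure lebesgue T * ((\<alpha> \<bullet> (?m - facet_apex T S) + DIM('a) * (\<alpha> \<bullet> ?m + \<gamma>)) / facet_height T S)))"
    by (simp add: sum_distrib_left mult_ac)
  also have "\<dots> = (\<Sum>S | S facet_of T. F T S * (side_area S * (\<alpha> \<bullet> side_centroid S + \<gamma>)))"
    by (intro sum.cong refl arg_cong2[where f="(*)"] facet_field_green[OF sT]) simp
  finally show ?thesis .
qed

text \<open>Every interior side is a facet of exactly two elements, whose contributions cancel.\<close>

lemma sum_facets_eq_sum_boundary:
  fixes G :: "'a set \<Rightarrow> 'a set \<Rightarrow> real"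
  assumes G: "\<And>S T T'. S \<in> interior_sides \<Omega> \<T> \<Longrightarrow> T \<in> \<T> \<Longrightarrow> T' \<in> \<T> \<Longrightarrow> T \<noteq> T' \<Longrightarrow> S facet_of T \<Longrightarrow> S facet_of T'
      \<Longrightarrow> G T S + G T' S = 0"
  shows "(\<Sum>T\<in>\<T>. \<Sum>S | S facet_of T. G T S) = (\<Sum>S\<in>boundary_sides \<Omega> \<T>. G (side_element \<T> S) S)"
proof -
  have "{S. S facet_of T} = {S \<in> sides \<T>. S facet_of T}" if "T \<in> \<T>" for T
    using that by (auto simp: sides_def)
  then have "(\<Sum>T\<in>\<T>. \<Sum>S | S facet_of T. G T S) = (\<Sum>T\<in>\<T>. \<Sum>S | S \<in> sides \<T> \<and> S facet_of T. G T S)"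
    by (intro sum.cong) auto
  also have "\<dots> = (\<Sum>S\<in>sides \<T>. \<Sum>T | T \<in> \<T> \<and> S facet_of T. G T S)"
    by (rule sum.swap_restrict[OF finite_elements finite_sides])
  also have "\<dots> = (\<Sum>S\<in>boundary_sides \<Omega> \<T>. \<Sum>T | T \<in> \<T> \<and> S facet_of T. G T S)"
  proof (rule sum.mono_neutral_right[OF finite_sides])
    show "\<forall>S\<in>sides \<T> - boundary_sides \<Omega> \<T>. (\<Sum>T | T \<in> \<T> \<and> S facet_of T. G T S) = 0"
    proof
      fix S assume S: "S \<in> sides \<T> - boundary_sides \<Omega> \<T>"
      then have Si: "S \<in> interior_sides \<Omega> \<T>" by (auto simp: interior_sides_def boundary_sides_def)
      obtain T where T: "T \<in> \<T>" "S facet_of T" using S by (auto simp: sides_def)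
      obtain T' where T': "T' \<in> \<T>" "T' \<noteq> T" "S facet_of T'"
        "\<And>T''. T'' \<in> \<T> \<Longrightarrow> S facet_of T'' \<Longrightarrow> T'' = T \<or> T'' = T'"
        by (rule interior_side_neighbour[OF Si T]) blast
      have "{T. T \<in> \<T> \<and> S facet_of T} = {T, T'}" using T T' by blast
      then show "(\<Sum>T | T \<in> \<T> \<and> S facet_of T. G T S) = 0"
        using G[OF Si T(1) T'(1) _ T(2) T'(3)] T'(2) by simp
    qed
  qed (auto simp: boundary_sides_def)
  also have "\<dots> = (\<Sum>S\<in>boundary_sides \<Omega> \<T>. G (side_element \<T> S) S)"
  proof (rule sum.cong)
    fix S assume S: "S \<in> boundary_sides \<Omega> \<T>"
    have "{T. T \<in> \<T> \<and> S facet_of T} = {side_element \<T> S}"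
      using side_element[OF S] by blast
    then show "(\<Sum>T | T \<in> \<T> \<and> S facet_of T. G T S) = G (side_element \<T> S) S" by simp
  qed simp
  finally show ?thesis .
qed

lemma L0_values:
  assumes "v \<in> L0 \<T>" obtains c where "\<And>T x. T \<in> \<T> \<Longrightarrow> x \<in> interior T \<Longrightarrow> v x = c T"
proof -
  have "\<forall>T\<in>\<T>. \<exists>c. \<forall>x\<in>interior T. v x = c" using assms by (simp add: L0_def)
  from bchoice[OF this] obtain c where "\<forall>T\<in>\<T>. \<forall>x\<in>interior T. v x = c T" ..
  then show thesis using that by blast
qed

lemma L1_pieces:
  assumes "v \<in> L1 \<T>" obtains \<alpha> \<gamma> where "has_pieces v \<alpha> \<gamma>"
proof -
  have "\<forall>T\<in>\<T>. \<exists>p. \<forall>x\<in>interior T. v x = fst p \<bullet> x + snd p" using assms by (simp add: L1_def)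
  from bchoice[OF this] obtain p where "\<forall>T\<in>\<T>. \<forall>x\<in>interior T. v x = fst (p T) \<bullet> x + snd (p T)" ..
  then show thesis using that[of "\<lambda>T. fst (p T)" "\<lambda>T. snd (p T)"] by (simp add: has_pieces_def)
qed

lemma has_pieces_side_average:
  assumes v: "has_pieces v \<alpha> \<gamma>" and T: "T \<in> \<T>" and S: "S facet_of T"
  shows "side_average S (elem_trace T v) = \<alpha> T \<bullet> side_centroid S + \<gamma> T"
proof -
  have vT: "\<And>x. x \<in> interior T \<Longrightarrow> v x = \<alpha> T \<bullet> x + \<gamma> T" using v T by (simp add: has_pieces_def)
  have c: "continuous_on UNIV (\<lambda>x. \<alpha> T \<bullet> x + \<gamma> T)" by (intro continuous_intros)
  show ?thesis
    using elem_trace_eq[OF T vT c] elem_trace_borel[OF T vT c] facet_of_imp_subset[OF S]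
    by (intro side_average_affine[OF element_simplex[OF T] S]) auto
qed

lemma has_pieces_jump:
  assumes v: "has_pieces v \<alpha> \<gamma>" and T: "T \<in> \<T>" "S facet_of T" and T': "T' \<in> \<T>" "S facet_of T'"
  shows "side_average S (\<lambda>x. elem_trace T v x - elem_trace T' v x)
    = (\<alpha> T \<bullet> side_centroid S + \<gamma> T) - (\<alpha> T' \<bullet> side_centroid S + \<gamma> T')"
proof -
  have vT: "\<And>x. x \<in> interior T \<Longrightarrow> v x = \<alpha> T \<bullet> x + \<gamma> T" "\<And>x. x \<in> interior T' \<Longrightarrow> v x = \<alpha> T' \<bullet> x + \<gamma> T'"
    using v T(1) T'(1) by (auto simp: has_pieces_def)
  have c: "continuous_on UNIV (\<lambda>x. \<alpha> T \<bullet> x + \<gamma> T)" for T by (intro continuous_intros)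
  have "side_average S (\<lambda>x. elem_trace T v x - elem_trace T' v x)
      = (\<alpha> T - \<alpha> T') \<bullet> side_centroid S + (\<gamma> T - \<gamma> T')"
    using elem_trace_eq[OF T(1) vT(1) c] elem_trace_borel[OF T(1) vT(1) c] facet_of_imp_subset[OF T(2)]
      elem_trace_eq[OF T'(1) vT(2) c] elem_trace_borel[OF T'(1) vT(2) c] facet_of_imp_subset[OF T'(2)]
    by (intro side_average_affine[OF element_simplex[OF T(1)] T(2)])
       (auto simp: inner_diff_left intro!: borel_measurable_diff)
  then show ?thesis by (simp add: inner_diff_left)
qed

lemma CR_iff:
  assumes v: "has_pieces v \<alpha> \<gamma>"
  shows "v \<in> CR \<Omega> \<T> \<longleftrightarrow> (\<forall>S\<in>interior_sides \<Omega> \<T>. \<forall>T\<in>\<T>. \<forall>T'\<in>\<T>. T \<noteq> T' \<and> S facet_of T \<and> S facet_of T' \<longrightarrow>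
    \<alpha> T \<bullet> side_centroid S + \<gamma> T = \<alpha> T' \<bullet> side_centroid S + \<gamma> T')"
proof -
  have "v \<in> L1 \<T>" using v unfolding L1_def has_pieces_def by blast
  then show ?thesis
    unfolding CR_def using has_pieces_jump[OF v] by auto
qed

lemma side_proj_pieces:
  assumes v: "has_pieces v \<alpha> \<gamma>" and S: "S \<in> boundary_sides \<Omega> \<T>"
  shows "side_proj \<T> v S = \<alpha> (side_element \<T> S) \<bullet> side_centroid S + \<gamma> (side_element \<T> S)"
  unfolding side_proj_def by (rule has_pieces_side_average[OF v side_element(1,2)[OF S]])

lemma sides_on_boundary: "S \<in> sides_on \<Omega> \<T> \<Gamma> \<Longrightarrow> S \<in> boundary_sides \<Omega> \<T>"
  by (simp add: sides_on_def)

lemma boundary_flux_eq: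
  assumes y: "has_fluxes y F" and S: "S \<in> boundary_sides \<Omega> \<T>"
  shows "x \<in> S \<Longrightarrow> boundary_flux \<T> S y x = F (side_element \<T> S) S"
    and "boundary_flux \<T> S y \<in> borel_measurable borel"
proof -
  note E = side_element(1,2)[OF S]
  show "x \<in> S \<Longrightarrow> boundary_flux \<T> S y x = F (side_element \<T> S) S"
    unfolding boundary_flux_def by (rule has_fluxes_normal_trace[OF y E])
  have [measurable]: "elem_trace (side_element \<T> S) y \<in> borel_measurable borel"
    by (rule has_fluxes_elem_trace(2)[OF y E(1)])
  show "boundary_flux \<T> S y \<in> borel_measurable borel"
    unfolding boundary_flux_def normal_trace_def[abs_def] by measurable
qed

lemma AE_boundary_flux_iff:
  assumes y: "has_fluxes y F" and S: "S \<in> boundary_sides \<Omega> \<T>"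
  shows "(AE x in side_measure S. boundary_flux \<T> S y x = c) \<longleftrightarrow> F (side_element \<T> S) S = c"
proof -
  note sT = element_simplex[OF side_element(1)[OF S]] and E = side_element(2)[OF S]
  note AE = AE_side_measure[OF sT E]
  show ?thesis
  proof
    assume "F (side_element \<T> S) S = c"
    then show "AE x in side_measure S. boundary_flux \<T> S y x = c"
      using AE by (auto simp: boundary_flux_eq(1)[OF y S])
  next
    assume "AE x in side_measure S. boundary_flux \<T> S y x = c"
    then have *: "AE x in side_measure S. F (side_element \<T> S) S = c"
      using AE by eventually_elim (simp add: boundary_flux_eq(1)[OF y S])
    show "F (side_element \<T> S) S = c"
    proof (rule ccontr)
      assume "F (side_element \<T> S) S \<noteq> c"
      then have "AE x in side_measure S. False" using * by simp
      then have "emeasure (side_measure S) (space (side_measure S)) = 0"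
        using AE_iff_measurable[of "space (side_measure S)" "side_measure S" "\<lambda>x. False"] by simp
      then have "measure (side_measure S) UNIV = 0" by (simp add: space_side_measure[OF sT E] measure_def)
      then show False using side_area_pos[OF sT E] by (simp add: measure_side_measure_UNIV[OF sT E])
    qed
  qed
qed

lemma flux_pairing_eq:
  assumes y: "has_fluxes y F"
  shows "flux_pairing \<Omega> \<T> \<Gamma> y u = (\<Sum>S\<in>sides_on \<Omega> \<T> \<Gamma>. F (side_element \<T> S) S * (side_area S * u S))"
  unfolding flux_pairing_def
proof (rule sum.cong)
  fix S assume "S \<in> sides_on \<Omega> \<T> \<Gamma>"
  then have S: "S \<in> boundary_sides \<Omega> \<T>" by (rule sides_on_boundary)
  note sT = element_simplex[OF side_element(1)[OF S]] and E = side_element(2)[OF S]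
  have "(LINT x|side_measure S. boundary_flux \<T> S y x * u S) = (LINT x|side_measure S. F (side_element \<T> S) S * u S)"
  proof (rule integral_cong_AE)
    show "AE x in side_measure S. boundary_flux \<T> S y x * u S = F (side_element \<T> S) S * u S"
      using AE_side_measure[OF sT E] by eventually_elim (simp add: boundary_flux_eq(1)[OF y S])
  qed (use boundary_flux_eq(2)[OF y S] in \<open>auto simp: borel_measurable_side_measure[OF sT E]\<close>)
  also have "\<dots> = F (side_element \<T> S) S * (side_area S * u S)"
    by (simp add: space_side_measure[OF sT E] measure_side_measure_UNIV[OF sT E])
  finally show "(LINT x|side_measure S. boundary_flux \<T> S y x * u S) = F (side_element \<T> S) S * (side_area S * u S)" .
qed simp

lemma side_pairing_eq:
  "side_pairing \<Omega> \<T> \<Gamma> g u = (\<Sum>S\<in>sides_on \<Omega> \<T> \<Gamma>. g S * (side_area S * u S))"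
  unfolding side_pairing_def
proof (rule sum.cong)
  fix S assume "S \<in> sides_on \<Omega> \<T> \<Gamma>"
  then have S: "S \<in> boundary_sides \<Omega> \<T>" by (rule sides_on_boundary)
  note sT = element_simplex[OF side_element(1)[OF S]] and E = side_element(2)[OF S]
  show "(LINT x|side_measure S. g S * u S) = g S * (side_area S * u S)"
    by (simp add: space_side_measure[OF sT E] measure_side_measure_UNIV[OF sT E])
qed simp

lemma integral_piecewise_constant:
  fixes \<phi> :: "'a \<Rightarrow> real"
  assumes "\<And>T x. T \<in> \<T> \<Longrightarrow> x \<in> interior T \<Longrightarrow> \<phi> x = c T"
  shows "(LINT x|lebesgue_on \<Omega>. \<phi> x) = (\<Sum>T\<in>\<T>. measure lebesgue T * c T)"
proof -
  have "(LINT x|lebesgue_on \<Omega>. \<phi> x) = (\<Sum>T\<in>\<T>. LINT x|lebesgue_on T. c T)"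
    using assms by (intro integral_domain) auto
  also have "\<dots> = (\<Sum>T\<in>\<T>. measure lebesgue T * c T)"
    using element_compact by (intro sum.cong) (auto simp: measure_restrict_space lmeasurable_compact fmeasurableD)
  finally show ?thesis .
qed

section \<open>Integration by parts on the mesh and prescribed divergence\<close>

lemma L2_inner_elem_proj:
  assumes y: "has_fluxes y F" and s: "\<And>T x. T \<in> \<T> \<Longrightarrow> x \<in> interior T \<Longrightarrow> s x = \<sigma> T"
  shows "L2_inner \<Omega> s (elem_proj \<T> y) = (\<Sum>T\<in>\<T>. measure lebesgue T * (\<sigma> T \<bullet> local_field F T (centroid T)))"
  unfolding L2_inner_def
  by (rule integral_piecewise_constant) (simp add: s has_fluxes_elem_proj[OF y])

lemma L2_inner_divergence:
  assumes y: "has_fluxes y F" and l: "\<And>T x. T \<in> \<T> \<Longrightarrow> x \<in> interior T \<Longrightarrow> l x = c T"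
  shows "L2_inner \<Omega> l (divergence y) = (\<Sum>T\<in>\<T>. measure lebesgue T * (c T * local_div F T))"
  unfolding L2_inner_def
  by (rule integral_piecewise_constant) (simp add: l has_fluxes_divergence[OF y])

lemma green_sides:
  "(\<Sum>T\<in>\<T>. measure lebesgue T * (\<alpha> T \<bullet> local_field F T (centroid T)))
   + (\<Sum>T\<in>\<T>. measure lebesgue T * ((\<alpha> T \<bullet> centroid T + \<gamma> T) * local_div F T))
   = (\<Sum>T\<in>\<T>. \<Sum>S | S facet_of T. F T S * (side_area S * (\<alpha> T \<bullet> side_centroid S + \<gamma> T)))"
  unfolding sum.distrib[symmetric] distrib_left[symmetric]
  by (rule sum.cong[OF refl]) (rule local_green)

lemma green_boundary:
  assumes v: "has_pieces v \<alpha> \<gamma>" "v \<in> CR \<Omega> \<T>" and F: "conforming F"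
  shows "(\<Sum>T\<in>\<T>. measure lebesgue T * (\<alpha> T \<bullet> local_field F T (centroid T)))
   + (\<Sum>T\<in>\<T>. measure lebesgue T * ((\<alpha> T \<bullet> centroid T + \<gamma> T) * local_div F T))
   = (\<Sum>S\<in>boundary_sides \<Omega> \<T>. F (side_element \<T> S) S * (side_area S * side_proj \<T> v S))"
proof -
  let ?G = "\<lambda>T S. F T S * (side_area S * (\<alpha> T \<bullet> side_centroid S + \<gamma> T))"
  have "?G T S + ?G T' S = 0" if "S \<in> interior_sides \<Omega> \<T>" "T \<in> \<T>" "T' \<in> \<T>" "T \<noteq> T'" "S facet_of T" "S facet_of T'" for S T T'
  proof -
    have "\<alpha> T \<bullet> side_centroid S + \<gamma> T = \<alpha> T' \<bullet> side_centroid S + \<gamma> T'"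
      using v(2) that unfolding CR_iff[OF v(1)] by blast
    moreover have "F T S + F T' S = 0" using F that unfolding conforming_def by blast
    then have "F T' S = - F T S" by simp
    ultimately show ?thesis by simp
  qed
  from sum_facets_eq_sum_boundary[of ?G, OF this]
  have "(\<Sum>T\<in>\<T>. \<Sum>S | S facet_of T. ?G T S) = (\<Sum>S\<in>boundary_sides \<Omega> \<T>. ?G (side_element \<T> S) S)" .
  also have "\<dots> = (\<Sum>S\<in>boundary_sides \<Omega> \<T>. F (side_element \<T> S) S * (side_area S * side_proj \<T> v S))"
    by (intro sum.cong) (simp_all add: side_proj_pieces[OF v(1)])
  finally show ?thesis by (simp only: green_sides)
qed

definition unit_flux :: "'a set \<Rightarrow> 'a set \<Rightarrow> 'a set \<Rightarrow> 'a set \<Rightarrow> real" where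
  "unit_flux T0 S0 = (\<lambda>T S. if T = T0 \<and> S = S0 then 1 else 0)"

lemma sum_unit_flux:
  assumes T: "T \<in> \<T>" and S: "S facet_of T"
  shows "(\<Sum>T'\<in>\<T>. \<Sum>S' | S' facet_of T'. unit_flux T S T' S' * G T' S') = G T S"
proof -
  have "(\<Sum>S' | S' facet_of T'. unit_flux T S T' S' * G T' S') = (if T' = T then G T S else 0)" if "T' \<in> \<T>" for T'
  proof (cases "T' = T")
    case True
    then have "(\<Sum>S' | S' facet_of T'. unit_flux T S T' S' * G T' S') = (\<Sum>S' | S' facet_of T. if S' = S then G T S else 0)"
      by (intro sum.cong) (auto simp: unit_flux_def)
    then show ?thesis using True S finite_facets[OF element_simplex[OF T]] by simp
  qed (simp add: unit_flux_def)
  then show ?thesis using T finite_elements by simp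
qed

lemma conforming_boundary_unit_flux:
  "S \<in> boundary_sides \<Omega> \<T> \<Longrightarrow> conforming (unit_flux T S)"
  using side_element_cases by (auto simp: conforming_def unit_flux_def boundary_sides_def)

lemma conforming_interior_unit_flux:
  assumes S: "S \<in> interior_sides \<Omega> \<T>" and T: "T \<in> \<T>" "S facet_of T" and T': "T' \<in> \<T>" "S facet_of T'" and ne: "T \<noteq> T'"
  shows "conforming (\<lambda>U R. unit_flux T S U R - unit_flux T' S U R)"
  unfolding conforming_def
proof (intro ballI impI)
  fix R U U' assume U: "R \<in> interior_sides \<Omega> \<T>" "U \<in> \<T>" "U' \<in> \<T>" "U \<noteq> U' \<and> R facet_of U \<and> R facet_of U'"
  show "unit_flux T S U R - unit_flux T' S U R + (unit_flux T S U' R - unit_flux T' S U' R) = 0"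
  proof (cases "R = S")
    case True
    obtain T'' where T'': "\<And>V. V \<in> \<T> \<Longrightarrow> S facet_of V \<Longrightarrow> V = T \<or> V = T''"
      by (rule interior_side_neighbour[OF S T]) blast
    have "T' = T''" using T''[OF T'] ne by blast
    then have "U = T \<and> U' = T' \<or> U = T' \<and> U' = T" using T''[of U] T''[of U'] U True by blast
    then show ?thesis using ne by (auto simp: unit_flux_def)
  qed (simp add: unit_flux_def)
qed

lemma conforming_add: "conforming F \<Longrightarrow> conforming G \<Longrightarrow> conforming (\<lambda>T S. F T S + G T S)"
  unfolding conforming_def by (metis (no_types, opaque_lifting) add.assoc add.commute add_0)

lemma conforming_scale: "conforming F \<Longrightarrow> conforming (\<lambda>T S. c * F T S)"
  unfolding conforming_def by (metis distrib_left mult_zero_right)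

lemma local_div_add: "local_div (\<lambda>T S. F T S + G T S) T = local_div F T + local_div G T"
  by (simp add: local_div_def add_divide_distrib sum.distrib distrib_left)

lemma local_div_scale: "local_div (\<lambda>T S. c * F T S) T = c * local_div F T"
  by (simp add: local_div_def sum_distrib_left mult_ac)

lemma local_div_unit_flux:
  assumes T: "T \<in> \<T>" and S: "S facet_of T"
  shows "local_div (unit_flux T S) T' = (if T' = T then DIM('a) / facet_height T S else 0)"
proof (cases "T' = T")
  case True
  then have "(\<Sum>S' | S' facet_of T'. unit_flux T S T' S' / facet_height T' S')
      = (\<Sum>S' | S' facet_of T. if S' = S then 1 / facet_height T S else 0)"
    by (intro sum.cong) (auto simp: unit_flux_def)
  then show ?thesis using True S finite_facets[OF element_simplex[OF T]] by (simp add: local_div_def)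
qed (simp add: local_div_def unit_flux_def)

text \<open>An element with a facet in \<open>\<Gamma>D\<close> can discharge its divergence through that facet.  A flux through an interior
side carries divergence from one element to its neighbour, so that the property spreads
over the whole mesh.\<close>

lemma exists_flux_div_indicator:
  assumes dec: "boundary_decomposition \<Omega> \<T> \<Gamma>D \<Gamma>N" and T: "T \<in> \<T>"
  obtains F where "conforming F" "\<And>S. S \<in> sides_on \<Omega> \<T> \<Gamma>N \<Longrightarrow> F (side_element \<T> S) S = 0"
    "\<And>T'. local_div F T' = (if T' = T then 1 else 0)"
proof -
  define adm where "adm F \<longleftrightarrow> conforming F \<and> (\<forall>S\<in>sides_on \<Omega> \<T> \<Gamma>N. F (side_element \<T> S) S = 0)" for F
  define G where "G = {T \<in> \<T>. \<exists>F. adm F \<and> (\<forall>T'. local_div F T' = (if T' = T then 1 else 0))}"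
  have "G = \<T>"
  proof (rule side_connected)
    show "G \<subseteq> \<T>" by (auto simp: G_def)
    show "G \<noteq> {}"
    proof -
      obtain S where SD: "S \<in> sides_on \<Omega> \<T> \<Gamma>D" using exists_Dirichlet_side[OF dec] by blast
      then have S: "S \<in> boundary_sides \<Omega> \<T>" by (rule sides_on_boundary)
      then have SN: "S \<notin> sides_on \<Omega> \<T> \<Gamma>N" using dec SD by (auto simp: boundary_decomposition_def)
      let ?T = "side_element \<T> S"
      note E = side_element(1,2)[OF S]
      let ?F = "\<lambda>T R. (facet_height ?T S / DIM('a)) * unit_flux ?T S T R"
      have "conforming ?F" by (rule conforming_scale[OF conforming_boundary_unit_flux[OF S]])
      then have "adm ?F" unfolding adm_def using SN by (auto simp: unit_flux_def)
      moreover have "local_div ?F T' = (if T' = ?T then 1 else 0)" for T'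
        unfolding local_div_scale local_div_unit_flux[OF E]
        using facet_height_pos[OF element_simplex[OF E(1)] E(2)] by simp
      ultimately have "?T \<in> G" unfolding G_def using E(1) by blast
      then show ?thesis by blast
    qed
  next
    fix S T T' assume S: "S \<in> interior_sides \<Omega> \<T>" and TG: "T \<in> G" and T': "T' \<in> \<T>" and f: "S facet_of T" "S facet_of T'"
    show "T' \<in> G"
    proof (cases "T = T'")
      case False
      have T: "T \<in> \<T>" using TG by (simp add: G_def)
      obtain F where F: "adm F" "\<And>T'. local_div F T' = (if T' = T then 1 else 0)"
        using TG unfolding G_def by blast
      let ?h = "facet_height T S" and ?h' = "facet_height T' S"
      let ?E = "\<lambda>U R. unit_flux T' S U R + (-1) * unit_flux T S U R"
      let ?F = "\<lambda>U R. (?h' / DIM('a)) * (?E U R + (DIM('a) / ?h) * F U R)"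
      have nb: "S \<notin> boundary_sides \<Omega> \<T>" using S by (simp add: interior_sides_def boundary_sides_def)
      have E: "conforming ?E"
        using conforming_interior_unit_flux[OF S T' f(2) T f(1)] False by simp
      have "conforming F" using F(1) by (simp add: adm_def)
      then have "conforming ?F" by (rule conforming_scale[OF conforming_add[OF E conforming_scale]])
      moreover have "?F (side_element \<T> R) R = 0" if R: "R \<in> sides_on \<Omega> \<T> \<Gamma>N" for R
      proof -
        have "R \<noteq> S" using nb sides_on_boundary[OF R] by blast
        then show ?thesis using F(1) R by (simp add: adm_def unit_flux_def)
      qed
      moreover have "local_div ?F U = (if U = T' then 1 else 0)" for U
        unfolding local_div_scale local_div_add local_div_unit_flux[OF T f(1)] local_div_unit_flux[OF T' f(2)] F(2)
        using False facet_height_pos[OF element_simplex[OF T'] f(2)] by auto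
      ultimately show ?thesis unfolding G_def adm_def using T' by blast
    qed (use TG in simp)
  qed
  then show thesis using T that unfolding G_def adm_def by blast
qed

text \<open>The fluxes through \<open>\<Gamma>N\<close> are prescribed first, and the divergence is then corrected element by element
without changing them.\<close>

lemma exists_flux_with_div:
  assumes dec: "boundary_decomposition \<Omega> \<T> \<Gamma>D \<Gamma>N"
  obtains F where "conforming F" "\<And>S. S \<in> sides_on \<Omega> \<T> \<Gamma>N \<Longrightarrow> F (side_element \<T> S) S = g S"
    "\<And>T. T \<in> \<T> \<Longrightarrow> local_div F T = c T"
proof -
  define F0 where "F0 T S = (if S \<in> sides_on \<Omega> \<T> \<Gamma>N then g S else 0)" for T S :: "'a set"
  have F0: "conforming F0"
    unfolding conforming_def F0_def by (auto simp: interior_sides_def sides_on_def boundary_sides_def)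
  have "\<forall>T\<in>\<T>. \<exists>F. conforming F \<and> (\<forall>S\<in>sides_on \<Omega> \<T> \<Gamma>N. F (side_element \<T> S) S = 0) \<and>
      (\<forall>T'. local_div F T' = (if T' = T then 1 else 0))"
  proof
    fix T assume "T \<in> \<T>"
    from exists_flux_div_indicator[OF dec this] show "\<exists>F. conforming F \<and> (\<forall>S\<in>sides_on \<Omega> \<T> \<Gamma>N. F (side_element \<T> S) S = 0) \<and>
      (\<forall>T'. local_div F T' = (if T' = T then 1 else 0))" by metis
  qed
  from bchoice[OF this] obtain E where E: "\<And>T. T \<in> \<T> \<Longrightarrow> conforming (E T)"
    "\<And>T S. T \<in> \<T> \<Longrightarrow> S \<in> sides_on \<Omega> \<T> \<Gamma>N \<Longrightarrow> E T (side_element \<T> S) S = 0"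
    "\<And>T T'. T \<in> \<T> \<Longrightarrow> local_div (E T) T' = (if T' = T then 1 else 0)" by blast
  define d where "d T = c T - local_div F0 T" for T
  define F where "F U R = F0 U R + (\<Sum>T\<in>\<T>. d T * E T U R)" for U R
  have sum_conf: "conforming (\<lambda>U R. \<Sum>T\<in>A. d T * E T U R)
      \<and> (\<forall>U. local_div (\<lambda>U R. \<Sum>T\<in>A. d T * E T U R) U = (\<Sum>T\<in>A. d T * local_div (E T) U))"
    if "finite A" "A \<subseteq> \<T>" for A
    using that
  proof (induction A rule: finite_induct)
    case empty
    then show ?case by (simp add: conforming_def local_div_def)
  next
    case (insert T A)
    then show ?case
      using conforming_add[OF conforming_scale[OF E(1)[of T]], of "\<lambda>U R. \<Sum>T\<in>A. d T * E T U R"]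
      by (simp add: local_div_add local_div_scale)
  qed
  note sc = sum_conf[OF finite_elements order_refl]
  show thesis
  proof (rule that)
    show "conforming F" unfolding F_def[abs_def] by (rule conforming_add[OF F0 conjunct1[OF sc]])
    show "F (side_element \<T> S) S = g S" if "S \<in> sides_on \<Omega> \<T> \<Gamma>N" for S
      using that E(2) by (simp add: F_def F0_def)
    show "local_div F T = c T" if T: "T \<in> \<T>" for T
    proof -
      have "local_div F T = local_div F0 T + (\<Sum>T'\<in>\<T>. d T' * local_div (E T') T)"
        unfolding F_def[abs_def] using sc by (simp add: local_div_add)
      also have "(\<Sum>T'\<in>\<T>. d T' * local_div (E T') T) = (\<Sum>T'\<in>\<T>. if T' = T then d T else 0)"
        using E(3) by (intro sum.cong) auto
      finally show ?thesis using T finite_elements by (simp add: d_def)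
    qed
  qed
qed

lemma K_rt_iff:
  assumes y: "has_fluxes y F" "y \<in> RT \<Omega> \<T>" and f: "\<And>T x. T \<in> \<T> \<Longrightarrow> x \<in> interior T \<Longrightarrow> f x = c T"
  shows "y \<in> K_rt \<Omega> \<T> \<Gamma>N f g \<longleftrightarrow> (\<forall>T\<in>\<T>. local_div F T = - c T) \<and> (\<forall>S\<in>sides_on \<Omega> \<T> \<Gamma>N. F (side_element \<T> S) S = g S)"
proof -
  have "(AE x in lebesgue_on \<Omega>. divergence y x = - f x) \<longleftrightarrow> (\<forall>T\<in>\<T>. local_div F T = - c T)"
  proof
    assume AE: "AE x in lebesgue_on \<Omega>. divergence y x = - f x"
    show "\<forall>T\<in>\<T>. local_div F T = - c T"
    proof
      fix T assume T: "T \<in> \<T>"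
      obtain x where "x \<in> interior T" "divergence y x = - f x" by (rule AE_domainD[OF AE T])
      then show "local_div F T = - c T" using has_fluxes_divergence[OF y(1) T] f[OF T] by simp
    qed
  next
    assume "\<forall>T\<in>\<T>. local_div F T = - c T"
    then show "AE x in lebesgue_on \<Omega>. divergence y x = - f x"
      by (intro AE_domainI) (simp add: has_fluxes_divergence[OF y(1)] f)
  qed
  then show ?thesis
    using y(2) AE_boundary_flux_iff[OF y(1)] sides_on_boundary by (simp add: K_rt_def)
qed

text \<open>The dual functional is finite on the nonempty constraint set and \<open>-\<infinity>\<close> outside of it.\<close>

lemma dual_solution_feasible:
  assumes dec: "boundary_decomposition \<Omega> \<T> \<Gamma>D \<Gamma>N" and f: "f \<in> L0 \<T>"
    and z: "is_arg_max (D_rt \<Omega> \<T> \<Gamma>D \<Gamma>N \<zeta> f g uD) (\<lambda>y. y \<in> RT \<Omega> \<T>) z"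
  shows "z \<in> K_rt \<Omega> \<T> \<Gamma>N f g"
proof (rule ccontr)
  assume "z \<notin> K_rt \<Omega> \<T> \<Gamma>N f g"
  then have z_inf: "D_rt \<Omega> \<T> \<Gamma>D \<Gamma>N \<zeta> f g uD z = - \<infinity>" by (simp add: D_rt_def)
  obtain c where c: "\<And>T x. T \<in> \<T> \<Longrightarrow> x \<in> interior T \<Longrightarrow> f x = c T" using L0_values[OF f] by blast
  obtain F where F: "conforming F" "\<And>S. S \<in> sides_on \<Omega> \<T> \<Gamma>N \<Longrightarrow> F (side_element \<T> S) S = g S"
    "\<And>T. T \<in> \<T> \<Longrightarrow> local_div F T = - c T"
    by (rule exists_flux_with_div[OF dec, of g "\<lambda>T. - c T"]) blast
  let ?y = "flux_field F"
  have RT: "?y \<in> RT \<Omega> \<T>" by (rule RT_flux_field[OF F(1)])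
  have "?y \<in> K_rt \<Omega> \<T> \<Gamma>N f g"
    using K_rt_iff[OF has_fluxes_flux_field RT, of f c] c F(2,3) by blast
  then have "D_rt \<Omega> \<T> \<Gamma>D \<Gamma>N \<zeta> f g uD z < D_rt \<Omega> \<T> \<Gamma>D \<Gamma>N \<zeta> f g uD ?y"
    unfolding z_inf by (simp add: D_rt_def)
  then show False using z RT unfolding is_arg_max_def by blast
qed

lemma Dirichlet_Neumann_sides:
  assumes dec: "boundary_decomposition \<Omega> \<T> \<Gamma>D \<Gamma>N"
  shows "boundary_sides \<Omega> \<T> = sides_on \<Omega> \<T> \<Gamma>D \<union> sides_on \<Omega> \<T> \<Gamma>N"
    and "sides_on \<Omega> \<T> \<Gamma>D \<inter> sides_on \<Omega> \<T> \<Gamma>N = {}" and "finite (sides_on \<Omega> \<T> \<Gamma>)"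
proof -
  show "boundary_sides \<Omega> \<T> = sides_on \<Omega> \<T> \<Gamma>D \<union> sides_on \<Omega> \<T> \<Gamma>N" "sides_on \<Omega> \<T> \<Gamma>D \<inter> sides_on \<Omega> \<T> \<Gamma>N = {}"
    using dec sides_on_boundary unfolding boundary_decomposition_def by blast+
  show "finite (sides_on \<Omega> \<T> \<Gamma>)"
    using finite_sides by (rule rev_finite_subset) (auto simp: sides_on_def boundary_sides_def)
qed

lemma RT_N_flux_field:
  assumes F: "conforming F" and zero: "\<And>S. S \<in> sides_on \<Omega> \<T> \<Gamma>N \<Longrightarrow> F (side_element \<T> S) S = 0"
  shows "flux_field F \<in> RT_N \<Omega> \<T> \<Gamma>N"
  using RT_flux_field[OF F] AE_boundary_flux_iff[OF has_fluxes_flux_field sides_on_boundary] zero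
  by (simp add: RT_N_def)

text \<open>The equation determines the side averages of \<open>v\<close>, since it may be tested with one side at a time.\<close>

lemma multiplier_reconstruction_CR:
  assumes dec: "boundary_decomposition \<Omega> \<T> \<Gamma>D \<Gamma>N" and v: "has_pieces v \<sigma> \<gamma>"
    and eq: "\<And>F. conforming F \<Longrightarrow> (\<And>S. S \<in> sides_on \<Omega> \<T> \<Gamma>N \<Longrightarrow> F (side_element \<T> S) S = 0) \<Longrightarrow>
      (\<Sum>T\<in>\<T>. measure lebesgue T * (\<sigma> T \<bullet> local_field F T (centroid T)))
      + (\<Sum>T\<in>\<T>. measure lebesgue T * ((\<sigma> T \<bullet> centroid T + \<gamma> T) * local_div F T))
      = (\<Sum>S\<in>sides_on \<Omega> \<T> \<Gamma>D. F (side_element \<T> S) S * (side_area S * uD S))"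
  shows "v \<in> CR \<Omega> \<T>" and "\<And>S. S \<in> sides_on \<Omega> \<T> \<Gamma>D \<Longrightarrow> side_proj \<T> v S = uD S"
proof -
  let ?A = "\<lambda>T S. side_area S * (\<sigma> T \<bullet> side_centroid S + \<gamma> T)"
  have test: "(\<Sum>T\<in>\<T>. \<Sum>S | S facet_of T. F T S * ?A T S)
      = (\<Sum>S\<in>sides_on \<Omega> \<T> \<Gamma>D. F (side_element \<T> S) S * (side_area S * uD S))"
    if "conforming F" "\<And>S. S \<in> sides_on \<Omega> \<T> \<Gamma>N \<Longrightarrow> F (side_element \<T> S) S = 0" for F
    using eq[OF that] unfolding green_sides .
  show "v \<in> CR \<Omega> \<T>"
    unfolding CR_iff[OF v]
  proof (intro ballI impI)
    fix S T T' assume S: "S \<in> interior_sides \<Omega> \<T>" and T: "T \<in> \<T>" "T' \<in> \<T>"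
      and f: "T \<noteq> T' \<and> S facet_of T \<and> S facet_of T'"
    let ?F = "\<lambda>U R. unit_flux T S U R - unit_flux T' S U R"
    have zero: "?F (side_element \<T> R) R = 0" if "R \<in> sides_on \<Omega> \<T> \<Gamma>" for R \<Gamma>
    proof -
      have "R \<noteq> S" using S sides_on_boundary[OF that] by (auto simp: interior_sides_def boundary_sides_def)
      then show ?thesis by (simp add: unit_flux_def)
    qed
    have "conforming ?F" using S T f by (intro conforming_interior_unit_flux) auto
    from test[OF this zero] have "(\<Sum>T\<in>\<T>. \<Sum>S | S facet_of T. ?F T S * ?A T S)
        = (\<Sum>R\<in>sides_on \<Omega> \<T> \<Gamma>D. ?F (side_element \<T> R) R * (side_area R * uD R))" .
    also have "\<dots> = 0" by (intro sum.neutral ballI) (simp only: zero mult_zero_left)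
    finally have "(\<Sum>T\<in>\<T>. \<Sum>S | S facet_of T. ?F T S * ?A T S) = 0" .
    then have "?A T S - ?A T' S = 0"
      using sum_unit_flux[of T S ?A] sum_unit_flux[of T' S ?A] T f
      by (simp only: left_diff_distrib sum_subtractf)
    then show "\<sigma> T \<bullet> side_centroid S + \<gamma> T = \<sigma> T' \<bullet> side_centroid S + \<gamma> T'"
      using side_area_pos[OF element_simplex[OF T(1)], of S] f by (simp flip: right_diff_distrib)
  qed
  show "side_proj \<T> v S = uD S" if SD: "S \<in> sides_on \<Omega> \<T> \<Gamma>D" for S
  proof -
    have S: "S \<in> boundary_sides \<Omega> \<T>" using SD by (rule sides_on_boundary)
    let ?T = "side_element \<T> S"
    note E = side_element(1,2)[OF S]
    have "unit_flux ?T S (side_element \<T> R) R = 0" if "R \<in> sides_on \<Omega> \<T> \<Gamma>N" for R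
      using that SD Dirichlet_Neumann_sides(2)[OF dec] by (auto simp: unit_flux_def)
    from test[OF conforming_boundary_unit_flux[OF S] this]
    have "?A ?T S = (\<Sum>R\<in>sides_on \<Omega> \<T> \<Gamma>D. unit_flux ?T S (side_element \<T> R) R * (side_area R * uD R))"
      by (simp only: sum_unit_flux[OF E])
    also have "\<dots> = (\<Sum>R\<in>sides_on \<Omega> \<T> \<Gamma>D. if R = S then side_area S * uD S else 0)"
      by (intro sum.cong) (auto simp: unit_flux_def)
    also have "\<dots> = side_area S * uD S" using SD Dirichlet_Neumann_sides(3)[OF dec] by simp
    finally show ?thesis
      using side_area_pos[OF element_simplex[OF E(1)] E(2)] by (simp add: side_proj_pieces[OF v S])
  qed
qed

end

section \<open>Minimality of the reconstruction\<close>

definition ball_projection :: "real \<Rightarrow> 'a::real_normed_vector \<Rightarrow> 'a" where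
  "ball_projection r s = (if norm s \<le> r then s else (r / norm s) *\<^sub>R s)"

lemma norm_ball_projection: "0 \<le> r \<Longrightarrow> norm (ball_projection r s) \<le> r"
  by (auto simp: ball_projection_def)

text \<open>Completing the square, the functional is half the squared distance to \<open>s\<close> up to a constant, so that it is
minimized over the ball by the projection of \<open>s\<close>.  The quadratic gap yields uniqueness.\<close>

lemma ball_projection_strongly_optimal:
  fixes s a :: "'a::real_inner"
  assumes r: "0 \<le> r" and a: "norm a \<le> r"
  shows "(norm (ball_projection r s))\<^sup>2 / 2 - ball_projection r s \<bullet> s + (norm (a - ball_projection r s))\<^sup>2 / 2 \<le> (norm a)\<^sup>2 / 2 - a \<bullet> s"
proof -
  let ?t = "ball_projection r s"
  \<comment> \<open>The variational inequality of the projection onto a convex set.\<close>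
  have "(a - ?t) \<bullet> (s - ?t) \<le> 0"
  proof (cases "norm s \<le> r")
    case True then show ?thesis by (simp add: ball_projection_def)
  next
    case False
    define q where "q = r / norm s"
    have q: "0 \<le> q" "q \<le> 1" "q * norm s = r" and t: "?t = q *\<^sub>R s"
      using False r by (auto simp: q_def ball_projection_def divide_le_eq)
    have "a \<bullet> s \<le> r * norm s"
      using norm_cauchy_schwarz[of a s] a mult_right_mono[OF a norm_ge_zero[of s]] by linarith
    then have "(a - ?t) \<bullet> s \<le> 0"
      unfolding t using q(3) by (simp add: inner_diff_left dot_square_norm power2_eq_square flip: mult.assoc)
    then have "(1 - q) * ((a - ?t) \<bullet> s) \<le> 0" using q by (simp add: mult_nonneg_nonpos)
    moreover have "s - ?t = (1 - q) *\<^sub>R s" by (simp add: t algebra_simps)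
    ultimately show ?thesis by simp
  qed
  moreover have "(norm a)\<^sup>2 / 2 - a \<bullet> s = (norm ?t)\<^sup>2 / 2 - ?t \<bullet> s + (norm (a - ?t))\<^sup>2 / 2 - (a - ?t) \<bullet> (s - ?t)"
    by (simp add: power2_norm_eq_inner inner_diff_left inner_diff_right inner_commute[of ?t a] inner_commute[of s] field_simps)
  ultimately show ?thesis by linarith
qed

context simplicial_mesh
begin

text \<open>The load terms in \<open>f\<close> and \<open>g\<close> are the divergence and the Neumann fluxes of the field given by \<open>F\<close>.
Integration by parts moves them to the gradient of \<open>v\<close>, and leaves the fluxes through \<open>\<Gamma>D\<close>, where the
averages of \<open>v\<close> are prescribed.\<close>

lemma primal_energy_eq:
  assumes dec: "boundary_decomposition \<Omega> \<T> \<Gamma>D \<Gamma>N" and f: "\<And>T x. T \<in> \<T> \<Longrightarrow> x \<in> interior T \<Longrightarrow> f x = c T"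
    and F: "conforming F" "\<And>T. T \<in> \<T> \<Longrightarrow> local_div F T = - c T"
      "\<And>S. S \<in> sides_on \<Omega> \<T> \<Gamma>N \<Longrightarrow> F (side_element \<T> S) S = g S"
    and v: "has_pieces v \<alpha> \<gamma>" and K: "v \<in> K_cr \<Omega> \<T> \<Gamma>D \<zeta> uD"
  shows "I_cr \<Omega> \<T> \<Gamma>D \<Gamma>N \<zeta> f g uD v =
    ereal ((\<Sum>T\<in>\<T>. measure lebesgue T * ((norm (\<alpha> T))\<^sup>2 / 2 - \<alpha> T \<bullet> local_field F T (centroid T)))
      + (\<Sum>S\<in>sides_on \<Omega> \<T> \<Gamma>D. F (side_element \<T> S) S * (side_area S * uD S)))"
proof -
  have CR: "v \<in> CR \<Omega> \<T>" and bc: "\<And>S. S \<in> sides_on \<Omega> \<T> \<Gamma>D \<Longrightarrow> side_proj \<T> v S = uD S"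
    using K by (auto simp: K_cr_def)
  let ?P = "\<lambda>S. F (side_element \<T> S) S * (side_area S * side_proj \<T> v S)"
  have "(\<Sum>S\<in>boundary_sides \<Omega> \<T>. ?P S) = (\<Sum>S\<in>sides_on \<Omega> \<T> \<Gamma>D. ?P S) + (\<Sum>S\<in>sides_on \<Omega> \<T> \<Gamma>N. ?P S)"
    unfolding Dirichlet_Neumann_sides(1)[OF dec]
    by (rule sum.union_disjoint) (use Dirichlet_Neumann_sides(2,3)[OF dec] in auto)
  also have "(\<Sum>S\<in>sides_on \<Omega> \<T> \<Gamma>N. ?P S) = side_pairing \<Omega> \<T> \<Gamma>N g (side_proj \<T> v)"
    by (simp add: side_pairing_eq F(3))
  also have "(\<Sum>S\<in>sides_on \<Omega> \<T> \<Gamma>D. ?P S) = (\<Sum>S\<in>sides_on \<Omega> \<T> \<Gamma>D. F (side_element \<T> S) S * (side_area S * uD S))"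
    by (simp add: bc)
  finally have bd: "side_pairing \<Omega> \<T> \<Gamma>N g (side_proj \<T> v)
      = (\<Sum>T\<in>\<T>. measure lebesgue T * (\<alpha> T \<bullet> local_field F T (centroid T)))
        + (\<Sum>T\<in>\<T>. measure lebesgue T * ((\<alpha> T \<bullet> centroid T + \<gamma> T) * local_div F T))
        - (\<Sum>S\<in>sides_on \<Omega> \<T> \<Gamma>D. F (side_element \<T> S) S * (side_area S * uD S))"
    unfolding green_boundary[OF v CR F(1)] by simp
  have "L2_inner \<Omega> f (elem_proj \<T> v) = (\<Sum>T\<in>\<T>. measure lebesgue T * (c T * (\<alpha> T \<bullet> centroid T + \<gamma> T)))"
    unfolding L2_inner_def by (rule integral_piecewise_constant) (simp add: f has_pieces_elem_proj[OF v])
  also have "\<dots> = - (\<Sum>T\<in>\<T>. measure lebesgue T * ((\<alpha> T \<bullet> centroid T + \<gamma> T) * local_div F T))"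
    by (simp add: F(2) sum_negf mult.commute)
  finally have L: "L2_inner \<Omega> f (elem_proj \<T> v) = \<dots>" .
  have "(LINT x|lebesgue_on \<Omega>. (norm (grad v x))\<^sup>2) = (\<Sum>T\<in>\<T>. measure lebesgue T * (norm (\<alpha> T))\<^sup>2)"
    by (rule integral_piecewise_constant) (simp add: has_pieces_grad[OF v])
  then have "(1/2) * (LINT x|lebesgue_on \<Omega>. (norm (grad v x))\<^sup>2)
      - (\<Sum>T\<in>\<T>. measure lebesgue T * (\<alpha> T \<bullet> local_field F T (centroid T)))
      = (\<Sum>T\<in>\<T>. measure lebesgue T * ((norm (\<alpha> T))\<^sup>2 / 2 - \<alpha> T \<bullet> local_field F T (centroid T)))"
    by (simp add: sum_distrib_left right_diff_distrib sum_subtractf)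
  then show ?thesis using K by (simp add: I_cr_def bd L)
qed

text \<open>The difference of the two functions is constant on each element; continuity of the side averages spreads
its zero next to \<open>\<Gamma>D\<close> to all elements.\<close>

lemma CR_unique:
  assumes dec: "boundary_decomposition \<Omega> \<T> \<Gamma>D \<Gamma>N" and u: "has_pieces u \<sigma> \<gamma>" "u \<in> CR \<Omega> \<T>"
    and v: "has_pieces v \<sigma> \<delta>" "v \<in> CR \<Omega> \<T>"
    and bc: "\<And>S. S \<in> sides_on \<Omega> \<T> \<Gamma>D \<Longrightarrow> side_proj \<T> u S = side_proj \<T> v S" and T: "T \<in> \<T>"
  shows "\<gamma> T = \<delta> T"
proof -
  define G where "G = {T \<in> \<T>. \<gamma> T = \<delta> T}"
  have "G = \<T>"
  proof (rule side_connected)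
    show "G \<subseteq> \<T>" by (auto simp: G_def)
    obtain S where S: "S \<in> sides_on \<Omega> \<T> \<Gamma>D" using exists_Dirichlet_side[OF dec] by blast
    note S' = sides_on_boundary[OF S]
    have "side_element \<T> S \<in> G"
      using bc[OF S] side_element(1)[OF S'] by (simp add: side_proj_pieces[OF u(1) S'] side_proj_pieces[OF v(1) S'] G_def)
    then show "G \<noteq> {}" by blast
    fix S T T' assume S: "S \<in> interior_sides \<Omega> \<T>" and TG: "T \<in> G" and T': "T' \<in> \<T>" and f: "S facet_of T" "S facet_of T'"
    show "T' \<in> G"
    proof (cases "T = T'")
      case False
      have T: "T \<in> \<T>" "\<gamma> T = \<delta> T" using TG by (auto simp: G_def)
      have "\<sigma> T \<bullet> side_centroid S + \<gamma> T = \<sigma> T' \<bullet> side_centroid S + \<gamma> T'"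
        using u(2) S T(1) T' f False unfolding CR_iff[OF u(1)] by blast
      moreover have "\<sigma> T \<bullet> side_centroid S + \<delta> T = \<sigma> T' \<bullet> side_centroid S + \<delta> T'"
        using v(2) S T(1) T' f False unfolding CR_iff[OF v(1)] by blast
      ultimately show ?thesis using T(2) T' by (simp add: G_def)
    qed (use TG in simp)
  qed
  then show ?thesis using T by (auto simp: G_def)
qed

text \<open>The energy of any admissible function exceeds that of \<open>v\<close> by at least half the squared distance of
their gradients.\<close>

lemma minimizer_pieces:
  assumes dec: "boundary_decomposition \<Omega> \<T> \<Gamma>D \<Gamma>N" and f: "\<And>T x. T \<in> \<T> \<Longrightarrow> x \<in> interior T \<Longrightarrow> f x = c T"
    and \<zeta>: "\<And>T x. T \<in> \<T> \<Longrightarrow> x \<in> interior T \<Longrightarrow> \<zeta> x = r T" "\<And>T. T \<in> \<T> \<Longrightarrow> r T \<ge> 0"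
    and F: "conforming F" "\<And>T. T \<in> \<T> \<Longrightarrow> local_div F T = - c T"
      "\<And>S. S \<in> sides_on \<Omega> \<T> \<Gamma>N \<Longrightarrow> F (side_element \<T> S) S = g S"
    and v: "has_pieces v (\<lambda>T. ball_projection (r T) (local_field F T (centroid T))) \<delta>" "v \<in> CR \<Omega> \<T>"
      "\<And>S. S \<in> sides_on \<Omega> \<T> \<Gamma>D \<Longrightarrow> side_proj \<T> v S = uD S"
    and u: "is_arg_min (I_cr \<Omega> \<T> \<Gamma>D \<Gamma>N \<zeta> f g uD) (\<lambda>v. v \<in> CR \<Omega> \<T>) u"
  shows "has_pieces u (\<lambda>T. ball_projection (r T) (local_field F T (centroid T))) \<delta>"
proof -
  let ?s = "\<lambda>T. local_field F T (centroid T)"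
  let ?t = "\<lambda>T. ball_projection (r T) (?s T)"
  let ?I = "I_cr \<Omega> \<T> \<Gamma>D \<Gamma>N \<zeta> f g uD"
  let ?J = "\<lambda>\<alpha>. \<Sum>T\<in>\<T>. measure lebesgue T * ((norm (\<alpha> T))\<^sup>2 / 2 - \<alpha> T \<bullet> ?s T)"
  have vK: "v \<in> K_cr \<Omega> \<T> \<Gamma>D \<zeta> uD"
    unfolding K_cr_def using v(2,3) \<zeta>
    by (auto intro!: AE_domainI simp: has_pieces_grad[OF v(1)] norm_ball_projection)
  let ?C = "\<Sum>S\<in>sides_on \<Omega> \<T> \<Gamma>D. F (side_element \<T> S) S * (side_area S * uD S)"
  have energy: "?I w = ereal (?J \<alpha> + ?C)" if "has_pieces w \<alpha> \<gamma>" "w \<in> K_cr \<Omega> \<T> \<Gamma>D \<zeta> uD" for w \<alpha> \<gamma>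
    by (rule primal_energy_eq[OF dec f F that])
  note Iv = energy[OF v(1) vK]
  have uCR: "u \<in> CR \<Omega> \<T>" and min: "\<not> ?I v < ?I u" using u v(2) by (auto simp: is_arg_min_def)
  have uK: "u \<in> K_cr \<Omega> \<T> \<Gamma>D \<zeta> uD"
  proof (rule ccontr)
    assume "u \<notin> K_cr \<Omega> \<T> \<Gamma>D \<zeta> uD"
    then have "?I u = \<infinity>" by (simp add: I_cr_def)
    then show False using min Iv by simp
  qed
  obtain \<alpha> \<gamma> where u\<alpha>: "has_pieces u \<alpha> \<gamma>" using uCR L1_pieces[of u] by (auto simp: CR_def)
  have le: "?J \<alpha> \<le> ?J ?t"
    using min unfolding Iv energy[OF u\<alpha> uK] by simp
  have norm\<alpha>: "norm (\<alpha> T) \<le> r T" if T: "T \<in> \<T>" for T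
  proof -
    have "AE x in lebesgue_on \<Omega>. norm (grad u x) \<le> \<zeta> x" using uK by (simp add: K_cr_def)
    then obtain x where "x \<in> interior T" "norm (grad u x) \<le> \<zeta> x" by (rule AE_domainD[OF _ T])
    then show ?thesis using \<zeta>(1)[OF T] has_pieces_grad[OF u\<alpha> T] by simp
  qed
  have pos: "measure lebesgue T > 0" if "T \<in> \<T>" for T
    using measure_simplex_pos(1)[OF element_simplex[OF that]] .
  let ?e = "\<lambda>T. measure lebesgue T * ((norm (\<alpha> T - ?t T))\<^sup>2 / 2)"
  have "(\<Sum>T\<in>\<T>. ?e T) + ?J ?t \<le> ?J \<alpha>"
    unfolding sum.distrib[symmetric] distrib_left[symmetric]
  proof (intro sum_mono mult_left_mono)
    fix T assume T: "T \<in> \<T>"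
    show "(norm (\<alpha> T - ?t T))\<^sup>2 / 2 + ((norm (?t T))\<^sup>2 / 2 - ?t T \<bullet> ?s T) \<le> (norm (\<alpha> T))\<^sup>2 / 2 - \<alpha> T \<bullet> ?s T"
      using ball_projection_strongly_optimal[OF \<zeta>(2)[OF T] norm\<alpha>[OF T], of "?s T"] by linarith
  qed simp
  then have "(\<Sum>T\<in>\<T>. ?e T) \<le> 0" using le by linarith
  then have "(\<Sum>T\<in>\<T>. ?e T) = 0" by (intro antisym sum_nonneg) auto
  then have "\<forall>T\<in>\<T>. ?e T = 0" using finite_elements by (subst (asm) sum_nonneg_eq_0_iff) auto
  then have \<alpha>t: "\<alpha> T = ?t T" if "T \<in> \<T>" for T using that pos[OF that] by force
  then have u': "has_pieces u ?t \<gamma>" using u\<alpha> by (simp add: has_pieces_def)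
  have "\<gamma> T = \<delta> T" if "T \<in> \<T>" for T
    by (rule CR_unique[OF dec u' uCR v(1,2) _ that]) (use uK v(3) in \<open>simp add: K_cr_def\<close>)
  then show ?thesis using u' by (simp add: has_pieces_def)
qed

end

theorem theorem5p4:
  fixes \<Omega> \<Gamma>D \<Gamma>N :: "(real ^ 'd) set"
    and \<T> :: "(real ^ 'd) set set"
    and f \<zeta> lam u :: "real ^ 'd \<Rightarrow> real"
    and g uD :: "(real ^ 'd) set \<Rightarrow> real"
    and z :: "real ^ 'd \<Rightarrow> real ^ 'd"
  assumes "bounded \<Omega>" and "lipschitz_domain \<Omega>"
    and "triangulation_of \<Omega> \<T>"
    and "boundary_decomposition \<Omega> \<T> \<Gamma>D \<Gamma>N"
    and "f \<in> L0 \<T>"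
    and "\<zeta> \<in> L0 \<T>" and "- esssup (lebesgue_on \<Omega>) (\<lambda>x. - ereal (\<zeta> x)) > 0"
    and "\<exists>uD_hat \<in> CR \<Omega> \<T>. (\<forall>S\<in>sides_on \<Omega> \<T> \<Gamma>D. side_proj \<T> uD_hat S = uD S) \<and>
           esssup (lebesgue_on \<Omega>) (\<lambda>x. ereal (norm (grad uD_hat x /\<^sub>R \<zeta> x))) < 1"
    and "is_arg_max (D_rt \<Omega> \<T> \<Gamma>D \<Gamma>N \<zeta> f g uD) (\<lambda>y. y \<in> RT \<Omega> \<T>) z"
    and "lam \<in> L0 \<T>"
    and "\<And>y. y \<in> RT_N \<Omega> \<T> \<Gamma>N \<Longrightarrow>
           - L2_inner \<Omega> (\<lambda>x. Dt_phi_star \<zeta> x (elem_proj \<T> z x)) (elem_proj \<T> y)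
           - L2_inner \<Omega> lam (divergence y) = - flux_pairing \<Omega> \<T> \<Gamma>D y uD"
    and "\<And>\<eta>. \<eta> \<in> L0 \<T> \<Longrightarrow> L2_inner \<Omega> (divergence z) \<eta> = - L2_inner \<Omega> f \<eta>"
    and "is_arg_min (I_cr \<Omega> \<T> \<Gamma>D \<Gamma>N \<zeta> f g uD) (\<lambda>v. v \<in> CR \<Omega> \<T>) u"
  shows "(AE x in lebesgue_on \<Omega>.
            u x = lam x + Dt_phi_star \<zeta> x (elem_proj \<T> z x) \<bullet> (x - elem_proj \<T> (\<lambda>x. x) x))
       \<and> (AE x in lebesgue_on \<Omega>. elem_proj \<T> u x = lam x)"
proof -
  note dec = assms(4) and mult = assms(11)
  interpret simplicial_mesh \<Omega> \<T> using assms(2,3) by unfold_locales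
  obtain c where c: "\<And>T x. T \<in> \<T> \<Longrightarrow> x \<in> interior T \<Longrightarrow> f x = c T" using L0_values[OF assms(5)] by blast
  obtain r where r: "\<And>T x. T \<in> \<T> \<Longrightarrow> x \<in> interior T \<Longrightarrow> \<zeta> x = r T" using L0_values[OF assms(6)] by blast
  obtain l where l: "\<And>T x. T \<in> \<T> \<Longrightarrow> x \<in> interior T \<Longrightarrow> lam x = l T" using L0_values[OF assms(10)] by blast
  have r0: "r T \<ge> 0" if T: "T \<in> \<T>" for T
  proof -
    obtain x where x: "x \<in> interior T" "- ereal (\<zeta> x) \<le> esssup (lebesgue_on \<Omega>) (\<lambda>x. - ereal (\<zeta> x))"
      by (rule AE_domainD[OF esssup_AE T])
    have "esssup (lebesgue_on \<Omega>) (\<lambda>x. - ereal (\<zeta> x)) < 0" using assms(7) by (simp add: ereal_less_uminus_reorder)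
    with x(2) have "- ereal (\<zeta> x) < 0" by (rule le_less_trans)
    then show ?thesis using r[OF T x(1)] by simp
  qed
  have zK: "z \<in> K_rt \<Omega> \<T> \<Gamma>N f g" by (rule dual_solution_feasible[OF dec assms(5,9)])
  then have zRT: "z \<in> RT \<Omega> \<T>" by (simp add: K_rt_def)
  obtain F where zF: "has_fluxes z F" and F: "conforming F" by (rule RT_fluxes[OF zRT])
  have Fdiv: "local_div F T = - c T" if "T \<in> \<T>" for T
    using zK that K_rt_iff[OF zF zRT, of f c] c by blast
  have FN: "F (side_element \<T> S) S = g S" if "S \<in> sides_on \<Omega> \<T> \<Gamma>N" for S
    using zK that K_rt_iff[OF zF zRT, of f c] c by blast
  define \<sigma> where "\<sigma> T = ball_projection (r T) (local_field F T (centroid T))" for T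
  define \<gamma> where "\<gamma> T = l T - \<sigma> T \<bullet> centroid T" for T
  define v where "v x = lam x + Dt_phi_star \<zeta> x (elem_proj \<T> z x) \<bullet> (x - elem_proj \<T> (\<lambda>x. x) x)" for x
  have Dt: "Dt_phi_star \<zeta> x (elem_proj \<T> z x) = \<sigma> T" if "T \<in> \<T>" "x \<in> interior T" for T x
    using that by (simp add: Dt_phi_star_def has_fluxes_elem_proj[OF zF] r \<sigma>_def ball_projection_def)
  have v: "has_pieces v \<sigma> \<gamma>"
    by (simp add: has_pieces_def v_def Dt elem_proj_id l \<gamma>_def inner_diff_right)
  have eq: "(\<Sum>T\<in>\<T>. measure lebesgue T * (\<sigma> T \<bullet> local_field E T (centroid T)))
      + (\<Sum>T\<in>\<T>. measure lebesgue T * ((\<sigma> T \<bullet> centroid T + \<gamma> T) * local_div E T))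
      = (\<Sum>S\<in>sides_on \<Omega> \<T> \<Gamma>D. E (side_element \<T> S) S * (side_area S * uD S))"
    if E: "conforming E" "\<And>S. S \<in> sides_on \<Omega> \<T> \<Gamma>N \<Longrightarrow> E (side_element \<T> S) S = 0" for E
  proof -
    note y = has_fluxes_flux_field[of E]
    have "L2_inner \<Omega> (\<lambda>x. Dt_phi_star \<zeta> x (elem_proj \<T> z x)) (elem_proj \<T> (flux_field E))
        + L2_inner \<Omega> lam (divergence (flux_field E)) = flux_pairing \<Omega> \<T> \<Gamma>D (flux_field E) uD"
      using mult[OF RT_N_flux_field[OF E]] by simp
    moreover have "L2_inner \<Omega> (\<lambda>x. Dt_phi_star \<zeta> x (elem_proj \<T> z x)) (elem_proj \<T> (flux_field E))
        = (\<Sum>T\<in>\<T>. measure lebesgue T * (\<sigma> T \<bullet> local_field E T (centroid T)))"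
      by (rule L2_inner_elem_proj[OF y Dt])
    moreover have "L2_inner \<Omega> lam (divergence (flux_field E)) = (\<Sum>T\<in>\<T>. measure lebesgue T * (l T * local_div E T))"
      by (rule L2_inner_divergence[OF y l])
    ultimately show ?thesis by (simp add: flux_pairing_eq[OF y] \<gamma>_def)
  qed
  have vCR: "v \<in> CR \<Omega> \<T>" by (rule multiplier_reconstruction_CR(1)[OF dec v eq])
  have vD: "side_proj \<T> v S = uD S" if "S \<in> sides_on \<Omega> \<T> \<Gamma>D" for S
    by (rule multiplier_reconstruction_CR(2)[OF dec v eq that])
  have u: "has_pieces u \<sigma> \<gamma>"
    unfolding \<sigma>_def[abs_def]
    by (rule minimizer_pieces[OF dec c r r0 F Fdiv FN v[unfolded \<sigma>_def[abs_def]] vCR vD assms(13)])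
  have "u x = v x" if "T \<in> \<T>" "x \<in> interior T" for T x using u v that by (simp add: has_pieces_def)
  moreover have "elem_proj \<T> u x = lam x" if "T \<in> \<T>" "x \<in> interior T" for T x
    using that by (simp add: has_pieces_elem_proj[OF u] l \<gamma>_def)
  ultimately show ?thesis unfolding v_def by (intro conjI AE_domainI) auto
qed

end
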